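(* Assume that $u\in H^1_+\cap L^2_s$ for some $s>\frac12$. For $\lambda\in(0,+\infty)\setminus\sigma_{pp}(\mathbb{L}_u)$, let $\phi_\lambda^\pm,\psi_\lambda^\pm\in L^\infty_{-s}$ be the Jost functions of $\mathbb{L}_u$ (defined in the context), and set $$\Gamma(\lambda):=1+i\int_{\mathbb{R}}u\,\Pi(\overline u\psi_\lambda^+)\,e^{-i\lambda y}\,dy,\qquad \beta(\lambda):=i\int_{\mathbb{R}}\big(u+u\,\Pi(\overline u\phi_\lambda^+)\big)e^{-i\lambda y}\,dy .$$ Then for every $\lambda\in(0,+\infty)\setminus\sigma_{pp}(\mathbb{L}_u)$ the following identities hold: $$\psi_\lambda^+=\Gamma(\lambda)\psi_\lambda^-,\qquad \phi_\lambda^+-\phi_\lambda^-=\beta(\lambda)\psi_\lambda^-,\qquad e_\lambda\,\partial_\lambda\big(e_{-\lambda}\psi_\lambda^-\big)=\Big(\frac1{2\pi}\int_{\mathbb{R}}\overline u\,\psi_\lambda^-\,dx\Big)\phi_\lambda^- .$$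
   Context: All functions are complex valued on $\mathbb{R}$. $\hat f(\xi)=\int_{\mathbb{R}} f(x)e^{-ix\xi}\,dx$. $H^\sigma_+=\{f\in H^\sigma(\mathbb{R};\mathbb{C}):\mathrm{supp}\,\hat f\subset[0,+\infty)\}$ for $\sigma\ge0$, and $L^2_+=H^0_+$. $\Pi:L^2\to L^2$ is the Cauchy-Szegő projector, $\widehat{\Pi f}(\xi)=\mathbf{1}_{\xi\ge0}\hat f(\xi)$. $\langle x\rangle=\sqrt{1+x^2}$. $L^2_s=\{f:\int_{\mathbb{R}}|f(x)|^2(1+x^2)^s\,dx<\infty\}$. $L^\infty_{-s}=\{f:\|\langle x\rangle^{-s}f\|_{L^\infty}<\infty\}$. $e_\mu(x)=e^{i\mu x}$ for $\mu\in\mathbb{R}$. The bar denotes complex conjugation. For $u\in H^1_+$ the Lax operator is $\mathbb{L}_u h=-i\partial_xh-u\Pi(\overline u h)$, self-adjoint on $L^2_+$ with domain $H^1_+$; $\sigma_{pp}(\mathbb{L}_u)$ is its set of eigenvalues. If $u\in L^2_s$ and $h\in L^\infty_{-s}$, then $\overline u h\in L^2$ and $\mathbb{L}_u h$ is defined by the same formula in the sense of distributions. Jost functions: for $u\in H^1_+\cap L^2_s$, $s>\frac12$, and $\lambda\in(0,+\infty)\setminus\sigma_{pp}(\mathbb{L}_u)$, $\phi_\lambda^\pm\in L^\infty_{-s}$ are the unique functions with $\mathbb{L}_u\phi_\lambda^\pm=\lambda\phi_\lambda^\pm+u$, $\phi_\lambda^+(x)\to0$ as $x\to-\infty$, $\phi_\lambda^-(x)\to0$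 as $x\to+\infty$; and $\psi_\lambda^\pm\in L^\infty_{-s}$ are the unique functions with $\mathbb{L}_u\psi_\lambda^\pm=\lambda\psi_\lambda^\pm$, $\psi_\lambda^+(x)-e^{i\lambda x}\to0$ as $x\to-\infty$, $\psi_\lambda^-(x)-e^{i\lambda x}\to0$ as $x\to+\infty$. *)

theory Defs
  imports "HOL-Analysis.Analysis"
begin

text \<open>
  Elements of Lebesgue spaces are represented by Borel functions on the line; two representatives
  of the same element are equal almost everywhere with respect to \<open>lborel\<close>.
\<close>

definition L2 :: "(real \<Rightarrow> complex) \<Rightarrow> bool" where
  "L2 f \<longleftrightarrow> f \<in> borel_measurable lborel \<and> integrable lborel (\<lambda>x. (cmod (f x))\<^sup>2)"

definition L2w :: "real \<Rightarrow> (real \<Rightarrow> complex) \<Rightarrow> bool" where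
  "L2w s f \<longleftrightarrow> f \<in> borel_measurable lborel \<and>
     integrable lborel (\<lambda>x. (cmod (f x))\<^sup>2 * (1 + x\<^sup>2) powr s)"

definition jbr :: "real \<Rightarrow> real" where
  "jbr x = sqrt (1 + x\<^sup>2)"

text \<open>\<open>Linfw r\<close> is the space of \<open>f\<close> such that \<open>\<langle>x\<rangle>\<^sup>r f\<close> is essentially bounded;
  the Jost functions live in \<open>Linfw (- s)\<close>.\<close>

definition Linfw :: "real \<Rightarrow> (real \<Rightarrow> complex) \<Rightarrow> bool" where
  "Linfw r f \<longleftrightarrow> f \<in> borel_measurable lborel \<and>
     (\<exists>C. AE x in lborel. jbr x powr r * cmod (f x) \<le> C)"

definition ee :: "real \<Rightarrow> real \<Rightarrow> complex" where
  "ee \<mu> x = exp (\<i> * complex_of_real (\<mu> * x))"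

text \<open>The Fourier transform on \<open>L\<^sup>2\<close> is the limit in \<open>L\<^sup>2\<close> of the Fourier integrals of the
  truncations to \<open>[-R, R]\<close>. By Plancherel's theorem the limit exists for every \<open>L\<^sup>2\<close> function, and
  it is determined up to a null set; \<open>fourier f\<close> and \<open>szego f\<close> are arbitrary representatives.\<close>

definition has_fourier :: "(real \<Rightarrow> complex) \<Rightarrow> (real \<Rightarrow> complex) \<Rightarrow> bool" where
  "has_fourier f F \<longleftrightarrow> L2 F \<and>
     ((\<lambda>R::real. \<integral>\<^sup>+ \<xi>. ennreal ((cmod ((LINT x:{-R..R}|lborel. f x * ee (- \<xi>) x) - F \<xi>))\<^sup>2) \<partial>lborel)
       \<longlongrightarrow> 0) at_top"

definition fourier :: "(real \<Rightarrow> complex) \<Rightarrow> real \<Rightarrow> complex" where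
  "fourier f = (SOME F. has_fourier f F)"

definition szego :: "(real \<Rightarrow> complex) \<Rightarrow> real \<Rightarrow> complex" where
  "szego f = (SOME g. L2 g \<and>
     (AE \<xi> in lborel. fourier g \<xi> = (if \<xi> \<ge> 0 then fourier f \<xi> else 0)))"

text \<open>For \<open>\<sigma> \<ge> 0\<close> this is the Sobolev space of order \<open>\<sigma>\<close> restricted to functions with Fourier
  transform supported in the closed half-line \<open>[0, \<infinity>)\<close>; a square integrable function has its
  (distributional) support there iff it vanishes almost everywhere on the complement.\<close>

definition Hplus :: "real \<Rightarrow> (real \<Rightarrow> complex) \<Rightarrow> bool" where
  "Hplus \<sigma> f \<longleftrightarrow> L2 f \<and>
     L2 (\<lambda>\<xi>. complex_of_real ((1 + \<xi>\<^sup>2) powr (\<sigma> / 2)) * fourier f \<xi>) \<and>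
     (AE \<xi> in lborel. \<xi> < 0 \<longrightarrow> fourier f \<xi> = 0)"

definition vderiv :: "(real \<Rightarrow> complex) \<Rightarrow> real \<Rightarrow> complex" where
  "vderiv f x = vector_derivative f (at x)"

definition test_function :: "(real \<Rightarrow> complex) \<Rightarrow> bool" where
  "test_function \<eta> \<longleftrightarrow>
     (\<forall>n x. ((vderiv ^^ n) \<eta>) differentiable (at x)) \<and> (\<exists>R. \<forall>x. \<bar>x\<bar> > R \<longrightarrow> \<eta> x = 0)"

text \<open>\<open>lax_eq u h f\<close> is the equation \<open>-i \<partial>\<^sub>x h - u \<Pi>(cnj u h) = f\<close> in the sense of distributions;
  the pairing of \<open>-i \<partial>\<^sub>x h\<close> with \<open>\<eta>\<close> is the integral of
  \<open>i h \<eta>'\<close>. It is meaningful when \<open>cnj u h\<close> is in \<open>L\<^sup>2\<close> and \<open>h\<close>, \<open>f\<close> are locally integrable.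
  For \<open>h\<close> in \<open>H\<^sup>1\<close> the distributional derivative is the \<open>L\<^sup>2\<close> derivative, so the same
  equation expresses that \<open>L\<^sub>u h = f\<close> for the self-adjoint operator with domain \<open>Hplus 1\<close>.\<close>

definition lax_eq :: "(real \<Rightarrow> complex) \<Rightarrow> (real \<Rightarrow> complex) \<Rightarrow> (real \<Rightarrow> complex) \<Rightarrow> bool" where
  "lax_eq u h f \<longleftrightarrow> (\<forall>\<eta>. test_function \<eta> \<longrightarrow>
     (LINT x|lborel. \<i> * h x * vderiv \<eta> x)
       - (LINT x|lborel. u x * szego (\<lambda>y. cnj (u y) * h y) x * \<eta> x)
     = (LINT x|lborel. f x * \<eta> x))"

text \<open>The eigenvalues are real because the operator is self-adjoint.\<close>

definition sigma_pp :: "(real \<Rightarrow> complex) \<Rightarrow> real set" where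
  "sigma_pp u = {\<kappa>. \<exists>h. Hplus 1 h \<and> \<not> (AE x in lborel. h x = 0) \<and>
     lax_eq u h (\<lambda>x. complex_of_real \<kappa> * h x)}"

text \<open>A solution of the equations below has a locally integrable distributional derivative, hence
  exactly one continuous representative. The Jost functions are taken to be these
  representatives, so that their limits at infinity, their equality and their derivative in the
  spectral parameter can be read pointwise. In \<open>jost_phi\<close> and \<open>jost_psi\<close> the filter \<open>F\<close>
  is the end of the line at which the function is normalised: \<open>at_bot\<close> for the functions with
  superscript plus, \<open>at_top\<close> for those with superscript minus.\<close>

definition jost_phi :: "real filter \<Rightarrow> (real \<Rightarrow> complex) \<Rightarrow> real \<Rightarrow> real \<Rightarrow> (real \<Rightarrow> complex) \<Rightarrow> bool" where
  "jost_phi F u s \<kappa> \<phi> \<longleftrightarrow> Linfw (- s) \<phi> \<and> continuous_on UNIV \<phi> \<and>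
     lax_eq u \<phi> (\<lambda>x. complex_of_real \<kappa> * \<phi> x + u x) \<and> (\<phi> \<longlongrightarrow> 0) F"

definition jost_psi :: "real filter \<Rightarrow> (real \<Rightarrow> complex) \<Rightarrow> real \<Rightarrow> real \<Rightarrow> (real \<Rightarrow> complex) \<Rightarrow> bool" where
  "jost_psi F u s \<kappa> \<psi> \<longleftrightarrow> Linfw (- s) \<psi> \<and> continuous_on UNIV \<psi> \<and>
     lax_eq u \<psi> (\<lambda>x. complex_of_real \<kappa> * \<psi> x) \<and> ((\<lambda>x. \<psi> x - ee \<kappa> x) \<longlongrightarrow> 0) F"

definition jost_Gamma :: "(real \<Rightarrow> complex) \<Rightarrow> (real \<Rightarrow> real \<Rightarrow> complex) \<Rightarrow> real \<Rightarrow> complex" where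
  "jost_Gamma u \<psi>p \<kappa> =
     1 + \<i> * (LINT y|lborel. u y * szego (\<lambda>x. cnj (u x) * \<psi>p \<kappa> x) y * ee (- \<kappa>) y)"

definition jost_beta :: "(real \<Rightarrow> complex) \<Rightarrow> (real \<Rightarrow> real \<Rightarrow> complex) \<Rightarrow> real \<Rightarrow> complex" where
  "jost_beta u \<phi>p \<kappa> =
     \<i> * (LINT y|lborel. (u y + u y * szego (\<lambda>x. cnj (u x) * \<phi>p \<kappa> x) y) * ee (- \<kappa>) y)"

end

theory Submission
  imports Defs "HOL-Probability.Characteristic_Functions" "HOL-Complex_Analysis.Great_Picard"
begin

text \<open>In the gauge \<open>g = e\<^sub>-\<^sub>\<kappa> h\<close> the equation \<open>L\<^sub>u h = \<kappa> h + c u\<close> becomes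
  \<open>g' = i u \<Pi>\<^sub>\<kappa>(cnj u g) + i c e\<^sub>-\<^sub>\<kappa> u\<close>, where \<open>\<Pi>\<^sub>\<kappa>\<close> projects onto frequencies \<open>\<ge> - \<kappa>\<close>; the
  right-hand side is integrable, so \<open>g\<close> has limits at both ends. For \<open>c = 0\<close> the integral of
  \<open>g' cnj g\<close> is \<open>i \<parallel>\<Pi>\<^sub>\<kappa>(cnj u g)\<parallel>\<^sup>2\<close>, hence \<open>|g(\<infinity>)| = |g(-\<infinity>)|\<close>. A solution that vanishes at one end
  therefore vanishes at both, inherits the decay of \<open>u\<close>, and is an eigenfunction; so it is zero when
  \<open>\<kappa>\<close> is not an eigenvalue. The first two identities follow by comparing limits at \<open>+\<infinity>\<close>.

  For the derivative, the equation with data at \<open>+\<infinity>\<close> is \<open>(I - T\<^sub>\<kappa>) g = 1\<close>. Since \<open>T\<^sub>\<kappa>\<close> is compact on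
  bounded functions and \<open>I - T\<^sub>\<kappa>\<close> is injective, \<open>I - T\<^sub>\<kappa>\<close> is bounded below, also for nearby spectral
  parameters. As \<open>\<Pi>\<^sub>\<mu> - \<Pi>\<^sub>\<kappa>\<close> is the Fourier integral over the thin band \<open>[-\<mu>, -\<kappa>)\<close>, the difference
  quotient of \<open>T\<close> converges to \<open>g \<mapsto> 1 / (2 \<pi>) (\<integral> cnj u e\<^sub>\<kappa> g)\<close> times the source term of \<open>\<phi>\<^sup>-\<close>.\<close>

section \<open>Square integrable functions\<close>

text \<open>\<open>fourier\<close> and \<open>szego\<close> are choices of representatives, so
  nothing can be said about \<open>szego\<close> before the Fourier theory of square integrable
  functions is available, including surjectivity. Identities for the projector hold almost
  everywhere; integration turns them into pointwise ones for the solutions.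

  A solution vanishing at both ends must be shown to lie in \<open>Hplus 1\<close>. The gauged
  equation trades multiplication by the frequency for a square integrable right-hand side. That side
  has no frequency below -\<kappa>, because \<open>u\<close> and the projected factor have only
  nonnegative ones; as \<kappa> > 0, dividing by the frequency there is harmless.

  Equicontinuity gives no uniform control on an unbounded line. Compactness survives because the sup
  norm of \<open>T \<kappa> g\<close> is bounded by the L2 norm of \<open>cnj u * g\<close>, so
  pointwise convergence of bounded functions is enough.

  The Jost functions are given only off the point spectrum, so the derivative needs a neighbourhood
  of \<kappa> free of eigenvalues. An eigenfunction in the gauge would be a fixed point of
  \<open>T \<mu>\<close>, which the lower bound for nearby \<mu> excludes.\<close>

lemma borel_measurable_cnj[measurable]:
  "f \<in> borel_measurable M \<Longrightarrow> (\<lambda>x. cnj (f x)) \<in> borel_measurable M"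
  by (rule measurable_compose[OF _ borel_measurable_continuous_onI]) (auto intro: continuous_intros)

definition l2ip :: "(real \<Rightarrow> complex) \<Rightarrow> (real \<Rightarrow> complex) \<Rightarrow> complex" where
  "l2ip f g = (LINT x|lborel. f x * cnj (g x))"

definition l2n :: "(real \<Rightarrow> complex) \<Rightarrow> real" where
  "l2n f = sqrt (LINT x|lborel. (cmod (f x))\<^sup>2)"

lemma L2_sq: "L2 f \<Longrightarrow> integrable lborel (\<lambda>x. (cmod (f x))\<^sup>2)"
  by (simp add: L2_def)

lemma L2_bound:
  assumes "f \<in> borel_measurable borel" "integrable lborel k" "AE x in lborel. (cmod (f x))\<^sup>2 \<le> k x"
  shows "L2 f"
proof -
  have "integrable lborel (\<lambda>x. (cmod (f x))\<^sup>2)"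
    by (rule Bochner_Integration.integrable_bound[OF assms(2)]) (use assms(1,3) in auto)
  then show ?thesis using assms(1) by (simp add: L2_def)
qed

lemma L2_0[simp]: "L2 (\<lambda>x. 0)"
  by (simp add: L2_def)

lemma sq_add_le: "(cmod (a + b))\<^sup>2 \<le> 2 * (cmod a)\<^sup>2 + 2 * (cmod b)\<^sup>2"
proof -
  have "(cmod (a + b))\<^sup>2 \<le> (cmod a + cmod b)\<^sup>2"
    by (intro power_mono norm_triangle_ineq norm_ge_zero)
  also have "\<dots> \<le> 2 * (cmod a)\<^sup>2 + 2 * (cmod b)\<^sup>2"
    using sum_squares_bound[of "cmod a" "cmod b"] by (simp add: power2_sum)
  finally show ?thesis .
qed

lemma L2_add: assumes "L2 f" "L2 g" shows "L2 (\<lambda>x. f x + g x)"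
  by (rule L2_bound[where k = "\<lambda>x. 2 * (cmod (f x))\<^sup>2 + 2 * (cmod (g x))\<^sup>2"])
     (use assms in \<open>auto simp: L2_def sq_add_le\<close>)

lemma L2_cmult: assumes "L2 f" shows "L2 (\<lambda>x. c * f x)"
  by (rule L2_bound[where k = "\<lambda>x. (cmod c)\<^sup>2 * (cmod (f x))\<^sup>2"])
     (use assms in \<open>auto simp: L2_def norm_mult power_mult_distrib\<close>)

lemma L2_uminus: "L2 f \<Longrightarrow> L2 (\<lambda>x. - f x)"
  using L2_cmult[of f "-1"] by simp

lemma L2_diff: "L2 f \<Longrightarrow> L2 g \<Longrightarrow> L2 (\<lambda>x. f x - g x)"
  using L2_add[OF _ L2_uminus, of f g] by simp

lemma L2_cnj: "L2 f \<Longrightarrow> L2 (\<lambda>x. cnj (f x))"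
  by (auto simp: L2_def)

lemma L2_bounded_mult:
  assumes "L2 f" "m \<in> borel_measurable borel" "AE x in lborel. cmod (m x) \<le> B"
  shows "L2 (\<lambda>x. m x * f x)"
proof (rule L2_bound[where k = "\<lambda>x. B\<^sup>2 * (cmod (f x))\<^sup>2"])
  show "AE x in lborel. (cmod (m x * f x))\<^sup>2 \<le> B\<^sup>2 * (cmod (f x))\<^sup>2"
    using assms(3) by eventually_elim (auto simp: norm_mult power_mult_distrib intro!: mult_right_mono power_mono)
qed (use assms in \<open>auto simp: L2_def\<close>)

lemma L2_cong_AE:
  assumes "L2 f" "g \<in> borel_measurable borel" "AE x in lborel. f x = g x" shows "L2 g"
  by (rule L2_bound[OF assms(2) L2_sq[OF assms(1)]]) (use assms(3) in auto)

lemma L2_mult_integrable: assumes "L2 f" "L2 g" shows "integrable lborel (\<lambda>x. f x * g x)"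
proof (rule Bochner_Integration.integrable_bound[where f = "\<lambda>x. (cmod (f x))\<^sup>2 + (cmod (g x))\<^sup>2"])
  have "cmod (f x) * cmod (g x) \<le> (cmod (f x))\<^sup>2 + (cmod (g x))\<^sup>2" for x
    using sum_squares_bound[of "cmod (f x)" "cmod (g x)"] mult_nonneg_nonneg[OF norm_ge_zero norm_ge_zero, of "f x" "g x"]
    by linarith
  then show "AE x in lborel. norm (f x * g x) \<le> norm ((cmod (f x))\<^sup>2 + (cmod (g x))\<^sup>2)"
    by (auto simp: norm_mult)
qed (use assms in \<open>auto simp: L2_def\<close>)

lemma L2_ip_integrable: "L2 f \<Longrightarrow> L2 g \<Longrightarrow> integrable lborel (\<lambda>x. f x * cnj (g x))"
  using L2_mult_integrable[OF _ L2_cnj] by auto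

lemma l2n_nonneg[simp]: "0 \<le> l2n f"
  by (simp add: l2n_def)

lemma l2n_sq: "(l2n f)\<^sup>2 = (LINT x|lborel. (cmod (f x))\<^sup>2)"
  by (simp add: l2n_def)

lemma l2n_nn: "L2 f \<Longrightarrow> (\<integral>\<^sup>+x. ennreal ((cmod (f x))\<^sup>2) \<partial>lborel) = ennreal ((l2n f)\<^sup>2)"
  unfolding l2n_sq by (rule nn_integral_eq_integral) (auto simp: L2_def)

lemma l2ip_self: "l2ip f f = complex_of_real ((l2n f)\<^sup>2)"
proof -
  have "l2ip f f = (LINT x|lborel. complex_of_real ((cmod (f x))\<^sup>2))"
    unfolding l2ip_def by (simp only: complex_norm_square)
  then show ?thesis by (simp only: integral_complex_of_real l2n_sq)
qed

lemma L2_Cauchy_Schwarz: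
  assumes "L2 f" "L2 g"
  shows "(LINT x|lborel. cmod (f x * g x)) \<le> l2n f * l2n g"
proof -
  let ?I = "LINT x|lborel. cmod (f x * g x)"
  have fg: "integrable lborel (\<lambda>x. cmod (f x * g x))"
    using L2_mult_integrable[OF assms] by auto
  have [measurable]: "f \<in> borel_measurable borel" "g \<in> borel_measurable borel"
    using assms by (auto simp: L2_def)
  have e: "(\<integral>\<^sup>+x. ennreal (cmod (f x)) * ennreal (cmod (g x)) \<partial>lborel) = ennreal ?I"
    using nn_integral_eq_integral[OF fg] by (simp add: norm_mult ennreal_mult)
  have "(ennreal ?I)\<^sup>2 \<le> (\<integral>\<^sup>+x. (ennreal (cmod (f x)))\<^sup>2 \<partial>lborel) * (\<integral>\<^sup>+x. (ennreal (cmod (g x)))\<^sup>2 \<partial>lborel)"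
    unfolding e[symmetric] by (rule Cauchy_Schwarz_nn_integral) auto
  also have "\<dots> = ennreal ((l2n f)\<^sup>2) * ennreal ((l2n g)\<^sup>2)"
    using l2n_nn[OF assms(1)] l2n_nn[OF assms(2)] by (simp add: ennreal_power)
  also have "\<dots> = ennreal ((l2n f * l2n g)\<^sup>2)"
    by (simp add: ennreal_mult power_mult_distrib)
  finally have "?I\<^sup>2 \<le> (l2n f * l2n g)\<^sup>2"
    by (simp add: ennreal_power)
  then show ?thesis by (rule power2_le_imp_le) simp
qed

lemma l2ip_bound: assumes "L2 f" "L2 g" shows "cmod (l2ip f g) \<le> l2n f * l2n g"
proof -
  have "l2n (\<lambda>x. cnj (g x)) = l2n g" by (simp add: l2n_def)
  then show ?thesis
    unfolding l2ip_def
    using L2_Cauchy_Schwarz[OF assms(1) L2_cnj[OF assms(2)]]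
      integral_norm_bound[of lborel "\<lambda>x. f x * cnj (g x)"] by (simp only:)
qed

lemma l2n_add: assumes "L2 f" "L2 g" shows "l2n (\<lambda>x. f x + g x) \<le> l2n f + l2n g"
proof (rule power2_le_imp_le)
  have "(l2n (\<lambda>x. f x + g x))\<^sup>2 \<le> (LINT x|lborel. (cmod (f x))\<^sup>2 + (cmod (g x))\<^sup>2 + 2 * cmod (f x * g x))"
    unfolding l2n_sq
  proof (rule integral_mono)
    show "integrable lborel (\<lambda>x. (cmod (f x))\<^sup>2 + (cmod (g x))\<^sup>2 + 2 * cmod (f x * g x))"
      using assms L2_mult_integrable[OF assms] by (auto simp: L2_def)
    show "(cmod (f x + g x))\<^sup>2 \<le> (cmod (f x))\<^sup>2 + (cmod (g x))\<^sup>2 + 2 * cmod (f x * g x)" for x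
      using power_mono[OF norm_triangle_ineq norm_ge_zero, of "f x" "g x" 2]
      by (simp add: power2_sum norm_mult)
  qed (use L2_add[OF assms] in \<open>auto simp: L2_def\<close>)
  also have "\<dots> = (l2n f)\<^sup>2 + (l2n g)\<^sup>2 + 2 * (LINT x|lborel. cmod (f x * g x))"
    unfolding l2n_sq using assms L2_mult_integrable[OF assms] by (simp add: L2_def)
  also have "\<dots> \<le> (l2n f + l2n g)\<^sup>2"
    using L2_Cauchy_Schwarz[OF assms] by (simp add: power2_sum)
  finally show "(l2n (\<lambda>x. f x + g x))\<^sup>2 \<le> (l2n f + l2n g)\<^sup>2" .
qed simp

lemma l2n_cmult: "l2n (\<lambda>x. c * f x) = cmod c * l2n f"
  by (simp add: l2n_def norm_mult power_mult_distrib real_sqrt_mult)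

lemma l2n_cong_AE:
  assumes "f \<in> borel_measurable borel" "g \<in> borel_measurable borel" "AE x in lborel. f x = g x"
  shows "l2n f = l2n g"
  unfolding l2n_def using assms by (intro arg_cong[where f = sqrt] integral_cong_AE) auto

lemma l2n_minus_commute: "l2n (\<lambda>x. f x - g x) = l2n (\<lambda>x. g x - f x)"
  by (simp add: l2n_def norm_minus_commute)

lemma l2n_cnj: "l2n (\<lambda>x. cnj (f x)) = l2n f"
  by (simp add: l2n_def)

lemma l2n_cnj_diff: "l2n (\<lambda>x. cnj (f x) - cnj (g x)) = l2n (\<lambda>x. f x - g x)"
  using l2n_cnj[of "\<lambda>x. f x - g x"] by simp

lemma l2n_diff_triangle:
  assumes "L2 f" "L2 g" "L2 h" shows "l2n (\<lambda>x. f x - h x) \<le> l2n (\<lambda>x. f x - g x) + l2n (\<lambda>x. g x - h x)"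
  using l2n_add[OF L2_diff[OF assms(1,2)] L2_diff[OF assms(2,3)]] by simp

lemma l2n_le_add_diff: assumes "L2 f" "L2 g" shows "l2n f \<le> l2n g + l2n (\<lambda>x. f x - g x)"
  using l2n_add[OF assms(2) L2_diff[OF assms]] by simp

lemma l2n_0_iff: assumes "L2 f" shows "l2n f = 0 \<longleftrightarrow> (AE x in lborel. f x = 0)"
  using integral_nonneg_eq_0_iff_AE[OF L2_sq[OF assms]] by (simp add: l2n_def)

lemma l2n_tendsto:
  assumes "\<And>n. L2 (f n)" "L2 g" "((\<lambda>n. l2n (\<lambda>x. f n x - g x)) \<longlongrightarrow> 0) F"
  shows "((\<lambda>n. l2n (f n)) \<longlongrightarrow> l2n g) F"
proof (rule LIM_zero_cancel, rule Lim_null_comparison[OF _ assms(3)], rule always_eventually, rule allI)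
  fix n
  show "norm (l2n (f n) - l2n g) \<le> l2n (\<lambda>x. f n x - g x)"
    using l2n_le_add_diff[OF assms(1)[of n] assms(2)] l2n_le_add_diff[OF assms(2) assms(1)[of n]]
      l2n_minus_commute[of "f n" g] by simp
qed

lemma l2ip_tendsto:
  assumes "\<And>n. L2 (f n)" "L2 g" "\<And>n. L2 (f' n)" "L2 g'"
    "((\<lambda>n. l2n (\<lambda>x. f n x - g x)) \<longlongrightarrow> 0) F" "((\<lambda>n. l2n (\<lambda>x. f' n x - g' x)) \<longlongrightarrow> 0) F"
  shows "((\<lambda>n. l2ip (f n) (f' n)) \<longlongrightarrow> l2ip g g') F"
proof -
  have "((\<lambda>n. l2n (\<lambda>x. f n x - g x) * l2n (f' n) + l2n g * l2n (\<lambda>x. f' n x - g' x)) \<longlongrightarrow> 0 * l2n g' + l2n g * 0) F"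
    by (intro tendsto_intros l2n_tendsto assms)
  then have lim: "((\<lambda>n. l2n (\<lambda>x. f n x - g x) * l2n (f' n) + l2n g * l2n (\<lambda>x. f' n x - g' x)) \<longlongrightarrow> 0) F"
    by simp
  show ?thesis
  proof (rule LIM_zero_cancel, rule Lim_null_comparison[OF _ lim], rule always_eventually, rule allI)
    fix n
    have "l2ip (f n) (f' n) - l2ip g g' = l2ip (\<lambda>x. f n x - g x) (f' n) + l2ip g (\<lambda>x. f' n x - g' x)"
      unfolding l2ip_def using assms(1-4)
      by (simp add: left_diff_distrib right_diff_distrib L2_ip_integrable)
    then have "cmod (l2ip (f n) (f' n) - l2ip g g') \<le> cmod (l2ip (\<lambda>x. f n x - g x) (f' n)) + cmod (l2ip g (\<lambda>x. f' n x - g' x))"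
      by (metis norm_triangle_ineq)
    also have "\<dots> \<le> l2n (\<lambda>x. f n x - g x) * l2n (f' n) + l2n g * l2n (\<lambda>x. f' n x - g' x)"
      by (intro add_mono l2ip_bound L2_diff assms)
    finally show "cmod (l2ip (f n) (f' n) - l2ip g g') \<le> \<dots>" .
  qed
qed

text \<open>\<open>has_fourier\<close> measures distances by an extended nonnegative integral; this
  is the passage to \<open>l2n\<close>, in which all later estimates are written.\<close>

lemma l2n_tendsto_0_of_nn:
  assumes "\<And>n. L2 (f n)"
  shows "((\<lambda>n. \<integral>\<^sup>+x. ennreal ((cmod (f n x))\<^sup>2) \<partial>lborel) \<longlongrightarrow> 0) F \<longleftrightarrow> ((\<lambda>n. l2n (f n)) \<longlongrightarrow> 0) F"
proof -
  have "((\<lambda>n. \<integral>\<^sup>+x. ennreal ((cmod (f n x))\<^sup>2) \<partial>lborel) \<longlongrightarrow> 0) F \<longleftrightarrow> ((\<lambda>n. (l2n (f n))\<^sup>2) \<longlongrightarrow> 0) F"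
    unfolding l2n_nn[OF assms] ennreal_0[symmetric] by (rule tendsto_ennreal_iff) auto
  also have "\<dots> \<longleftrightarrow> ((\<lambda>n. l2n (f n)) \<longlongrightarrow> 0) F"
    using tendsto_power[of "\<lambda>n. l2n (f n)" 0 F 2] tendsto_real_sqrt[of "\<lambda>n. (l2n (f n))\<^sup>2" 0 F]
    by auto
  finally show ?thesis .
qed

text \<open>Along a subsequence with \<open>\<parallel>f\<^sub>k\<^sub>+\<^sub>1 - f\<^sub>k\<parallel>\<^sup>2 \<le> 4\<^sup>-\<^sup>k\<close> the sum of
  \<open>2\<^sup>k |f\<^sub>k\<^sub>+\<^sub>1 - f\<^sub>k|\<^sup>2\<close> is integrable, so the increments are geometrically small almost everywhere.\<close>

lemma Riesz_Fischer:
  fixes f :: "nat \<Rightarrow> real \<Rightarrow> complex"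
  assumes L2: "\<And>n. L2 (f n)"
    and Cauchy: "\<And>e. e > 0 \<Longrightarrow> \<exists>N. \<forall>m\<ge>N. \<forall>n\<ge>N. l2n (\<lambda>x. f m x - f n x) < e"
  obtains g where "L2 g" "(\<lambda>n. l2n (\<lambda>x. f n x - g x)) \<longlonglongrightarrow> 0"
proof -
  have [measurable]: "f n \<in> borel_measurable borel" for n
    using L2[of n] by (simp add: L2_def)
  have "\<exists>N. \<forall>m\<ge>N. \<forall>n\<ge>N. l2n (\<lambda>x. f m x - f n x) < (1/2)^k" for k
    using Cauchy[of "(1/2)^k"] by simp
  then obtain N where N: "\<And>k m n. m \<ge> N k \<Longrightarrow> n \<ge> N k \<Longrightarrow> l2n (\<lambda>x. f m x - f n x) < (1/2)^k"
    by metis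
  \<comment> \<open>Partial sums dominate \<open>N j\<close> for all j \<le> k at once. That is all
    the argument asks of \<open>r\<close>; strict monotonicity plays no part.\<close>
  define r where "r k = (\<Sum>j\<le>k. N j)" for k
  have rN: "r j \<ge> N k" if "k \<le> j" for k j
    unfolding r_def using that by (intro member_le_sum) auto
  define d where "d k x = f (r (Suc k)) x - f (r k) x" for k x
  have [measurable]: "d k \<in> borel_measurable borel" for k
    unfolding d_def by measurable
  have dL2: "L2 (d k)" for k
    unfolding d_def by (intro L2_diff L2)
  have dn: "l2n (d k) \<le> (1/2)^k" for k
    unfolding d_def using N[of k "r (Suc k)" "r k"] rN[of k k] rN[of k "Suc k"] by simp
  have "(\<integral>\<^sup>+x. (\<Sum>k. ennreal (2^k * (cmod (d k x))\<^sup>2)) \<partial>lborel) = (\<Sum>k. \<integral>\<^sup>+x. ennreal (2^k * (cmod (d k x))\<^sup>2) \<partial>lborel)"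
    by (rule nn_integral_suminf) auto
  also have "\<dots> = (\<Sum>k. ennreal (2^k * (l2n (d k))\<^sup>2))"
    by (simp add: ennreal_mult nn_integral_cmult l2n_nn[OF dL2])
  also have "\<dots> \<le> (\<Sum>k. ennreal ((1/2)^k))"
  proof (intro suminf_le summableI ennreal_leI)
    fix k
    have "2^k * (l2n (d k))\<^sup>2 \<le> 2^k * ((1/2)^k)\<^sup>2"
      by (intro mult_left_mono power_mono dn) auto
    also have "\<dots> = (1/2)^k" by (simp add: power2_eq_square field_simps)
    finally show "2^k * (l2n (d k))\<^sup>2 \<le> (1/2)^k" .
  qed
  also have "\<dots> < \<infinity>"
    by (subst suminf_ennreal2) (auto intro: summable_geometric)
  finally have "(\<integral>\<^sup>+x. (\<Sum>k. ennreal (2^k * (cmod (d k x))\<^sup>2)) \<partial>lborel) \<noteq> \<infinity>" by simp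
  then have "AE x in lborel. (\<Sum>k. ennreal (2^k * (cmod (d k x))\<^sup>2)) \<noteq> \<infinity>"
    by (intro nn_integral_noteq_infinite) auto
  then have conv: "AE x in lborel. convergent (\<lambda>k. f (r k) x)"
  proof eventually_elim
    case (elim x)
    define S where "S = (\<Sum>k. ennreal (2^k * (cmod (d k x))\<^sup>2))"
    define C where "C = enn2real S"
    have C1: "C \<ge> 0" by (simp add: C_def)
    have C2: "S = ennreal C"
      unfolding C_def using elim unfolding S_def[symmetric] by (simp add: less_top)
    have "cmod (d k x) \<le> sqrt C * (1 / sqrt 2)^k" for k
    proof (rule power2_le_imp_le)
      have "ennreal (2^k * (cmod (d k x))\<^sup>2) \<le> S"
        unfolding S_def using sum_le_suminf[OF summableI, of "{k}" "\<lambda>k. ennreal (2^k * (cmod (d k x))\<^sup>2)"]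
        by (simp only: sum.insert sum.empty finite.intros empty_iff not_False_eq_True add_0_right zero_le simp_thms)
      then have "ennreal (2^k * (cmod (d k x))\<^sup>2) \<le> ennreal C" unfolding C2 .
      then have c: "2^k * (cmod (d k x))\<^sup>2 \<le> C" using C1 by (simp add: ennreal_le_iff)
      have "((1 / sqrt 2)^k)\<^sup>2 = ((1 / sqrt 2)\<^sup>2)^k"
        by (simp only: power_mult[symmetric] mult.commute)
      also have "\<dots> = 1 / 2^k" by (simp only: power_divide real_sqrt_pow2) simp
      finally have "(sqrt C * (1 / sqrt 2)^k)\<^sup>2 = C * (1 / 2^k)"
        using C1 by (simp only: power_mult_distrib real_sqrt_pow2)
      moreover have "(cmod (d k x))\<^sup>2 \<le> C * (1 / 2^k)"
        using c by (simp add: field_simps)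
      ultimately show "(cmod (d k x))\<^sup>2 \<le> (sqrt C * (1 / sqrt 2)^k)\<^sup>2" by simp
    qed (use C1 in simp)
    moreover have "summable (\<lambda>k. sqrt C * (1 / sqrt 2)^k)"
      by (rule summable_mult, rule summable_geometric) simp
    ultimately have "summable (\<lambda>k. d k x)"
      by (rule summable_comparison_test'[where N = 0, rotated])
    then have "convergent (\<lambda>n. \<Sum>k<n. d k x)" by (simp add: summable_iff_convergent)
    moreover have "(\<Sum>k<n. d k x) = f (r n) x - f (r 0) x" for n
      unfolding d_def by (rule sum_lessThan_telescope)
    ultimately have "convergent (\<lambda>n. (f (r n) x - f (r 0) x) + f (r 0) x)"
      by (intro convergent_add convergent_const) simp
    then show ?case by simp
  qed
  define g where "g x = lim (\<lambda>k. f (r k) x)" for x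
  have [measurable]: "g \<in> borel_measurable borel" unfolding g_def by measurable
  have lim: "AE x in lborel. (\<lambda>k. f (r k) x) \<longlonglongrightarrow> g x"
    using conv unfolding g_def by eventually_elim (simp add: convergent_LIMSEQ_iff)
  \<comment> \<open>Fatou's lemma in j with m fixed: almost everywhere convergence of the
    subsequence becomes an L2 estimate for every m beyond \<open>N k\<close>, not only for members
    of the subsequence.\<close>
  have est: "(\<integral>\<^sup>+x. ennreal ((cmod (f m x - g x))\<^sup>2) \<partial>lborel) \<le> ennreal (((1/2)^k)\<^sup>2)" if m: "m \<ge> N k" for m k
  proof -
    have "(\<integral>\<^sup>+x. ennreal ((cmod (f m x - g x))\<^sup>2) \<partial>lborel) = (\<integral>\<^sup>+x. liminf (\<lambda>j. ennreal ((cmod (f m x - f (r j) x))\<^sup>2)) \<partial>lborel)"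
    proof (rule nn_integral_cong_AE)
      show "AE x in lborel. ennreal ((cmod (f m x - g x))\<^sup>2) = liminf (\<lambda>j. ennreal ((cmod (f m x - f (r j) x))\<^sup>2))"
        using lim
      proof eventually_elim
        case (elim x)
        then have "(\<lambda>j. ennreal ((cmod (f m x - f (r j) x))\<^sup>2)) \<longlonglongrightarrow> ennreal ((cmod (f m x - g x))\<^sup>2)"
          by (intro tendsto_intros)
        then show ?case by (rule lim_imp_Liminf[OF trivial_limit_sequentially, symmetric])
      qed
    qed
    also have "\<dots> \<le> liminf (\<lambda>j. \<integral>\<^sup>+x. ennreal ((cmod (f m x - f (r j) x))\<^sup>2) \<partial>lborel)"
      by (rule nn_integral_liminf) auto
    also have "\<dots> = liminf (\<lambda>j. ennreal ((l2n (\<lambda>x. f m x - f (r j) x))\<^sup>2))"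
      by (simp add: l2n_nn L2_diff L2)
    also have "\<dots> \<le> liminf (\<lambda>j. ennreal (((1/2)^k)\<^sup>2))"
    proof (rule Liminf_mono)
      show "\<forall>\<^sub>F j in sequentially. ennreal ((l2n (\<lambda>x. f m x - f (r j) x))\<^sup>2) \<le> ennreal (((1/2)^k)\<^sup>2)"
        using eventually_ge_at_top[of k]
        by eventually_elim (rule ennreal_leI, rule power_mono, rule less_imp_le, rule N[OF m rN], simp_all)
    qed
    also have "\<dots> = ennreal (((1/2)^k)\<^sup>2)" by (simp add: Liminf_const)
    finally show ?thesis .
  qed
  have dL2: "L2 (\<lambda>x. f m x - g x)" if "m \<ge> N k" for m k
    unfolding L2_def using est[OF that] by (auto intro!: integrableI_bounded simp: top_unique less_top[symmetric] order.strict_trans1)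
  have gL2: "L2 g"
    using L2_diff[OF L2[of "N 0"] dL2[of 0 "N 0"]] by simp
  have est': "l2n (\<lambda>x. f m x - g x) \<le> (1/2)^k" if "m \<ge> N k" for m k
    using est[OF that] unfolding l2n_nn[OF L2_diff[OF L2 gL2]]
    by (auto intro: power2_le_imp_le)
  have "(\<lambda>n. l2n (\<lambda>x. f n x - g x)) \<longlonglongrightarrow> 0"
  proof (rule LIMSEQ_I)
    fix e :: real assume "e > 0"
    then obtain k where k: "(1/2)^k < e" using real_arch_pow_inv[of e "1/2"] by auto
    have "\<forall>n\<ge>N k. norm (l2n (\<lambda>x. f n x - g x) - 0) < e"
      using est' k by (fastforce intro: order.strict_trans1)
    then show "\<exists>no. \<forall>n\<ge>no. norm (l2n (\<lambda>x. f n x - g x) - 0) < e" by blast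
  qed
  then show ?thesis using gL2 that by blast
qed

text \<open>Identifies an L2 limit of Fourier transforms with their pointwise limit in
  \<open>prim_fourier\<close>.\<close>

lemma L2_tendsto_AE_subseq:
  assumes "\<And>n::nat. L2 (f n)" "L2 g" "(\<lambda>n. l2n (\<lambda>x. f n x - g x)) \<longlonglongrightarrow> 0"
  obtains r where "strict_mono r" "AE x in lborel. (\<lambda>n. f (r n) x) \<longlonglongrightarrow> g x"
proof -
  have "(\<lambda>n. (l2n (\<lambda>x. f n x - g x))\<^sup>2) \<longlonglongrightarrow> 0"
    using tendsto_power[OF assms(3), of 2] by simp
  then have "(\<lambda>n. LINT x|lborel. norm ((cmod (f n x - g x))\<^sup>2)) \<longlonglongrightarrow> 0"
    by (simp add: l2n_sq)
  moreover have "integrable lborel (\<lambda>x. (cmod (f n x - g x))\<^sup>2)" for n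
    by (intro L2_sq L2_diff assms)
  ultimately obtain r where r: "strict_mono r" "AE x in lborel. (\<lambda>n. (cmod (f (r n) x - g x))\<^sup>2) \<longlonglongrightarrow> 0"
    using tendsto_L1_AE_subseq[of lborel "\<lambda>n x. (cmod (f n x - g x))\<^sup>2"] by blast
  have "AE x in lborel. (\<lambda>n. f (r n) x) \<longlonglongrightarrow> g x"
    using r(2)
  proof eventually_elim
    case (elim x)
    have "(\<lambda>n. sqrt ((cmod (f (r n) x - g x))\<^sup>2)) \<longlonglongrightarrow> sqrt 0" by (intro tendsto_intros elim)
    then have "(\<lambda>n. f (r n) x - g x) \<longlonglongrightarrow> 0" by (simp add: tendsto_norm_zero_iff)
    then show ?case by (rule LIM_zero_cancel)
  qed
  with r(1) that show ?thesis by blast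
qed

section \<open>Functions determined by their integrals over half-lines or intervals\<close>

text \<open>\<open>ennreal\<close> sends negative numbers to 0, so \<open>?p\<close> and
  \<open>?m\<close> are the positive and negative parts of \<open>q\<close>. As densities they give
  measures that are finite and agree on the open half-lines, hence coincide, and densities are
  unique almost everywhere.\<close>

lemma real_AE_zero_if_tail_integrals_zero:
  fixes q :: "real \<Rightarrow> real"
  assumes q: "integrable lborel q" and z: "\<And>a. (LINT x:{a<..}|lborel. q x) = 0"
  shows "AE x in lborel. q x = 0"
proof -
  have [measurable]: "q \<in> borel_measurable borel" using q by auto
  let ?p = "\<lambda>x. ennreal (q x)" and ?m = "\<lambda>x. ennreal (- q x)"
  have "density lborel ?p = density lborel ?m"
  proof (rule measure_eqI_lessThan)
    fix a
    have qi: "integrable lborel (\<lambda>x. indicator {a<..} x * q x)"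
      using integrable_mult_indicator[OF _ q, of "{a<..}"] by simp
    have p: "emeasure (density lborel ?p) {a<..} = (\<integral>\<^sup>+x. ennreal (indicator {a<..} x * q x) \<partial>lborel)"
      by (subst emeasure_density) (auto intro!: nn_integral_cong simp: indicator_def)
    have m: "emeasure (density lborel ?m) {a<..} = (\<integral>\<^sup>+x. ennreal (- (indicator {a<..} x * q x)) \<partial>lborel)"
      by (subst emeasure_density) (auto intro!: nn_integral_cong simp: indicator_def)
    have fin: "(\<integral>\<^sup>+x. ennreal (indicator {a<..} x * q x) \<partial>lborel) < \<infinity>" "(\<integral>\<^sup>+x. ennreal (- (indicator {a<..} x * q x)) \<partial>lborel) < \<infinity>"
      using qi unfolding real_integrable_def by (auto simp: less_top)
    show "emeasure (density lborel ?p) {a<..} < \<infinity>" using fin p by simp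
    have "(LINT x|lborel. indicator {a<..} x * q x) = 0"
      using z[of a] by (simp add: set_lebesgue_integral_def)
    then have "enn2real (\<integral>\<^sup>+x. ennreal (indicator {a<..} x * q x) \<partial>lborel) = enn2real (\<integral>\<^sup>+x. ennreal (- (indicator {a<..} x * q x)) \<partial>lborel)"
      using real_lebesgue_integral_def[OF qi] by simp
    then show "emeasure (density lborel ?p) {a<..} = emeasure (density lborel ?m) {a<..}"
      unfolding p m using fin by (metis ennreal_enn2real infinity_ennreal_def)
  qed auto
  then have "AE x in lborel. ?p x = ?m x"
    by (intro sigma_finite_measure.density_unique[OF sigma_finite_lborel]) auto
  then show ?thesis
  proof eventually_elim
    case (elim x)
    then show ?case
      by (cases "q x \<ge> 0") (auto simp: ennreal_neg ennreal_eq_0_iff dest: sym)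
  qed
qed

lemma AE_zero_if_tail_integrals_zero:
  fixes q :: "real \<Rightarrow> complex"
  assumes q: "integrable lborel q" and z: "\<And>a. (LINT x:{a<..}|lborel. q x) = 0"
  shows "AE x in lborel. q x = 0"
proof -
  have qi: "integrable lborel (\<lambda>x. indicator {a<..} x *\<^sub>R q x)" for a
    using integrable_mult_indicator[OF _ q, of "{a<..}"] by simp
  have "AE x in lborel. Re (q x) = 0"
  proof (rule real_AE_zero_if_tail_integrals_zero)
    show "(LINT x:{a<..}|lborel. Re (q x)) = 0" for a
      using z[of a] integral_Re[OF qi[of a]] by (simp add: set_lebesgue_integral_def)
  qed (use q in auto)
  moreover have "AE x in lborel. Im (q x) = 0"
  proof (rule real_AE_zero_if_tail_integrals_zero)
    show "(LINT x:{a<..}|lborel. Im (q x)) = 0" for a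
      using z[of a] integral_Im[OF qi[of a]] by (simp add: set_lebesgue_integral_def)
  qed (use q in auto)
  ultimately show ?thesis by eventually_elim (simp add: complex_eq_iff)
qed

lemma indicator_L2[simp]: "L2 (indicator {a..b::real})"
  by (rule L2_bound[where k = "indicator {a..b}"]) (auto simp: indicator_def intro!: integrable_real_indicator emeasure_lborel_Icc_eq[THEN ord_eq_less_trans])

text \<open>A square integrable function need not be integrable on the line; cutting it off to
  [-n, n] makes it so, and the half-line integrals of the cut-off are interval integrals.\<close>

lemma L2_AE_zero_if_interval_integrals_zero:
  assumes f: "L2 f" and z: "\<And>a b. l2ip f (indicator {a..b}) = 0"
  shows "AE x in lborel. f x = 0"
proof -
  have "AE x in lborel. indicator {-real n..real n} x * f x = 0" for n
  proof (rule AE_zero_if_tail_integrals_zero)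
    show "integrable lborel (\<lambda>x. indicator {-real n..real n} x * f x)"
      by (intro L2_mult_integrable f indicator_L2)
    fix a
    let ?b = "max a (-real n)"
    \<comment> \<open>The half-line is open and the interval closed, so the integrands may differ at
      the single point a.\<close>
    have "(LINT x:{a<..}|lborel. indicator {-real n..real n} x * f x) = (LINT x|lborel. f x * cnj (indicator {?b..real n} x))"
      unfolding set_lebesgue_integral_def
    proof (rule integral_cong_AE)
      show "AE x in lborel. indicator {a<..} x *\<^sub>R (indicator {-real n..real n} x * f x) = f x * cnj (indicator {?b..real n} x)"
        using AE_lborel_singleton[of a] by eventually_elim (auto simp: indicator_def)
    qed (use f in \<open>auto simp: L2_def\<close>)
    then show "(LINT x:{a<..}|lborel. indicator {-real n..real n} x * f x) = 0"
      using z[of ?b "real n"] by (simp add: l2ip_def)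
  qed
  then have "AE x in lborel. \<forall>n. indicator {-real n..real n} x * f x = 0"
    by (simp only: AE_all_countable) blast
  then show ?thesis
  proof eventually_elim
    case (elim x)
    obtain n where "\<bar>x\<bar> \<le> real n" using real_arch_simple by blast
    then show ?case using elim[rule_format, of n] by (auto simp: indicator_def abs_le_iff)
  qed
qed

section \<open>The Fourier transform and Plancherel's theorem\<close>

lemma ee_measurable[measurable]: "f \<in> borel_measurable M \<Longrightarrow> g \<in> borel_measurable M \<Longrightarrow> (\<lambda>x. ee (f x) (g x)) \<in> borel_measurable M"
  unfolding ee_def by measurable

lemma norm_ee[simp]: "cmod (ee a x) = 1"
  by (simp add: ee_def)

lemma ee_add: "ee a x * ee b x = ee (a + b) x"
  by (simp add: ee_def ring_distribs flip: exp_add)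

lemma ee_commute: "ee a x = ee x a"
  by (simp add: ee_def mult.commute)

lemma ee_0[simp]: "ee 0 x = 1" "ee x 0 = 1"
  by (simp_all add: ee_def)

lemma cnj_ee[simp]: "cnj (ee a x) = ee (- a) x"
  by (simp add: ee_def exp_cnj)

lemma ee_cancel[simp]: "ee a x * ee (- a) x = 1" "ee (- a) x * ee a x = 1"
  "ee a x * (ee (- a) x * z) = z" "ee (- a) x * (ee a x * z) = z"
  by (simp_all add: ee_add flip: mult.assoc)

lemma continuous_on_ee[continuous_intros]:
  "continuous_on S f \<Longrightarrow> continuous_on S g \<Longrightarrow> continuous_on S (\<lambda>x. ee (f x) (g x))"
  unfolding ee_def by (intro continuous_intros)

lemma tendsto_ee[tendsto_intros]:
  "(f \<longlongrightarrow> a) F \<Longrightarrow> (g \<longlongrightarrow> b) F \<Longrightarrow> ((\<lambda>x. ee (f x) (g x)) \<longlongrightarrow> ee a b) F"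
  unfolding ee_def by (intro tendsto_intros)

lemma L2_ee: "L2 f \<Longrightarrow> L2 (\<lambda>x. ee a x * f x)"
  by (rule L2_bounded_mult[where B = 1]) auto

lemma integrable_bounded_mult:
  fixes f :: "real \<Rightarrow> complex"
  assumes "integrable lborel f" "m \<in> borel_measurable borel" "\<And>x. cmod (m x) \<le> B"
  shows "integrable lborel (\<lambda>x. m x * f x)"
proof (rule Bochner_Integration.integrable_bound[where f = "\<lambda>x. B * cmod (f x)"])
  have "0 \<le> B" using assms(3)[of 0] norm_ge_zero order_trans by blast
  then show "AE x in lborel. norm (m x * f x) \<le> norm (B * cmod (f x))"
    using assms(3) by (auto simp: norm_mult intro!: mult_right_mono)
qed (use assms in auto)

lemma integrable_ee:
  fixes f :: "real \<Rightarrow> complex"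
  assumes "integrable lborel f" and [measurable]: "g \<in> borel_measurable borel" "h \<in> borel_measurable borel"
  shows "integrable lborel (\<lambda>x. ee (g x) (h x) * f x)"
  by (rule integrable_bounded_mult[OF assms(1), where B = 1]) auto

text \<open>Fubini for a bounded kernel between two integrable functions. It is applied with two
  kernels: the character, which moves the Fourier transform across a pairing, and the indicator of y
  \<le> x, which is integration by parts for \<open>prim\<close>.\<close>

lemma
  fixes f g :: "real \<Rightarrow> complex" and K :: "real \<Rightarrow> real \<Rightarrow> complex"
  assumes f: "integrable lborel f" and g: "integrable lborel g"
    and K: "(\<lambda>(x, y). K x y) \<in> borel_measurable (borel \<Otimes>\<^sub>M borel)"
    and B: "\<And>x y. cmod (K x y) \<le> B"
  shows Fubini_kernel: "(LINT x|lborel. f x * (LINT y|lborel. K x y * g y)) = (LINT y|lborel. g y * (LINT x|lborel. K x y * f x))" (is ?thesis1)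
    and integrable_kernel: "integrable lborel (\<lambda>x. f x * (LINT y|lborel. K x y * g y))" (is ?thesis2)
    and measurable_kernel: "(\<lambda>x. LINT y|lborel. K x y * g y) \<in> borel_measurable borel" (is ?thesis3)
proof -
  have [measurable]: "f \<in> borel_measurable borel" "g \<in> borel_measurable borel" using f g by auto
  have K1[measurable]: "K x \<in> borel_measurable borel" for x
    using measurable_compose[of "\<lambda>y. (x, y)" borel, OF _ K] by simp
  have K2[measurable]: "(\<lambda>x. K x y) \<in> borel_measurable borel" for y
    using measurable_compose[of "\<lambda>x. (x, y)" borel, OF _ K] by simp
  have B0: "0 \<le> B" using B[of 0 0] norm_ge_zero order_trans by blast
  have Kg: "integrable lborel (\<lambda>y. K x y * g y)" for x
    by (rule integrable_bounded_mult[OF g _ B]) auto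
  have Kf: "integrable lborel (\<lambda>x. K x y * f x)" for y
    by (rule integrable_bounded_mult[OF f _ B]) auto
  have Kp: "(\<lambda>(x, y). K x y * g y) \<in> borel_measurable (borel \<Otimes>\<^sub>M borel)"
    using borel_measurable_times[OF K measurable_compose[OF measurable_snd, of g borel borel borel]] by (simp add: case_prod_beta')
  have cong: "borel_measurable (borel \<Otimes>\<^sub>M borel) = borel_measurable (M \<Otimes>\<^sub>M lborel)" if "sets M = sets borel" for M :: "real measure"
    using that by (intro measurable_cong_sets sets_pair_measure_cong) auto
  have Kn: "(\<lambda>x. LINT y|lborel. cmod (K x y * g y)) \<in> borel_measurable borel"
    using measurable_compose[OF Kp borel_measurable_norm] cong[of borel]
    by (intro sigma_finite_measure.borel_measurable_lebesgue_integral[OF sigma_finite_lborel]) (simp add: case_prod_beta')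
  show ?thesis3 by (rule sigma_finite_measure.borel_measurable_lebesgue_integral[OF sigma_finite_lborel Kp[unfolded cong[OF refl]]])
  have le: "(LINT y|lborel. cmod (K x y * g y)) \<le> B * (LINT y|lborel. cmod (g y))" for x
  proof -
    have "(LINT y|lborel. cmod (K x y * g y)) \<le> (LINT y|lborel. B * cmod (g y))"
      by (rule integral_mono) (use integrable_norm[OF Kg[of x]] g B in \<open>auto simp: norm_mult intro!: mult_right_mono\<close>)
    then show ?thesis by simp
  qed
  have int: "integrable (lborel \<Otimes>\<^sub>M lborel) (\<lambda>(x, y). f x * (K x y * g y))"
  proof (rule lborel_pair.Fubini_integrable)
    have "integrable lborel (\<lambda>x. cmod (f x) * (LINT y|lborel. cmod (K x y * g y)))"
    proof (rule Bochner_Integration.integrable_bound[where f = "\<lambda>x. B * (LINT y|lborel. cmod (g y)) * cmod (f x)"])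
      show "AE x in lborel. norm (cmod (f x) * (LINT y|lborel. cmod (K x y * g y))) \<le> norm (B * (LINT y|lborel. cmod (g y)) * cmod (f x))"
        using le B0 by (intro AE_I2) (simp add: abs_mult mult.commute mult_left_mono)
    qed (use f Kn in auto)
    then show "integrable lborel (\<lambda>x. LINT y|lborel. norm (case (x, y) of (x, y) \<Rightarrow> f x * (K x y * g y)))"
      by (simp add: norm_mult)
    show "(\<lambda>(x, y). f x * (K x y * g y)) \<in> borel_measurable (lborel \<Otimes>\<^sub>M lborel)"
      using borel_measurable_times[OF measurable_compose[OF measurable_fst, of f borel borel borel] Kp] cong[of lborel] by (simp add: case_prod_beta')
    show "AE x in lborel. integrable lborel (\<lambda>y. case (x, y) of (x, y) \<Rightarrow> f x * (K x y * g y))"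
      using Kg by simp
  qed
  show ?thesis2 using lborel_pair.integrable_fst[OF int] by simp
  have "(LINT x|lborel. f x * (LINT y|lborel. K x y * g y)) = (LINT x|lborel. LINT y|lborel. f x * (K x y * g y))"
    by simp
  also have "\<dots> = (LINT y|lborel. LINT x|lborel. f x * (K x y * g y))"
    by (rule lborel_pair.Fubini_integral[OF int, symmetric])
  also have "\<dots> = (LINT y|lborel. LINT x|lborel. g y * (K x y * f x))"
    by (simp only: mult_ac)
  finally show ?thesis1 by simp
qed

section \<open>The Fourier integral of an integrable function\<close>

definition ft :: "(real \<Rightarrow> complex) \<Rightarrow> real \<Rightarrow> complex" where
  "ft f \<xi> = (LINT x|lborel. f x * ee (- \<xi>) x)"

lemma ft_integrable:
  assumes "integrable lborel f" shows "integrable lborel (\<lambda>x. f x * ee a x)"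
proof -
  have "integrable lborel (\<lambda>x. ee a x * f x)"
    by (rule integrable_ee[OF assms]) auto
  then show ?thesis by (simp only: mult.commute)
qed

lemma ft_measurable[measurable]:
  assumes "integrable lborel f" shows "ft f \<in> borel_measurable borel"
proof -
  have "(\<lambda>\<xi>. LINT x|lborel. ee (- \<xi>) x * f x) \<in> borel_measurable borel"
    by (rule measurable_kernel[OF assms assms, where B = 1]) (auto simp: case_prod_beta')
  then show ?thesis by (simp only: ft_def[abs_def] mult.commute)
qed

lemma ft_bound: "integrable lborel f \<Longrightarrow> cmod (ft f \<xi>) \<le> (LINT x|lborel. cmod (f x))"
  using integral_norm_bound[of lborel "\<lambda>x. f x * ee (- \<xi>) x"] by (simp add: ft_def norm_mult)

lemma ft_exchange:
  assumes "integrable lborel f" "integrable lborel g"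
  shows "(LINT x|lborel. f x * ft g x) = (LINT x|lborel. ft f x * g x)"
proof -
  have g: "ft g x = (LINT y|lborel. ee (- x) y * g y)" for x
    by (simp only: ft_def mult.commute)
  have "ee (- y) x = ee (- x) y" for x y by (simp add: ee_def mult.commute)
  then have f: "ft f y = (LINT x|lborel. ee (- x) y * f x)" for y
    by (simp only: ft_def mult.commute)
  have "(LINT x|lborel. f x * ft g x) = (LINT y|lborel. g y * (LINT x|lborel. ee (- x) y * f x))"
    unfolding g by (rule Fubini_kernel[OF assms, where B = 1]) (auto simp: case_prod_beta')
  then show ?thesis by (simp only: f mult.commute)
qed

lemma ft_exchange_cnj:
  assumes "integrable lborel f" "integrable lborel g"
  shows "(LINT x|lborel. f x * cnj (ft g x)) = (LINT y|lborel. cnj (g y) * ft f (- y))"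
proof -
  have g: "cnj (ft g x) = (LINT y|lborel. ee x y * cnj (g y))" for x
    unfolding ft_def by (subst Bochner_Integration.integral_cnj[symmetric]) (simp add: mult.commute)
  have "ee (- (- y)) x = ee x y" for x y by (simp add: ee_def mult.commute)
  then have f: "ft f (- y) = (LINT x|lborel. ee x y * f x)" for y
    by (simp only: ft_def mult.commute)
  show ?thesis
    unfolding g f
    by (rule Fubini_kernel[OF assms(1), where B = 1]) (use assms(2) in \<open>auto simp: case_prod_beta'\<close>)
qed

section \<open>Gaussian regularisation and the L2 bound\<close>

abbreviation gauss :: "real \<Rightarrow> real" where "gauss \<equiv> std_normal_density"

lemma gauss_integrable: "integrable lborel gauss"
  using integrable_std_normal_moment[of 0] by simp

lemma gauss_total: "(LINT x|lborel. gauss x) = 1"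
  by (rule integral_normal_density) simp

lemma gauss_le: "gauss x \<le> gauss 0"
  by (simp add: std_normal_density_def divide_right_mono)

text \<open>The characteristic function of the standard normal law. The factor sqrt (2 pi) appears
  because \<open>gauss\<close> has total mass 1, so that the bare exponential is
  \<open>sqrt (2 * pi) * gauss t\<close>.\<close>

lemma ft_gauss: "(LINT z|lborel. complex_of_real (gauss z) * ee t z) = complex_of_real (sqrt (2 * pi) * gauss t)"
proof -
  have "(LINT z|lborel. complex_of_real (gauss z) * ee t z) = (LINT z|lborel. gauss z *\<^sub>R iexp (t * z))"
    by (simp only: ee_def scaleR_conv_of_real)
  also have "\<dots> = char std_normal_distribution t"
    unfolding char_def by (subst integral_density) auto
  also have "\<dots> = complex_of_real (exp (- t\<^sup>2 / 2))"
    by (simp only: char_std_normal_distribution)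
  also have "exp (- t\<^sup>2 / 2) = sqrt (2 * pi) * gauss t"
    by (simp add: std_normal_density_def)
  finally show ?thesis .
qed

lemma ft_gauss_scaled:
  assumes "\<sigma> > 0"
  shows "(LINT \<xi>|lborel. complex_of_real (gauss (\<sigma> * \<xi>)) * ee t \<xi>) = complex_of_real (sqrt (2 * pi) * gauss (t / \<sigma>) / \<sigma>)"
proof -
  have "complex_of_real (sqrt (2 * pi) * gauss (t / \<sigma>)) = (LINT z|lborel. complex_of_real (gauss z) * ee (t / \<sigma>) z)"
    by (rule ft_gauss[symmetric])
  also have "\<dots> = \<sigma> *\<^sub>R (LINT \<xi>|lborel. complex_of_real (gauss (\<sigma> * \<xi>)) * ee (t / \<sigma>) (\<sigma> * \<xi>))"
    using lborel_integral_real_affine[of \<sigma> "\<lambda>z. complex_of_real (gauss z) * ee (t / \<sigma>) z" 0] assms by simp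
  also have "(LINT \<xi>|lborel. complex_of_real (gauss (\<sigma> * \<xi>)) * ee (t / \<sigma>) (\<sigma> * \<xi>)) = (LINT \<xi>|lborel. complex_of_real (gauss (\<sigma> * \<xi>)) * ee t \<xi>)"
    using assms by (simp add: ee_def)
  finally have "complex_of_real (sqrt (2 * pi) * gauss (t / \<sigma>)) = complex_of_real \<sigma> * (LINT \<xi>|lborel. complex_of_real (gauss (\<sigma> * \<xi>)) * ee t \<xi>)"
    by (simp only: scaleR_conv_of_real)
  then show ?thesis using assms by (simp only: of_real_divide nonzero_eq_divide_eq of_real_eq_0_iff mult.commute)
qed

lemma gauss_scaled_integrable: "\<sigma> > 0 \<Longrightarrow> integrable lborel (\<lambda>x. gauss (\<sigma> * x))"
  using lborel_integrable_real_affine[OF gauss_integrable, of \<sigma> 0] by simp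

text \<open>Transforms of integrable functions are merely bounded, so their product need not be
  integrable; the Gaussian factor repairs this and allows Fubini. On the other side it turns into an
  average of \<open>f\<close> over distances of order \<sigma>, seen after the substitution x = y +
  \<sigma> z.\<close>

lemma gauss_smoothed_Parseval:
  assumes f: "integrable lborel f" and g: "integrable lborel g" and \<sigma>: "\<sigma> > 0"
  shows "(LINT \<xi>|lborel. ft f \<xi> * cnj (ft g \<xi>) * complex_of_real (gauss (\<sigma> * \<xi>)))
    = complex_of_real (sqrt (2 * pi)) * (LINT y|lborel. cnj (g y) * (LINT z|lborel. f (y + \<sigma> * z) * complex_of_real (gauss z)))"
proof -
  let ?G = "\<lambda>\<xi>. complex_of_real (gauss (\<sigma> * \<xi>))"
  have [measurable]: "f \<in> borel_measurable borel" "g \<in> borel_measurable borel" using f g by auto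
  have G: "integrable lborel ?G" using gauss_scaled_integrable[OF \<sigma>] by simp
  have fG: "integrable lborel (\<lambda>\<xi>. ft f \<xi> * ?G \<xi>)"
    by (rule integrable_bounded_mult[OF G _ ft_bound[OF f]]) (use f in auto)
  have aux: "\<sigma> *\<^sub>R (F * complex_of_real (c * d / \<sigma>)) = complex_of_real c * (F * complex_of_real d)" for F c d
    using \<sigma> by (simp add: scaleR_conv_of_real)
  have inner: "ft (\<lambda>\<xi>. ft f \<xi> * ?G \<xi>) (- y) = complex_of_real (sqrt (2 * pi)) * (LINT z|lborel. f (y + \<sigma> * z) * complex_of_real (gauss z))" for y
  proof -
    have Ge: "integrable lborel (\<lambda>\<xi>. ?G \<xi> * ee y \<xi>)" using ft_integrable[OF G] .
    have "ft (\<lambda>\<xi>. ft f \<xi> * ?G \<xi>) (- y) = (LINT \<xi>|lborel. ft f \<xi> * (?G \<xi> * ee y \<xi>))"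
      by (simp add: ft_def mult.assoc)
    also have "\<dots> = (LINT x|lborel. f x * ft (\<lambda>\<xi>. ?G \<xi> * ee y \<xi>) x)"
      by (rule ft_exchange[OF f Ge, symmetric])
    also have "\<dots> = (LINT x|lborel. f x * complex_of_real (sqrt (2 * pi) * gauss ((y - x) / \<sigma>) / \<sigma>))"
      unfolding ft_def by (simp add: mult.assoc ee_add ft_gauss_scaled[OF \<sigma>])
    also have "\<dots> = \<sigma> *\<^sub>R (LINT z|lborel. f (y + \<sigma> * z) * complex_of_real (sqrt (2 * pi) * gauss ((y - (y + \<sigma> * z)) / \<sigma>) / \<sigma>))"
      using lborel_integral_real_affine[of \<sigma> "\<lambda>x. f x * complex_of_real (sqrt (2 * pi) * gauss ((y - x) / \<sigma>) / \<sigma>)" y] \<sigma> by simp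
    also have "\<dots> = (LINT z|lborel. complex_of_real (sqrt (2 * pi)) * (f (y + \<sigma> * z) * complex_of_real (gauss z)))"
      unfolding integral_scaleR_right[symmetric]
    proof (intro Bochner_Integration.integral_cong refl)
      fix z
      have "(y - (y + \<sigma> * z)) / \<sigma> = - z" using \<sigma> by simp
      then have e: "gauss ((y - (y + \<sigma> * z)) / \<sigma>) = gauss z" by (simp only: std_normal_density_def power2_minus)
      show "\<sigma> *\<^sub>R (f (y + \<sigma> * z) * complex_of_real (sqrt (2 * pi) * gauss ((y - (y + \<sigma> * z)) / \<sigma>) / \<sigma>))
         = complex_of_real (sqrt (2 * pi)) * (f (y + \<sigma> * z) * complex_of_real (gauss z))"
        unfolding e by (rule aux)
    qed
    finally show ?thesis by simp
  qed
  have "(LINT \<xi>|lborel. ft f \<xi> * cnj (ft g \<xi>) * ?G \<xi>) = (LINT \<xi>|lborel. (ft f \<xi> * ?G \<xi>) * cnj (ft g \<xi>))"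
    by (simp add: mult_ac)
  also have "\<dots> = (LINT y|lborel. cnj (g y) * ft (\<lambda>\<xi>. ft f \<xi> * ?G \<xi>) (- y))"
    by (rule ft_exchange_cnj[OF fG g])
  also have "\<dots> = (LINT y|lborel. complex_of_real (sqrt (2 * pi)) * (cnj (g y) * (LINT z|lborel. f (y + \<sigma> * z) * complex_of_real (gauss z))))"
    unfolding inner by (simp add: mult_ac)
  finally show ?thesis by simp
qed

text \<open>Holds for every \<open>f\<close>: when \<open>f\<close> is not integrable the Bochner
  integral is 0 by convention.\<close>

lemma norm_integral_le_nn_integral:
  fixes f :: "real \<Rightarrow> complex"
  shows "ennreal (cmod (LINT x|lborel. f x)) \<le> (\<integral>\<^sup>+x. ennreal (cmod (f x)) \<partial>lborel)"
  using integral_norm_bound_ennreal[of lborel f] not_integrable_integral_eq[of lborel f] by (cases "integrable lborel f") auto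

text \<open>The Gaussian weight has mass 1 and translations preserve the L2 norm. After |ab| \<le>
  (a^2 + b^2) / 2 both squares integrate to the square of the norm, whatever \<sigma> is. Working
  with nonnegative integrals makes every exchange of integrals free.\<close>

lemma smoothed_sq_bound:
  assumes f: "L2 f"
  shows "cmod (LINT y|lborel. cnj (f y) * (LINT z|lborel. f (y + \<sigma> * z) * complex_of_real (gauss z))) \<le> (l2n f)\<^sup>2"
proof -
  have [measurable]: "f \<in> borel_measurable borel" using f by (auto simp: L2_def)
  let ?q = "\<lambda>y. ennreal ((cmod (f y))\<^sup>2)"
  have g1: "(\<integral>\<^sup>+z. ennreal (gauss z) \<partial>lborel) = 1"
    using nn_integral_eq_integral[OF gauss_integrable] gauss_total by simp
  have sh: "(\<integral>\<^sup>+y. ?q (y + c) \<partial>lborel) = ennreal ((l2n f)\<^sup>2)" for c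
    using nn_integral_real_affine[of ?q 1 c] l2n_nn[OF f] by (simp add: add.commute)
  define c :: real where "c = 1/2"
  have c0: "0 \<le> c" and cc: "c + c = 1" by (simp_all add: c_def)
  have "ennreal (cmod (LINT y|lborel. cnj (f y) * (LINT z|lborel. f (y + \<sigma> * z) * complex_of_real (gauss z))))
      \<le> (\<integral>\<^sup>+y. ennreal (cmod (cnj (f y) * (LINT z|lborel. f (y + \<sigma> * z) * complex_of_real (gauss z)))) \<partial>lborel)"
    by (rule norm_integral_le_nn_integral)
  also have "\<dots> \<le> (\<integral>\<^sup>+y. (\<integral>\<^sup>+z. ennreal (cmod (f y)) * ennreal (cmod (f (y + \<sigma> * z) * complex_of_real (gauss z))) \<partial>lborel) \<partial>lborel)"
  proof (intro nn_integral_mono)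
    fix y
    have "ennreal (cmod (cnj (f y) * (LINT z|lborel. f (y + \<sigma> * z) * complex_of_real (gauss z))))
        = ennreal (cmod (f y)) * ennreal (cmod (LINT z|lborel. f (y + \<sigma> * z) * complex_of_real (gauss z)))"
      by (simp only: norm_mult complex_mod_cnj ennreal_mult norm_ge_zero)
    also have "\<dots> \<le> ennreal (cmod (f y)) * (\<integral>\<^sup>+z. ennreal (cmod (f (y + \<sigma> * z) * complex_of_real (gauss z))) \<partial>lborel)"
      by (intro mult_left_mono norm_integral_le_nn_integral) simp
    also have "\<dots> = (\<integral>\<^sup>+z. ennreal (cmod (f y)) * ennreal (cmod (f (y + \<sigma> * z) * complex_of_real (gauss z))) \<partial>lborel)"
      by (rule nn_integral_cmult[symmetric]) simp
    finally show "ennreal (cmod (cnj (f y) * (LINT z|lborel. f (y + \<sigma> * z) * complex_of_real (gauss z))))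
      \<le> (\<integral>\<^sup>+z. ennreal (cmod (f y)) * ennreal (cmod (f (y + \<sigma> * z) * complex_of_real (gauss z))) \<partial>lborel)" .
  qed
  also have "\<dots> \<le> (\<integral>\<^sup>+y. (\<integral>\<^sup>+z. ennreal c * (?q y * ennreal (gauss z)) + ennreal c * (ennreal (gauss z) * ?q (y + \<sigma> * z)) \<partial>lborel) \<partial>lborel)"
  proof (intro nn_integral_mono)
    fix y z
    have "cmod (f y) * cmod (f (y + \<sigma> * z)) \<le> c * (cmod (f y))\<^sup>2 + c * (cmod (f (y + \<sigma> * z)))\<^sup>2"
      using sum_squares_bound[of "cmod (f y)" "cmod (f (y + \<sigma> * z))"] by (simp add: c_def)
    then have "cmod (f y) * cmod (f (y + \<sigma> * z)) * gauss z \<le> (c * (cmod (f y))\<^sup>2 + c * (cmod (f (y + \<sigma> * z)))\<^sup>2) * gauss z"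
      by (rule mult_right_mono) simp
    then have "ennreal (cmod (f y) * (cmod (f (y + \<sigma> * z)) * gauss z)) \<le> ennreal (c * ((cmod (f y))\<^sup>2 * gauss z) + c * (gauss z * (cmod (f (y + \<sigma> * z)))\<^sup>2))"
      by (intro ennreal_leI) (simp add: algebra_simps)
    then show "ennreal (cmod (f y)) * ennreal (cmod (f (y + \<sigma> * z) * complex_of_real (gauss z)))
       \<le> ennreal c * (?q y * ennreal (gauss z)) + ennreal c * (ennreal (gauss z) * ?q (y + \<sigma> * z))" (is ?thesis)
    proof -
      assume le: "ennreal (cmod (f y) * (cmod (f (y + \<sigma> * z)) * gauss z)) \<le> ennreal (c * ((cmod (f y))\<^sup>2 * gauss z) + c * (gauss z * (cmod (f (y + \<sigma> * z)))\<^sup>2))"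
      have "cmod (f (y + \<sigma> * z) * complex_of_real (gauss z)) = cmod (f (y + \<sigma> * z)) * gauss z"
        by (simp add: norm_mult)
      moreover have "ennreal (c * ((cmod (f y))\<^sup>2 * gauss z) + c * (gauss z * (cmod (f (y + \<sigma> * z)))\<^sup>2))
          = ennreal c * (?q y * ennreal (gauss z)) + ennreal c * (ennreal (gauss z) * ?q (y + \<sigma> * z))"
        using c0 by (subst ennreal_plus) (auto simp only: ennreal_mult mult_nonneg_nonneg zero_le_power2 normal_density_nonneg)
      ultimately show ?thesis using le by (simp only: ennreal_mult norm_ge_zero mult_nonneg_nonneg normal_density_nonneg)
    qed
  qed
  also have "\<dots> = ennreal c * ((\<integral>\<^sup>+y. ?q y \<partial>lborel) * 1) + ennreal c * (\<integral>\<^sup>+y. (\<integral>\<^sup>+z. ennreal (gauss z) * ?q (y + \<sigma> * z) \<partial>lborel) \<partial>lborel)"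
    by (simp add: nn_integral_add nn_integral_cmult nn_integral_multc g1)
  also have "(\<integral>\<^sup>+y. (\<integral>\<^sup>+z. ennreal (gauss z) * ?q (y + \<sigma> * z) \<partial>lborel) \<partial>lborel) = (\<integral>\<^sup>+z. (\<integral>\<^sup>+y. ennreal (gauss z) * ?q (y + \<sigma> * z) \<partial>lborel) \<partial>lborel)"
    by (rule lborel_pair.Fubini') simp
  also have "\<dots> = ennreal ((l2n f)\<^sup>2)"
    by (simp add: nn_integral_cmult sh nn_integral_multc g1)
  also have "(\<integral>\<^sup>+y. ?q y \<partial>lborel) = ennreal ((l2n f)\<^sup>2)" by (rule l2n_nn[OF f])
  also have "ennreal c * (ennreal ((l2n f)\<^sup>2) * 1) + ennreal c * ennreal ((l2n f)\<^sup>2) = ennreal ((l2n f)\<^sup>2)"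
    using c0 cc by (simp flip: distrib_right ennreal_plus)
  finally show ?thesis by (simp add: ennreal_le_iff)
qed

lemma gauss_0: "gauss 0 = 1 / sqrt (2 * pi)"
  by (simp add: std_normal_density_def)

lemma inverse_Suc_tendsto: "(\<lambda>n. 1 / real (Suc n)) \<longlonglongrightarrow> 0"
  using LIMSEQ_inverse_real_of_nat by (simp only: inverse_eq_divide)

lemma gauss_scaled_tendsto: "(\<lambda>n. gauss (1 / real (Suc n) * x)) \<longlonglongrightarrow> gauss 0"
proof -
  have t: "(\<lambda>n. 1 / real (Suc n) * x) \<longlonglongrightarrow> 0 * x"
    by (rule tendsto_mult_right[OF inverse_Suc_tendsto])
  have "(\<lambda>n. 1 / sqrt (2 * pi) * exp (- (1 / real (Suc n) * x)\<^sup>2 / 2)) \<longlonglongrightarrow> 1 / sqrt (2 * pi) * exp (- (0 * x)\<^sup>2 / 2)"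
    by (intro tendsto_mult tendsto_const tendsto_exp tendsto_divide tendsto_minus tendsto_power t) simp
  then show ?thesis by (simp only: std_normal_density_def mult_zero_left)
qed

text \<open>The smoothed identity with g = f is bounded uniformly in \<sigma>, and Fatou's lemma
  removes the Gaussian; its value 1 / sqrt (2 pi) at 0 accounts for the constant. The inequality
  suffices to extend the transform by approximation; equality comes only after inversion.\<close>

lemma ft_L2_bound:
  assumes f: "integrable lborel f" "L2 f"
  shows ft_L2: "L2 (ft f)" and ft_l2n_le: "l2n (ft f) \<le> sqrt (2 * pi) * l2n f"
proof -
  have [measurable]: "ft f \<in> borel_measurable borel" using f by simp
  let ?F = "\<lambda>n \<xi>. ennreal ((cmod (ft f \<xi>))\<^sup>2 * gauss (1 / real (Suc n) * \<xi>))"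
  have bd: "(\<integral>\<^sup>+\<xi>. ?F n \<xi> \<partial>lborel) \<le> ennreal (sqrt (2 * pi) * (l2n f)\<^sup>2)" for n
  proof -
    let ?\<sigma> = "1 / real (Suc n)"
    have "integrable lborel (\<lambda>\<xi>. (ft f \<xi> * cnj (ft f \<xi>)) * complex_of_real (gauss (?\<sigma> * \<xi>)))"
      by (rule integrable_bounded_mult[where B = "(LINT x|lborel. cmod (f x)) * (LINT x|lborel. cmod (f x))"])
        (use gauss_scaled_integrable[of ?\<sigma>] in \<open>auto simp: norm_mult intro!: mult_mono ft_bound f\<close>)
    then have "integrable lborel (\<lambda>\<xi>. complex_of_real ((cmod (ft f \<xi>))\<^sup>2 * gauss (?\<sigma> * \<xi>)))"
      by (simp only: complex_norm_square[symmetric] of_real_mult of_real_power)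
    then have int: "integrable lborel (\<lambda>\<xi>. (cmod (ft f \<xi>))\<^sup>2 * gauss (?\<sigma> * \<xi>))"
      by (simp only: complex_of_real_integrable_eq)
    have "complex_of_real (LINT \<xi>|lborel. (cmod (ft f \<xi>))\<^sup>2 * gauss (?\<sigma> * \<xi>)) = (LINT \<xi>|lborel. ft f \<xi> * cnj (ft f \<xi>) * complex_of_real (gauss (?\<sigma> * \<xi>)))"
      by (simp only: complex_norm_square[symmetric] of_real_mult of_real_power integral_complex_of_real[symmetric])
    then have "complex_of_real (LINT \<xi>|lborel. (cmod (ft f \<xi>))\<^sup>2 * gauss (?\<sigma> * \<xi>))
        = complex_of_real (sqrt (2 * pi)) * (LINT y|lborel. cnj (f y) * (LINT z|lborel. f (y + ?\<sigma> * z) * complex_of_real (gauss z)))"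
      by (rule trans[OF _ gauss_smoothed_Parseval[OF f(1) f(1)]]) simp
    from arg_cong[OF this, of cmod]
    have "\<bar>LINT \<xi>|lborel. (cmod (ft f \<xi>))\<^sup>2 * gauss (?\<sigma> * \<xi>)\<bar>
        = sqrt (2 * pi) * cmod (LINT y|lborel. cnj (f y) * (LINT z|lborel. f (y + ?\<sigma> * z) * complex_of_real (gauss z)))"
      by (simp only: norm_mult norm_of_real abs_of_nonneg real_sqrt_ge_zero pi_ge_zero mult_nonneg_nonneg zero_le_numeral)
    also have "\<dots> \<le> sqrt (2 * pi) * (l2n f)\<^sup>2"
      by (intro mult_left_mono smoothed_sq_bound f) simp
    finally have "(LINT \<xi>|lborel. (cmod (ft f \<xi>))\<^sup>2 * gauss (?\<sigma> * \<xi>)) \<le> sqrt (2 * pi) * (l2n f)\<^sup>2"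
      by simp
    then show ?thesis
      by (subst nn_integral_eq_integral[OF int]) (auto intro: ennreal_leI)
  qed
  have "(\<integral>\<^sup>+\<xi>. ennreal ((cmod (ft f \<xi>))\<^sup>2 * gauss 0) \<partial>lborel) = (\<integral>\<^sup>+\<xi>. liminf (\<lambda>n. ?F n \<xi>) \<partial>lborel)"
  proof (rule nn_integral_cong)
    fix \<xi>
    have "(\<lambda>n. ?F n \<xi>) \<longlonglongrightarrow> ennreal ((cmod (ft f \<xi>))\<^sup>2 * gauss 0)"
      by (intro tendsto_ennrealI tendsto_intros gauss_scaled_tendsto)
    then show "ennreal ((cmod (ft f \<xi>))\<^sup>2 * gauss 0) = liminf (\<lambda>n. ?F n \<xi>)"
      by (rule lim_imp_Liminf[OF trivial_limit_sequentially, symmetric])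
  qed
  also have "\<dots> \<le> liminf (\<lambda>n. \<integral>\<^sup>+\<xi>. ?F n \<xi> \<partial>lborel)"
    by (rule nn_integral_liminf) auto
  also have "\<dots> \<le> liminf (\<lambda>n::nat. ennreal (sqrt (2 * pi) * (l2n f)\<^sup>2))"
    by (intro Liminf_mono always_eventually allI bd)
  also have "\<dots> = ennreal (sqrt (2 * pi) * (l2n f)\<^sup>2)" by (simp add: Liminf_const)
  finally have le: "(\<integral>\<^sup>+\<xi>. ennreal ((cmod (ft f \<xi>))\<^sup>2) \<partial>lborel) * ennreal (gauss 0) \<le> ennreal (sqrt (2 * pi) * (l2n f)\<^sup>2)"
    by (simp add: ennreal_mult nn_integral_multc)
  have "(\<integral>\<^sup>+\<xi>. ennreal ((cmod (ft f \<xi>))\<^sup>2) \<partial>lborel) = (\<integral>\<^sup>+\<xi>. ennreal ((cmod (ft f \<xi>))\<^sup>2) \<partial>lborel) * ennreal (gauss 0) * ennreal (sqrt (2 * pi))"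
    by (simp add: mult.assoc gauss_0 flip: ennreal_mult)
  also have "\<dots> \<le> ennreal (sqrt (2 * pi) * (l2n f)\<^sup>2) * ennreal (sqrt (2 * pi))"
    by (rule mult_right_mono[OF le]) simp
  also have "\<dots> = ennreal ((sqrt (2 * pi) * l2n f)\<^sup>2)"
    by (simp add: power_mult_distrib mult_ac flip: ennreal_mult)
  finally have le2: "(\<integral>\<^sup>+\<xi>. ennreal ((cmod (ft f \<xi>))\<^sup>2) \<partial>lborel) \<le> ennreal ((sqrt (2 * pi) * l2n f)\<^sup>2)" .
  show "L2 (ft f)"
    unfolding L2_def using le2
    by (auto intro!: integrableI_bounded simp: order.strict_trans1 less_top[symmetric] top_unique)
  from le2 show "l2n (ft f) \<le> sqrt (2 * pi) * l2n f"
    unfolding l2n_nn[OF \<open>L2 (ft f)\<close>] by (auto intro: power2_le_imp_le simp: ennreal_le_iff)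
qed

lemma indicator_integrable[simp]: "integrable lborel (indicator {a..b::real} :: real \<Rightarrow> complex)"
proof -
  have "integrable lborel (\<lambda>x. complex_of_real (indicator {a..b} x))"
    by (simp add: emeasure_lborel_Icc_eq)
  then show ?thesis by (simp add: of_real_indicator)
qed

lemma of_real_indicator_complex: "(indicator A x :: complex) = complex_of_real (indicator A x)"
  by (simp add: indicator_def)

text \<open>With an indicator as one factor, the Gaussian averages converge at every point other
  than the two endpoints, so dominated convergence passes to the limit in the smoothed identity.
  Indicators of intervals are also enough to test against.\<close>

lemma ft_indicator_Parseval:
  assumes g: "integrable lborel g" "L2 g"
  shows "l2ip (ft (indicator {a..b})) (ft g) = complex_of_real (2 * pi) * l2ip (indicator {a..b}) g"
proof -
  let ?I = "indicator {a..b} :: real \<Rightarrow> complex"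
  have [measurable]: "g \<in> borel_measurable borel" using g by auto
  let ?\<sigma> = "\<lambda>n. 1 / real (Suc n)"
  have [measurable]: "ft ?I \<in> borel_measurable borel" "ft g \<in> borel_measurable borel" using g by auto
  have "(\<lambda>n. LINT \<xi>|lborel. ft ?I \<xi> * cnj (ft g \<xi>) * complex_of_real (gauss (?\<sigma> n * \<xi>)))
    \<longlonglongrightarrow> (LINT \<xi>|lborel. ft ?I \<xi> * cnj (ft g \<xi>) * complex_of_real (gauss 0))"
  proof (rule integral_dominated_convergence[where w = "\<lambda>\<xi>. cmod (ft ?I \<xi> * cnj (ft g \<xi>)) * gauss 0"])
    show "integrable lborel (\<lambda>\<xi>. cmod (ft ?I \<xi> * cnj (ft g \<xi>)) * gauss 0)"
      using L2_ip_integrable[OF ft_L2[OF indicator_integrable indicator_L2] ft_L2[OF g]] by auto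
    show "AE \<xi> in lborel. (\<lambda>n. ft ?I \<xi> * cnj (ft g \<xi>) * complex_of_real (gauss (?\<sigma> n * \<xi>))) \<longlonglongrightarrow> ft ?I \<xi> * cnj (ft g \<xi>) * complex_of_real (gauss 0)"
      by (intro AE_I2 tendsto_intros gauss_scaled_tendsto)
    show "AE \<xi> in lborel. norm (ft ?I \<xi> * cnj (ft g \<xi>) * complex_of_real (gauss (?\<sigma> n * \<xi>))) \<le> cmod (ft ?I \<xi> * cnj (ft g \<xi>)) * gauss 0" for n
      using gauss_le by (auto simp: norm_mult intro!: mult_left_mono AE_I2)
  qed auto
  then have l: "(\<lambda>n. LINT \<xi>|lborel. ft ?I \<xi> * cnj (ft g \<xi>) * complex_of_real (gauss (?\<sigma> n * \<xi>))) \<longlonglongrightarrow> l2ip (ft ?I) (ft g) * complex_of_real (gauss 0)"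
    by (simp add: l2ip_def)
  have inner: "(\<lambda>n. LINT z|lborel. ?I (y + ?\<sigma> n * z) * complex_of_real (gauss z)) \<longlonglongrightarrow> (LINT z|lborel. ?I y * complex_of_real (gauss z))"
    if "y \<noteq> a" "y \<noteq> b" for y
  proof (rule integral_dominated_convergence[where w = gauss])
    show "AE z in lborel. (\<lambda>n. ?I (y + ?\<sigma> n * z) * complex_of_real (gauss z)) \<longlonglongrightarrow> ?I y * complex_of_real (gauss z)"
    proof (intro AE_I2 tendsto_mult tendsto_const)
      fix z
      have "(\<lambda>n. y + ?\<sigma> n * z) \<longlonglongrightarrow> y + 0 * z"
        by (intro tendsto_intros inverse_Suc_tendsto)
      then have t: "(\<lambda>n. y + ?\<sigma> n * z) \<longlonglongrightarrow> y" by simp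
      have "\<forall>\<^sub>F n in sequentially. ?I (y + ?\<sigma> n * z) = ?I y"
      proof (cases "y < a \<or> y > b")
        case True
        then have "\<forall>\<^sub>F n in sequentially. y + ?\<sigma> n * z \<in> - {a..b}"
          by (intro topological_tendstoD[OF t]) auto
        then show ?thesis by eventually_elim (use True in auto)
      next
        case False
        then have "\<forall>\<^sub>F n in sequentially. y + ?\<sigma> n * z \<in> {a<..<b}"
          using that by (intro topological_tendstoD[OF t]) auto
        then show ?thesis by eventually_elim (use False in auto)
      qed
      then show "(\<lambda>n. ?I (y + ?\<sigma> n * z)) \<longlonglongrightarrow> ?I y"
        by (rule tendsto_eventually)
    qed
    show "AE z in lborel. norm (?I (y + ?\<sigma> n * z) * complex_of_real (gauss z)) \<le> gauss z" for n
      by (auto simp: norm_mult indicator_def)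
  qed (auto simp: gauss_integrable)
  have "(\<lambda>n. LINT y|lborel. cnj (g y) * (LINT z|lborel. ?I (y + ?\<sigma> n * z) * complex_of_real (gauss z))) \<longlonglongrightarrow> (LINT y|lborel. cnj (g y) * ?I y)"
  proof (rule integral_dominated_convergence[where w = "\<lambda>y. cmod (g y)"])
    show "AE y in lborel. (\<lambda>n. cnj (g y) * (LINT z|lborel. ?I (y + ?\<sigma> n * z) * complex_of_real (gauss z))) \<longlonglongrightarrow> cnj (g y) * ?I y"
      using AE_lborel_singleton[of a] AE_lborel_singleton[of b]
    proof eventually_elim
      case (elim y)
      then show ?case using inner[of y] by (intro tendsto_intros) (simp add: gauss_total)
    qed
    show "AE y in lborel. norm (cnj (g y) * (LINT z|lborel. ?I (y + ?\<sigma> n * z) * complex_of_real (gauss z))) \<le> cmod (g y)" for n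
    proof (intro AE_I2)
      fix y
      have "cmod (LINT z|lborel. ?I (y + ?\<sigma> n * z) * complex_of_real (gauss z)) \<le> (LINT z|lborel. gauss z)"
        by (rule order_trans[OF integral_norm_bound], rule integral_mono_AE')
          (auto simp: norm_mult gauss_integrable indicator_def)
      then show "norm (cnj (g y) * (LINT z|lborel. ?I (y + ?\<sigma> n * z) * complex_of_real (gauss z))) \<le> cmod (g y)"
        by (simp add: norm_mult gauss_total mult_left_le)
    qed
  qed (use g in auto)
  then have "(\<lambda>n. complex_of_real (sqrt (2 * pi)) * (LINT y|lborel. cnj (g y) * (LINT z|lborel. ?I (y + ?\<sigma> n * z) * complex_of_real (gauss z))))
     \<longlonglongrightarrow> complex_of_real (sqrt (2 * pi)) * l2ip ?I g"
    by (intro tendsto_intros) (simp add: l2ip_def mult.commute)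
  then have r: "(\<lambda>n. LINT \<xi>|lborel. ft ?I \<xi> * cnj (ft g \<xi>) * complex_of_real (gauss (?\<sigma> n * \<xi>))) \<longlonglongrightarrow> complex_of_real (sqrt (2 * pi)) * l2ip ?I g"
    using gauss_smoothed_Parseval[OF indicator_integrable g(1), of "?\<sigma> _"] by simp
  have "l2ip (ft ?I) (ft g) * complex_of_real (gauss 0) = complex_of_real (sqrt (2 * pi)) * l2ip ?I g"
    by (rule LIMSEQ_unique[OF l r])
  moreover have "complex_of_real (sqrt (2 * pi)) * complex_of_real (gauss 0) = 1"
    by (simp add: gauss_0 del: real_sqrt_mult flip: of_real_mult)
  ultimately have "l2ip (ft ?I) (ft g) = complex_of_real (sqrt (2 * pi)) * (complex_of_real (sqrt (2 * pi)) * l2ip ?I g)"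
    by (metis mult.commute mult.left_commute mult_1)
  moreover have "complex_of_real (sqrt (2 * pi)) * complex_of_real (sqrt (2 * pi)) = complex_of_real (2 * pi)"
    by (simp only: of_real_mult[symmetric] real_sqrt_mult_self) simp
  ultimately show ?thesis by (simp only: mult.assoc[symmetric])
qed

section \<open>Extension of the transform to square integrable functions\<close>

lemma ft_add: "integrable lborel f \<Longrightarrow> integrable lborel g \<Longrightarrow> ft (\<lambda>x. f x + g x) \<xi> = ft f \<xi> + ft g \<xi>"
  by (simp add: ft_def distrib_right ft_integrable)

lemma ft_diff: "integrable lborel f \<Longrightarrow> integrable lborel g \<Longrightarrow> ft (\<lambda>x. f x - g x) \<xi> = ft f \<xi> - ft g \<xi>"
  by (simp add: ft_def left_diff_distrib ft_integrable)

lemma ft_cmult: "ft (\<lambda>x. c * f x) \<xi> = c * ft f \<xi>"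
  by (simp add: ft_def mult.assoc)

definition trunc :: "(real \<Rightarrow> complex) \<Rightarrow> real \<Rightarrow> real \<Rightarrow> complex" where
  "trunc f R x = indicator {-R..R} x * f x"

lemma trunc_L2: "L2 f \<Longrightarrow> L2 (trunc f R)"
  unfolding trunc_def by (rule L2_bounded_mult[where B = 1]) (auto simp: indicator_def)

lemma trunc_integrable: "L2 f \<Longrightarrow> integrable lborel (trunc f R)"
  unfolding trunc_def by (intro L2_mult_integrable indicator_L2)

lemma set_integral_trunc: "(LINT x:{-R..R}|lborel. f x * ee (- \<xi>) x) = ft (trunc f R) \<xi>"
  unfolding set_lebesgue_integral_def ft_def trunc_def
  by (intro Bochner_Integration.integral_cong refl) (simp add: indicator_def)

lemma trunc_tendsto:
  assumes f: "L2 f" shows "((\<lambda>R. l2n (\<lambda>x. trunc f R x - f x)) \<longlongrightarrow> 0) at_top"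
proof -
  have [measurable]: "f \<in> borel_measurable borel" using f by (simp add: L2_def)
  have "((\<lambda>R. LINT x|lborel. (cmod (trunc f R x - f x))\<^sup>2) \<longlongrightarrow> (LINT x|(lborel :: real measure). 0 :: real)) at_top"
  proof (rule integral_dominated_convergence_at_top[where w = "\<lambda>x. (cmod (f x))\<^sup>2"])
    show "AE x in lborel. ((\<lambda>R. (cmod (trunc f R x - f x))\<^sup>2) \<longlongrightarrow> 0) at_top"
    proof (intro AE_I2 tendsto_eventually)
      fix x :: real
      show "\<forall>\<^sub>F R in at_top. (cmod (trunc f R x - f x))\<^sup>2 = 0"
        using eventually_ge_at_top[of "\<bar>x\<bar>"] by eventually_elim (auto simp: trunc_def indicator_def)
    qed
    show "\<forall>\<^sub>F R in at_top. AE x in lborel. norm ((cmod (trunc f R x - f x))\<^sup>2) \<le> (cmod (f x))\<^sup>2"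
      by (intro always_eventually allI AE_I2) (simp add: trunc_def indicator_def)
  qed (use f in \<open>auto simp: L2_def trunc_def[abs_def]\<close>)
  from tendsto_real_sqrt[OF this] show ?thesis by (simp add: l2n_def)
qed

lemma has_fourier_iff:
  assumes f: "L2 f"
  shows "has_fourier f F \<longleftrightarrow> L2 F \<and> ((\<lambda>R. l2n (\<lambda>\<xi>. ft (trunc f R) \<xi> - F \<xi>)) \<longlongrightarrow> 0) at_top"
proof (cases "L2 F")
  case True
  have "L2 (\<lambda>\<xi>. ft (trunc f R) \<xi> - F \<xi>)" for R
    by (intro L2_diff ft_L2 trunc_integrable trunc_L2 f True)
  from l2n_tendsto_0_of_nn[OF this, of "\<lambda>R. R"] show ?thesis
    unfolding has_fourier_def set_integral_trunc by simp
qed (simp add: has_fourier_def)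

lemma ft_trunc_diff:
  assumes f: "L2 f" and g: "L2 g"
  shows "l2n (\<lambda>\<xi>. ft (trunc f R) \<xi> - ft (trunc g S) \<xi>) \<le> sqrt (2 * pi) * l2n (\<lambda>x. trunc f R x - trunc g S x)"
proof -
  have "(\<lambda>\<xi>. ft (trunc f R) \<xi> - ft (trunc g S) \<xi>) = ft (\<lambda>x. trunc f R x - trunc g S x)"
    by (intro ext ft_diff[symmetric] trunc_integrable f g)
  then show ?thesis
    using ft_l2n_le[of "\<lambda>x. trunc f R x - trunc g S x"] f g
    by (simp add: trunc_integrable L2_diff trunc_L2)
qed

text \<open>Truncations converge in L2 and the transform is bounded there, so the transforms along
  integer cut-offs form a Cauchy sequence. The estimate by \<open>d R\<close> then carries the
  convergence over to real cut-offs, as the definition demands.\<close>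

lemma has_fourier_exists:
  assumes f: "L2 f" shows "\<exists>F. has_fourier f F"
proof -
  have tL: "L2 (trunc f R)" for R by (rule trunc_L2[OF f])
  have FL: "L2 (ft (trunc f R))" for R by (intro ft_L2 trunc_integrable tL f)
  have le: "l2n (\<lambda>\<xi>. ft (trunc f R) \<xi> - ft (trunc f S) \<xi>) \<le> sqrt (2 * pi) * l2n (\<lambda>x. trunc f R x - f x) + sqrt (2 * pi) * l2n (\<lambda>x. trunc f S x - f x)" for R S
  proof -
    have "l2n (\<lambda>x. trunc f R x - trunc f S x) \<le> l2n (\<lambda>x. trunc f R x - f x) + l2n (\<lambda>x. trunc f S x - f x)"
      using l2n_diff_triangle[OF tL[of R] f tL[of S]] l2n_minus_commute[of f "trunc f S"] by simp
    then have "sqrt (2 * pi) * l2n (\<lambda>x. trunc f R x - trunc f S x) \<le> sqrt (2 * pi) * (l2n (\<lambda>x. trunc f R x - f x) + l2n (\<lambda>x. trunc f S x - f x))"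
      by (rule mult_left_mono) simp
    with ft_trunc_diff[OF f f, of R S] show ?thesis unfolding distrib_left by (rule order_trans)
  qed
  define d where "d R = sqrt (2 * pi) * l2n (\<lambda>x. trunc f R x - f x)" for R
  have d: "(d \<longlongrightarrow> 0) at_top"
    unfolding d_def using tendsto_mult_left[OF trunc_tendsto[OF f], of "sqrt (2 * pi)"] by (simp only: mult_zero_right)
  have dn: "(\<lambda>n. d (real n)) \<longlonglongrightarrow> 0"
    by (rule filterlim_compose[OF d filterlim_real_sequentially])
  have le: "l2n (\<lambda>\<xi>. ft (trunc f R) \<xi> - ft (trunc f S) \<xi>) \<le> d R + d S" for R S
    unfolding d_def by (rule le)
  have "\<exists>N. \<forall>m\<ge>N. \<forall>n\<ge>N. l2n (\<lambda>\<xi>. ft (trunc f (real m)) \<xi> - ft (trunc f (real n)) \<xi>) < e" if "e > 0" for e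
  proof -
    have "\<forall>\<^sub>F n in sequentially. d (real n) < e / 2"
      using that by (intro order_tendstoD(2)[OF dn]) simp
    then obtain N where N: "\<And>n. n \<ge> N \<Longrightarrow> d (real n) < e / 2"
      unfolding eventually_sequentially by blast
    have "l2n (\<lambda>\<xi>. ft (trunc f (real m)) \<xi> - ft (trunc f (real n)) \<xi>) < e" if "m \<ge> N" "n \<ge> N" for m n
      using le[of "real m" "real n"] N[OF that(1)] N[OF that(2)] by linarith
    then show ?thesis by blast
  qed
  from Riesz_Fischer[OF FL this] obtain F where F: "L2 F" "(\<lambda>n. l2n (\<lambda>\<xi>. ft (trunc f (real n)) \<xi> - F \<xi>)) \<longlonglongrightarrow> 0"
    by blast
  \<comment> \<open>R stays fixed while the auxiliary integer cut-off n tends to infinity.\<close>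
  have "l2n (\<lambda>\<xi>. ft (trunc f R) \<xi> - F \<xi>) \<le> d R" for R
  proof (rule LIMSEQ_le_const)
    have "(\<lambda>n. (d R + d (real n)) + l2n (\<lambda>\<xi>. ft (trunc f (real n)) \<xi> - F \<xi>)) \<longlonglongrightarrow> (d R + 0) + 0"
      by (intro tendsto_add tendsto_const dn F(2))
    then show "(\<lambda>n. (d R + d (real n)) + l2n (\<lambda>\<xi>. ft (trunc f (real n)) \<xi> - F \<xi>)) \<longlonglongrightarrow> d R" by simp
    have "l2n (\<lambda>\<xi>. ft (trunc f R) \<xi> - F \<xi>) \<le> (d R + d (real n)) + l2n (\<lambda>\<xi>. ft (trunc f (real n)) \<xi> - F \<xi>)" for n
      using l2n_diff_triangle[OF FL[of R] FL[of "real n"] F(1)] le[of R "real n"] by linarith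
    then show "\<exists>N. \<forall>n\<ge>N. l2n (\<lambda>\<xi>. ft (trunc f R) \<xi> - F \<xi>) \<le> (d R + d (real n)) + l2n (\<lambda>\<xi>. ft (trunc f (real n)) \<xi> - F \<xi>)"
      by blast
  qed
  then have "((\<lambda>R. l2n (\<lambda>\<xi>. ft (trunc f R) \<xi> - F \<xi>)) \<longlongrightarrow> 0) at_top"
    by (intro Lim_null_comparison[OF _ d] always_eventually allI) simp
  then show ?thesis using F(1) has_fourier_iff[OF f] by blast
qed

lemma has_fourier_fourier: "L2 f \<Longrightarrow> has_fourier f (fourier f)"
  unfolding fourier_def by (rule someI_ex[OF has_fourier_exists])

lemma has_fourier_L2: "has_fourier f F \<Longrightarrow> L2 F"
  by (simp add: has_fourier_def)

lemma fourier_L2: "L2 f \<Longrightarrow> L2 (fourier f)"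
  by (blast intro: has_fourier_L2 has_fourier_fourier)

lemma has_fourier_add:
  assumes "L2 f" "L2 g" "has_fourier f F" "has_fourier g G"
  shows "has_fourier (\<lambda>x. f x + g x) (\<lambda>\<xi>. F \<xi> + G \<xi>)"
proof -
  have FG: "L2 F" "L2 G" using assms has_fourier_L2 by blast+
  have lim: "((\<lambda>R. l2n (\<lambda>\<xi>. ft (trunc f R) \<xi> - F \<xi>) + l2n (\<lambda>\<xi>. ft (trunc g R) \<xi> - G \<xi>)) \<longlongrightarrow> 0) at_top"
    using tendsto_add[of "\<lambda>R. l2n (\<lambda>\<xi>. ft (trunc f R) \<xi> - F \<xi>)" 0 at_top] assms
    by (fastforce simp: has_fourier_iff)
  have tr: "trunc (\<lambda>x. f x + g x) R = (\<lambda>x. trunc f R x + trunc g R x)" for R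
    by (simp add: trunc_def fun_eq_iff distrib_left)
  have e: "(\<lambda>\<xi>. ft (trunc (\<lambda>x. f x + g x) R) \<xi> - (F \<xi> + G \<xi>)) = (\<lambda>\<xi>. (ft (trunc f R) \<xi> - F \<xi>) + (ft (trunc g R) \<xi> - G \<xi>))" for R
    by (simp add: fun_eq_iff tr ft_add[OF trunc_integrable[OF assms(1)] trunc_integrable[OF assms(2)]])
  have "((\<lambda>R. l2n (\<lambda>\<xi>. ft (trunc (\<lambda>x. f x + g x) R) \<xi> - (F \<xi> + G \<xi>))) \<longlongrightarrow> 0) at_top"
    unfolding e using l2n_add[OF L2_diff[OF ft_L2[OF trunc_integrable trunc_L2] FG(1)] L2_diff[OF ft_L2[OF trunc_integrable trunc_L2] FG(2)]] assms
    by (intro Lim_null_comparison[OF _ lim] always_eventually allI) simp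
  then show ?thesis using has_fourier_iff[OF L2_add] assms FG L2_add by blast
qed

lemma has_fourier_cmult:
  assumes "L2 f" "has_fourier f F" shows "has_fourier (\<lambda>x. c * f x) (\<lambda>\<xi>. c * F \<xi>)"
proof -
  have FG: "L2 F" using assms has_fourier_L2 by blast
  have "trunc (\<lambda>x. c * f x) R = (\<lambda>x. c * trunc f R x)" for R
    by (simp add: trunc_def fun_eq_iff)
  then have e: "(\<lambda>\<xi>. ft (trunc (\<lambda>x. c * f x) R) \<xi> - c * F \<xi>) = (\<lambda>\<xi>. c * (ft (trunc f R) \<xi> - F \<xi>))" for R
    by (simp add: ft_cmult right_diff_distrib)
  have "((\<lambda>R. l2n (\<lambda>\<xi>. ft (trunc (\<lambda>x. c * f x) R) \<xi> - c * F \<xi>)) \<longlongrightarrow> cmod c * 0) at_top"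
    unfolding e l2n_cmult using assms has_fourier_iff by (intro tendsto_intros) blast
  then show ?thesis using has_fourier_iff[OF L2_cmult] assms FG L2_cmult by simp
qed

lemma has_fourier_diff:
  assumes "L2 f" "L2 g" "has_fourier f F" "has_fourier g G"
  shows "has_fourier (\<lambda>x. f x - g x) (\<lambda>\<xi>. F \<xi> - G \<xi>)"
  using has_fourier_add[OF assms(1) L2_cmult[OF assms(2), of "-1"] assms(3) has_fourier_cmult[OF assms(2,4), of "-1"]] by simp

lemma has_fourier_le:
  assumes "L2 f" "has_fourier f F" shows "l2n F \<le> sqrt (2 * pi) * l2n f"
proof (rule LIMSEQ_le)
  have F: "L2 F" "((\<lambda>R. l2n (\<lambda>\<xi>. ft (trunc f R) \<xi> - F \<xi>)) \<longlongrightarrow> 0) at_top"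
    using assms has_fourier_iff by blast+
  have *: "((\<lambda>R. l2n (ft (trunc f R))) \<longlongrightarrow> l2n F) at_top"
    by (rule l2n_tendsto[OF _ F]) (intro ft_L2 trunc_integrable trunc_L2 assms)
  show "(\<lambda>n. l2n (ft (trunc f (real n)))) \<longlonglongrightarrow> l2n F"
    by (rule filterlim_compose[OF * filterlim_real_sequentially])
  have *: "((\<lambda>R. l2n (trunc f R)) \<longlongrightarrow> l2n f) at_top"
    by (rule l2n_tendsto[OF trunc_L2[OF assms(1)] assms(1) trunc_tendsto[OF assms(1)]])
  show "(\<lambda>n. sqrt (2 * pi) * l2n (trunc f (real n))) \<longlonglongrightarrow> sqrt (2 * pi) * l2n f"
    by (rule tendsto_mult_left[OF filterlim_compose[OF * filterlim_real_sequentially]])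
  show "\<exists>N. \<forall>n\<ge>N. l2n (ft (trunc f (real n))) \<le> sqrt (2 * pi) * l2n (trunc f (real n))"
    using ft_l2n_le[OF trunc_integrable[OF assms(1)] trunc_L2[OF assms(1)]] by blast
qed

lemma has_fourier_unique:
  assumes "L2 f" "has_fourier f F" "has_fourier f G" shows "AE \<xi> in lborel. F \<xi> = G \<xi>"
proof -
  have FG: "L2 F" "L2 G" using assms has_fourier_L2 by blast+
  have "has_fourier (\<lambda>x. 0) (\<lambda>\<xi>. F \<xi> - G \<xi>)"
    using has_fourier_diff[OF assms(1,1,2,3)] by simp
  from has_fourier_le[OF L2_0 this] have "l2n (\<lambda>\<xi>. F \<xi> - G \<xi>) = 0"
    using l2n_nonneg[of "\<lambda>\<xi>. F \<xi> - G \<xi>"] l2n_cmult[of 0 "\<lambda>x. 0"] by (simp del: l2n_nonneg)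
  then show ?thesis using l2n_0_iff[OF L2_diff[OF FG]] by simp
qed

lemma has_fourier_cong_AE:
  assumes "has_fourier f F" "AE x in lborel. f x = g x"
    "f \<in> borel_measurable borel" "g \<in> borel_measurable borel"
  shows "has_fourier g F"
proof -
  have "ft (trunc f R) \<xi> = ft (trunc g R) \<xi>" for R \<xi>
    unfolding ft_def trunc_def using assms(2-4) by (intro integral_cong_AE) auto
  then show ?thesis using assms(1) by (simp add: has_fourier_def set_integral_trunc)
qed

text \<open>An equality of functions, not merely almost everywhere: both arguments admit exactly the
  same transforms, so the choice operator selects the same one.\<close>

lemma fourier_cong_AE:
  assumes "AE x in lborel. f x = g x"
    "f \<in> borel_measurable borel" "g \<in> borel_measurable borel"
  shows "fourier f = fourier g"
proof -
  have "has_fourier f F \<longleftrightarrow> has_fourier g F" for F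
    using has_fourier_cong_AE[of f F g] has_fourier_cong_AE[of g F f] assms by (auto simp: eq_commute)
  then show ?thesis by (simp add: fourier_def)
qed

lemma has_fourier_cong_AE2:
  assumes "L2 f" "has_fourier f F" "AE \<xi> in lborel. F \<xi> = G \<xi>" "G \<in> borel_measurable borel"
  shows "has_fourier f G"
proof -
  have F: "L2 F" using assms has_fourier_L2 by blast
  have G: "L2 G" by (rule L2_cong_AE[OF F assms(4,3)])
  have "l2n (\<lambda>\<xi>. ft (trunc f R) \<xi> - G \<xi>) = l2n (\<lambda>\<xi>. ft (trunc f R) \<xi> - F \<xi>)" for R
  proof (rule l2n_cong_AE)
    show "AE \<xi> in lborel. ft (trunc f R) \<xi> - G \<xi> = ft (trunc f R) \<xi> - F \<xi>"
      using assms(3) by eventually_elim simp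
  qed (use F G trunc_integrable[OF assms(1), of R] in \<open>auto simp: L2_def\<close>)
  then show ?thesis using assms G has_fourier_iff[OF assms(1)] by simp
qed

lemma has_fourier_ft:
  assumes f: "integrable lborel f" "L2 f" shows "has_fourier f (ft f)"
proof -
  have le: "l2n (\<lambda>\<xi>. ft (trunc f R) \<xi> - ft f \<xi>) \<le> sqrt (2 * pi) * l2n (\<lambda>x. trunc f R x - f x)" for R
  proof -
    have "(\<lambda>\<xi>. ft (trunc f R) \<xi> - ft f \<xi>) = ft (\<lambda>x. trunc f R x - f x)"
      using f by (intro ext ft_diff[symmetric] trunc_integrable)
    then show ?thesis
      using ft_l2n_le[of "\<lambda>x. trunc f R x - f x"] f by (simp add: trunc_integrable L2_diff trunc_L2)
  qed
  have lim: "((\<lambda>R. sqrt (2 * pi) * l2n (\<lambda>x. trunc f R x - f x)) \<longlongrightarrow> 0) at_top"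
    using tendsto_mult_left[OF trunc_tendsto[OF f(2)], of "sqrt (2 * pi)"] by (simp only: mult_zero_right)
  have "((\<lambda>R. l2n (\<lambda>\<xi>. ft (trunc f R) \<xi> - ft f \<xi>)) \<longlongrightarrow> 0) at_top"
    by (rule Lim_null_comparison[OF _ lim]) (simp add: le)
  then show ?thesis using has_fourier_iff[OF f(2)] ft_L2[OF f] by simp
qed

section \<open>Inversion, surjectivity and Parseval's identity\<close>

lemma l2ip_scale: "l2ip f (\<lambda>x. c * g x) = cnj c * l2ip f g"
  by (simp add: l2ip_def mult.left_commute)

lemma l2ip_cnj: "cnj (l2ip f g) = l2ip g f"
  unfolding l2ip_def by (subst Bochner_Integration.integral_cnj[symmetric]) (simp add: mult.commute)

lemma fourier_exchange:
  assumes f: "L2 f" "has_fourier f F" and g: "L2 g" "has_fourier g G"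
  shows "(LINT x|lborel. f x * G x) = (LINT x|lborel. F x * g x)"
proof -
  have F: "L2 F" "((\<lambda>R. l2n (\<lambda>\<xi>. ft (trunc f R) \<xi> - F \<xi>)) \<longlongrightarrow> 0) at_top"
    using f has_fourier_iff by blast+
  have G: "L2 G" "((\<lambda>R. l2n (\<lambda>\<xi>. ft (trunc g R) \<xi> - G \<xi>)) \<longlongrightarrow> 0) at_top"
    using g has_fourier_iff by blast+
  have 1: "((\<lambda>R. l2ip (trunc f R) (\<lambda>x. cnj (ft (trunc g R) x))) \<longlongrightarrow> l2ip f (\<lambda>x. cnj (G x))) at_top"
    by (rule l2ip_tendsto) (use f g F G in \<open>auto intro!: trunc_L2 trunc_tendsto L2_cnj ft_L2 trunc_integrable simp: l2n_cnj_diff\<close>)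
  have 2: "((\<lambda>R. l2ip (ft (trunc f R)) (\<lambda>x. cnj (trunc g R x))) \<longlongrightarrow> l2ip F (\<lambda>x. cnj (g x))) at_top"
    by (rule l2ip_tendsto) (use f g F G in \<open>auto intro!: trunc_L2 trunc_tendsto L2_cnj ft_L2 trunc_integrable simp: l2n_cnj_diff\<close>)
  have 3: "l2ip (trunc f R) (\<lambda>x. cnj (ft (trunc g R) x)) = l2ip (ft (trunc f R)) (\<lambda>x. cnj (trunc g R x))" for R
    using ft_exchange[OF trunc_integrable[OF f(1)] trunc_integrable[OF g(1)]] by (simp add: l2ip_def)
  have "l2ip f (\<lambda>x. cnj (G x)) = l2ip F (\<lambda>x. cnj (g x))"
    by (rule tendsto_unique[OF trivial_limit_at_top_linorder 1 2[folded 3]])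
  then show ?thesis by (simp add: l2ip_def)
qed

lemma indicator_Parseval:
  assumes f: "L2 f" "has_fourier f F"
  shows "l2ip (ft (indicator {a..b})) F = complex_of_real (2 * pi) * l2ip (indicator {a..b}) f"
proof -
  let ?I = "indicator {a..b} :: real \<Rightarrow> complex"
  have F: "L2 F" "((\<lambda>R. l2n (\<lambda>\<xi>. ft (trunc f R) \<xi> - F \<xi>)) \<longlongrightarrow> 0) at_top"
    using f has_fourier_iff by blast+
  have c0: "((\<lambda>R. l2n (\<lambda>x. g x - g x)) \<longlongrightarrow> 0) at_top" for g :: "real \<Rightarrow> complex" by (simp add: l2n_def)
  have 1: "((\<lambda>R. l2ip (ft ?I) (ft (trunc f R))) \<longlongrightarrow> l2ip (ft ?I) F) at_top"
    by (rule l2ip_tendsto[OF _ _ _ _ c0]) (use f F in \<open>auto intro!: trunc_L2 ft_L2 trunc_integrable\<close>)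
  have 2: "((\<lambda>R. complex_of_real (2 * pi) * l2ip ?I (trunc f R)) \<longlongrightarrow> complex_of_real (2 * pi) * l2ip ?I f) at_top"
    by (intro tendsto_mult_left l2ip_tendsto[OF _ _ _ _ c0]) (use f F in \<open>auto intro!: trunc_L2 trunc_tendsto\<close>)
  show ?thesis
    by (rule tendsto_unique[OF trivial_limit_at_top_linorder 1[unfolded ft_indicator_Parseval[OF trunc_integrable[OF f(1)] trunc_L2[OF f(1)]]] 2])
qed

text \<open>The inverse transform is written as the forward transform between two conjugations,
  divided by 2 pi, so that no second limit has to be constructed. Both sides have the same inner
  products with indicators of intervals.\<close>

lemma fourier_inversion:
  assumes f: "L2 f" "has_fourier f F" and H: "has_fourier (\<lambda>\<xi>. cnj (F \<xi>)) H"
  shows "AE x in lborel. f x = complex_of_real (1 / (2 * pi)) * cnj (H x)"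
proof -
  have F: "L2 F" using f has_fourier_L2 by blast
  have HL: "L2 H" using H has_fourier_L2 by blast
  let ?g = "\<lambda>x. complex_of_real (1 / (2 * pi)) * cnj (H x)"
  have gL: "L2 ?g" by (intro L2_cmult L2_cnj HL)
  have eq: "l2ip f (indicator {a..b}) = l2ip ?g (indicator {a..b})" for a b
  proof -
    let ?I = "indicator {a..b} :: real \<Rightarrow> complex"
    have "l2ip ?I (\<lambda>x. cnj (H x)) = (LINT x|lborel. ?I x * H x)" by (simp add: l2ip_def)
    also have "\<dots> = (LINT \<xi>|lborel. ft ?I \<xi> * cnj (F \<xi>))"
      by (rule fourier_exchange[OF indicator_L2 has_fourier_ft[OF indicator_integrable indicator_L2] L2_cnj[OF F] H])
    also have "\<dots> = complex_of_real (2 * pi) * l2ip ?I f"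
      using indicator_Parseval[OF f] by (simp add: l2ip_def)
    finally have "l2ip ?I ?g = l2ip ?I f"
      unfolding l2ip_scale by simp
    then show ?thesis by (metis l2ip_cnj)
  qed
  have "AE x in lborel. f x - ?g x = 0"
  proof (rule L2_AE_zero_if_interval_integrals_zero[OF L2_diff[OF f(1) gL]])
    fix a b
    have "l2ip (\<lambda>x. f x - ?g x) (indicator {a..b}) = l2ip f (indicator {a..b}) - l2ip ?g (indicator {a..b})"
      using L2_ip_integrable[OF f(1) indicator_L2] L2_ip_integrable[OF gL indicator_L2]
      unfolding l2ip_def left_diff_distrib by (intro Bochner_Integration.integral_diff)
    then show "l2ip (\<lambda>x. f x - ?g x) (indicator {a..b}) = 0" using eq by simp
  qed
  then show ?thesis by eventually_elim simp
qed

text \<open>The preimage is read off from the inversion formula. That it works follows from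
  inversion applied to \<open>cnj F\<close> itself, whose transform \<open>H\<close> is known to
  exist.\<close>

lemma fourier_surj:
  assumes F: "L2 F" shows "\<exists>f. L2 f \<and> has_fourier f F"
proof -
  obtain H where H: "has_fourier (\<lambda>\<xi>. cnj (F \<xi>)) H" using has_fourier_exists[OF L2_cnj[OF F]] by blast
  have HL: "L2 H" using H has_fourier_L2 by blast
  obtain K where K: "has_fourier (\<lambda>x. cnj (H x)) K" using has_fourier_exists[OF L2_cnj[OF HL]] by blast
  have KL: "L2 K" using K has_fourier_L2 by blast
  let ?c = "complex_of_real (1 / (2 * pi))"
  have "AE \<xi> in lborel. cnj (F \<xi>) = ?c * cnj (K \<xi>)"
    by (rule fourier_inversion[OF L2_cnj[OF F] H K])
  then have e: "AE \<xi> in lborel. ?c * K \<xi> = F \<xi>"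
    by eventually_elim (metis complex_cnj_cnj complex_cnj_complex_of_real complex_cnj_mult)
  have "has_fourier (\<lambda>x. ?c * cnj (H x)) (\<lambda>\<xi>. ?c * K \<xi>)"
    by (rule has_fourier_cmult[OF L2_cnj[OF HL] K])
  from has_fourier_cong_AE2[OF L2_cmult[OF L2_cnj[OF HL]] this e] F
  have "has_fourier (\<lambda>x. ?c * cnj (H x)) F" by (simp add: L2_def)
  then show ?thesis using L2_cmult[OF L2_cnj[OF HL]] by blast
qed

text \<open>Exchange moves the transform from f onto \<open>cnj G\<close>, and by inversion the
  transform of \<open>cnj G\<close> is 2 pi times \<open>cnj g\<close>.\<close>

lemma fourier_Parseval:
  assumes f: "L2 f" "has_fourier f F" and g: "L2 g" "has_fourier g G"
  shows "l2ip F G = complex_of_real (2 * pi) * l2ip f g"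
proof -
  have G: "L2 G" using g has_fourier_L2 by blast
  obtain H where H: "has_fourier (\<lambda>\<xi>. cnj (G \<xi>)) H" using has_fourier_exists[OF L2_cnj[OF G]] by blast
  have HL: "L2 H" using H has_fourier_L2 by blast
  have e: "AE x in lborel. g x = complex_of_real (1 / (2 * pi)) * cnj (H x)"
    by (rule fourier_inversion[OF g H])
  have "l2ip F G = (LINT x|lborel. f x * H x)"
    unfolding l2ip_def by (rule fourier_exchange[OF f L2_cnj[OF G] H, symmetric])
  also have "\<dots> = (LINT x|lborel. complex_of_real (2 * pi) * (f x * cnj (g x)))"
  proof (rule integral_cong_AE)
    show "AE x in lborel. f x * H x = complex_of_real (2 * pi) * (f x * cnj (g x))"
      using e by eventually_elim simp
  qed (use f g HL in \<open>auto simp: L2_def\<close>)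
  also have "\<dots> = complex_of_real (2 * pi) * l2ip f g" by (simp only: integral_mult_right_zero l2ip_def)
  finally show ?thesis .
qed

lemma Plancherel:
  assumes "L2 f" "has_fourier f F" shows "l2n F = sqrt (2 * pi) * l2n f"
proof -
  have "complex_of_real ((l2n F)\<^sup>2) = complex_of_real (2 * pi * (l2n f)\<^sup>2)"
    using fourier_Parseval[OF assms assms] by (simp add: l2ip_self)
  then have "(l2n F)\<^sup>2 = 2 * pi * (l2n f)\<^sup>2" by (simp only: of_real_eq_iff)
  also have "\<dots> = (sqrt (2 * pi) * l2n f)\<^sup>2" by (simp add: power_mult_distrib)
  finally show ?thesis by (rule power2_eq_imp_eq) simp_all
qed

lemma fourier_inj:
  assumes "L2 f" "L2 g" "has_fourier f F" "has_fourier g G" "AE \<xi> in lborel. F \<xi> = G \<xi>"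
  shows "AE x in lborel. f x = g x"
proof -
  have FG: "L2 F" "L2 G" using assms has_fourier_L2 by blast+
  have "l2n (\<lambda>\<xi>. F \<xi> - G \<xi>) = 0"
    using l2n_0_iff[OF L2_diff[OF FG]] assms(5) by simp
  then have "l2n (\<lambda>x. f x - g x) = 0"
    using Plancherel[OF L2_diff[OF assms(1,2)] has_fourier_diff[OF assms(1-4)]] by simp
  then show ?thesis using l2n_0_iff[OF L2_diff[OF assms(1,2)]] by simp
qed

lemma fourier_inversion_integrable:
  assumes f: "L2 f" "has_fourier f F" and F: "integrable lborel F"
  shows "AE x in lborel. f x = complex_of_real (1 / (2 * pi)) * (LINT \<xi>|lborel. F \<xi> * ee x \<xi>)"
proof -
  have FL: "L2 F" using f has_fourier_L2 by blast
  have "has_fourier (\<lambda>\<xi>. cnj (F \<xi>)) (ft (\<lambda>\<xi>. cnj (F \<xi>)))"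
    by (rule has_fourier_ft) (use F L2_cnj[OF FL] in auto)
  note inv = fourier_inversion[OF f this]
  have "cnj (ft (\<lambda>\<xi>. cnj (F \<xi>)) x) = (LINT \<xi>|lborel. F \<xi> * ee x \<xi>)" for x
    unfolding ft_def by (subst Bochner_Integration.integral_cnj[symmetric]) simp
  from inv[unfolded this] show ?thesis .
qed

section \<open>Modulation and conjugation\<close>

lemma L2_translate:
  assumes "L2 f" shows "L2 (\<lambda>x. f (x - a))" "l2n (\<lambda>x. f (x - a)) = l2n f"
proof -
  have [measurable]: "f \<in> borel_measurable borel" using assms by (simp add: L2_def)
  show "L2 (\<lambda>x. f (x - a))"
    using lborel_integrable_real_affine[OF L2_sq[OF assms], of 1 "- a"] by (simp add: L2_def)
  show "l2n (\<lambda>x. f (x - a)) = l2n f"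
    using lborel_integral_real_affine[of 1 "\<lambda>x. (cmod (f x))\<^sup>2" "- a"] by (simp add: l2n_def)
qed

lemma has_fourier_modulate:
  assumes f: "L2 f" "has_fourier f F"
  shows "has_fourier (\<lambda>x. ee a x * f x) (\<lambda>\<xi>. F (\<xi> - a))"
proof -
  have F: "L2 F" using f has_fourier_L2 by blast
  have e: "ft (trunc (\<lambda>x. ee a x * f x) R) \<xi> = ft (trunc f R) (\<xi> - a)" for R \<xi>
  proof -
    have "trunc (\<lambda>x. ee a x * f x) R x * ee (- \<xi>) x = trunc f R x * ee (- (\<xi> - a)) x" for x
      using ee_add[of a x "- \<xi>"] by (simp add: trunc_def mult_ac)
    then show ?thesis by (simp only: ft_def)
  qed
  have "l2n (\<lambda>\<xi>. ft (trunc (\<lambda>x. ee a x * f x) R) \<xi> - F (\<xi> - a)) = l2n (\<lambda>\<xi>. ft (trunc f R) \<xi> - F \<xi>)" for R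
    unfolding e by (rule L2_translate(2)[OF L2_diff[OF ft_L2[OF trunc_integrable trunc_L2] F]]) (rule f)+
  then show ?thesis
    using f L2_ee[OF f(1), of a] L2_translate(1)[OF F, of a] by (simp add: has_fourier_iff)
qed

lemma has_fourier_cnj:
  assumes f: "L2 f" "has_fourier f F"
  shows "has_fourier (\<lambda>x. cnj (f x)) (\<lambda>\<xi>. cnj (F (- \<xi>)))"
proof -
  have F: "L2 F" using f has_fourier_L2 by blast
  have reflL: "L2 (\<lambda>x. g (- x))" if "L2 g" for g
    using lborel_integrable_real_affine[OF L2_sq[OF that], of "-1" 0] that by (auto simp: L2_def)
  have refl: "l2n (\<lambda>x. g (- x)) = l2n g" for g
    using lborel_integral_real_affine[of "-1" "\<lambda>x. (cmod (g x))\<^sup>2" 0] by (simp add: l2n_def)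
  have e: "ft (trunc (\<lambda>x. cnj (f x)) R) \<xi> = cnj (ft (trunc f R) (- \<xi>))" for R \<xi>
    unfolding ft_def by (subst Bochner_Integration.integral_cnj[symmetric]) (simp add: trunc_def of_real_indicator_complex)
  have "l2n (\<lambda>\<xi>. ft (trunc (\<lambda>x. cnj (f x)) R) \<xi> - cnj (F (- \<xi>))) = l2n (\<lambda>\<xi>. ft (trunc f R) \<xi> - F \<xi>)" for R
    unfolding e l2n_cnj_diff by (rule refl)
  then show ?thesis
    using f L2_cnj[OF f(1)] L2_cnj[OF reflL[OF F]] by (simp add: has_fourier_iff)
qed

section \<open>The Szego projector\<close>

lemma L2_restrict:
  assumes "L2 F" "S \<in> sets borel"
  shows "L2 (\<lambda>\<xi>. if \<xi> \<in> S then F \<xi> else 0)" "l2n (\<lambda>\<xi>. if \<xi> \<in> S then F \<xi> else 0) \<le> l2n F"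
proof -
  have [measurable]: "F \<in> borel_measurable borel" using assms by (simp add: L2_def)
  have [measurable]: "S \<in> sets borel" by fact
  show L: "L2 (\<lambda>\<xi>. if \<xi> \<in> S then F \<xi> else 0)"
    by (rule L2_bound[OF _ L2_sq[OF assms(1)]]) auto
  show "l2n (\<lambda>\<xi>. if \<xi> \<in> S then F \<xi> else 0) \<le> l2n F"
    unfolding l2n_def by (intro real_sqrt_le_mono integral_mono L2_sq L assms) auto
qed

text \<open>Surjectivity of the transform guarantees that the choice in \<open>szego\<close> has a
  witness. From here on the projector is handled through the relation \<open>has_fourier\<close>,
  for any representative F of the transform.\<close>

lemma szego_has_fourier:
  assumes f: "L2 f" "has_fourier f F"
  shows "L2 (szego f)" "has_fourier (szego f) (\<lambda>\<xi>. if \<xi> \<in> {0..} then F \<xi> else 0)"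
proof -
  let ?P = "\<lambda>g. L2 g \<and> (AE \<xi> in lborel. fourier g \<xi> = (if \<xi> \<ge> 0 then fourier f \<xi> else 0))"
  have F: "L2 (fourier f)" by (rule fourier_L2[OF f(1)])
  have F': "L2 F" using f has_fourier_L2 by blast
  obtain g where g: "L2 g" "has_fourier g (\<lambda>\<xi>. if \<xi> \<in> {0..} then fourier f \<xi> else 0)"
    using fourier_surj[OF L2_restrict(1)[OF F, of "{0..}"]] by auto
  have "?P g"
    using has_fourier_unique[OF g(1) has_fourier_fourier[OF g(1)] g(2)] g(1) by simp
  then have P: "?P (szego f)" unfolding szego_def by (rule someI[of ?P])
  then show L: "L2 (szego f)" by blast
  have "AE \<xi> in lborel. fourier (szego f) \<xi> = (if \<xi> \<in> {0..} then F \<xi> else 0)"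
    using has_fourier_unique[OF f(1) has_fourier_fourier[OF f(1)] f(2)] P[THEN conjunct2]
    by eventually_elim simp
  then show "has_fourier (szego f) (\<lambda>\<xi>. if \<xi> \<in> {0..} then F \<xi> else 0)"
    using has_fourier_cong_AE2[OF L has_fourier_fourier[OF L]] L2_restrict(1)[OF F', of "{0..}"] by (simp add: L2_def)
qed

lemma szego_cong:
  assumes "AE x in lborel. f x = g x" "f \<in> borel_measurable borel" "g \<in> borel_measurable borel"
  shows "szego f = szego g"
  unfolding szego_def fourier_cong_AE[OF assms] ..

text \<open>The projector onto frequencies \<open>\<ge> - \<kappa>\<close>; it is \<open>\<Pi>\<close> conjugated by \<open>e\<^sub>\<kappa>\<close>.\<close>

definition sz :: "real \<Rightarrow> (real \<Rightarrow> complex) \<Rightarrow> real \<Rightarrow> complex" where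
  "sz \<kappa> f x = ee (- \<kappa>) x * szego (\<lambda>y. ee \<kappa> y * f y) x"

lemma sz_has_fourier:
  assumes f: "L2 f" "has_fourier f F"
  shows "L2 (sz \<kappa> f)" "has_fourier (sz \<kappa> f) (\<lambda>\<xi>. if \<xi> \<in> {- \<kappa>..} then F \<xi> else 0)"
proof -
  note s = szego_has_fourier[OF L2_ee[OF f(1)] has_fourier_modulate[OF f], of \<kappa>]
  show "L2 (sz \<kappa> f)" unfolding sz_def[abs_def] by (rule L2_ee[OF s(1)])
  have "(\<lambda>\<xi>. if \<xi> - - \<kappa> \<in> {0..} then F (\<xi> - - \<kappa> - \<kappa>) else 0) = (\<lambda>\<xi>. if \<xi> \<in> {- \<kappa>..} then F \<xi> else 0)"
    by (auto simp: fun_eq_iff)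
  then show "has_fourier (sz \<kappa> f) (\<lambda>\<xi>. if \<xi> \<in> {- \<kappa>..} then F \<xi> else 0)"
    unfolding sz_def[abs_def] using has_fourier_modulate[OF s, of "- \<kappa>"] by simp
qed

lemma sz_L2: "L2 f \<Longrightarrow> L2 (sz \<kappa> f)"
  using sz_has_fourier(1) has_fourier_fourier by blast

text \<open>Linearity holds only almost everywhere because the three projections are separately
  chosen representatives; injectivity of the transform compares them.\<close>

lemma sz_lincomb:
  assumes f: "L2 f" and g: "L2 g"
  shows "AE x in lborel. sz \<kappa> (\<lambda>x. a * f x + b * g x) x = a * sz \<kappa> f x + b * sz \<kappa> g x"
proof -
  note F = has_fourier_fourier[OF f] and G = has_fourier_fourier[OF g]
  have L: "L2 (\<lambda>x. a * f x + b * g x)" by (intro L2_add L2_cmult f g)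
  note s = sz_has_fourier[OF L has_fourier_add[OF L2_cmult[OF f] L2_cmult[OF g] has_fourier_cmult[OF f F] has_fourier_cmult[OF g G]], of \<kappa>]
  note f' = sz_has_fourier[OF f F, of \<kappa>] and g' = sz_has_fourier[OF g G, of \<kappa>]
  show ?thesis
    by (rule fourier_inj[OF s(1) L2_add[OF L2_cmult[OF f'(1)] L2_cmult[OF g'(1)]] s(2)
      has_fourier_add[OF L2_cmult[OF f'(1)] L2_cmult[OF g'(1)] has_fourier_cmult[OF f'] has_fourier_cmult[OF g']]]) auto
qed

lemma sz_le: assumes f: "L2 f" shows "l2n (sz \<kappa> f) \<le> l2n f"
proof -
  note F = has_fourier_fourier[OF f]
  note s = sz_has_fourier[OF f F, of \<kappa>]
  have "sqrt (2 * pi) * l2n (sz \<kappa> f) \<le> sqrt (2 * pi) * l2n f"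
    using Plancherel[OF s] Plancherel[OF f F] L2_restrict(2)[OF fourier_L2[OF f], of "{- \<kappa>..}"] by simp
  then show ?thesis by simp
qed

lemma sz_l2ip_self: assumes f: "L2 f" shows "l2ip (sz \<kappa> f) f = complex_of_real ((l2n (sz \<kappa> f))\<^sup>2)"
proof -
  note F = has_fourier_fourier[OF f]
  note s = sz_has_fourier[OF f F, of \<kappa>]
  let ?G = "\<lambda>\<xi>. if \<xi> \<in> {- \<kappa>..} then fourier f \<xi> else 0"
  have "l2ip ?G (fourier f) = l2ip ?G ?G"
    unfolding l2ip_def by (intro Bochner_Integration.integral_cong) auto
  then have "complex_of_real (2 * pi) * l2ip (sz \<kappa> f) f = complex_of_real (2 * pi) * l2ip (sz \<kappa> f) (sz \<kappa> f)"
    using fourier_Parseval[OF s f F] fourier_Parseval[OF s s] by simp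
  then show ?thesis by (simp add: l2ip_self)
qed

text \<open>Integrability of \<open>f\<close> makes its transform bounded, hence integrable over the
  bounded band, and inversion yields an honest integral. This is the source of all regularity in the
  spectral parameter.\<close>

lemma sz_diff:
  assumes f: "integrable lborel f" "L2 f" and "a < b"
  shows "AE x in lborel. sz b f x - sz a f x = complex_of_real (1 / (2 * pi)) * (LINT \<xi>:{- b..<- a}|lborel. ft f \<xi> * ee x \<xi>)"
proof -
  note F = has_fourier_ft[OF f]
  note sa = sz_has_fourier[OF f(2) F, of a] and sb = sz_has_fourier[OF f(2) F, of b]
  let ?D = "\<lambda>\<xi>. (if \<xi> \<in> {- b..} then ft f \<xi> else 0) - (if \<xi> \<in> {- a..} then ft f \<xi> else 0)"
  have D: "?D = (\<lambda>\<xi>. indicator {- b..<- a} \<xi> *\<^sub>R ft f \<xi>)"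
    using \<open>a < b\<close> by (auto simp: fun_eq_iff indicator_def)
  have [measurable]: "ft f \<in> borel_measurable borel" using f(1) by (rule ft_measurable)
  have "integrable lborel ?D"
    unfolding D
  proof (rule Bochner_Integration.integrable_bound[where f = "\<lambda>\<xi>. indicator {- b..<- a} \<xi> * (LINT x|lborel. cmod (f x))"])
    show "integrable lborel (\<lambda>\<xi>. indicator {- b..<- a} \<xi> * (LINT x|lborel. cmod (f x)))"
      using \<open>a < b\<close> by (intro integrable_mult_left integrable_real_indicator) auto
    show "AE \<xi> in lborel. norm (indicator {- b..<- a} \<xi> *\<^sub>R ft f \<xi>) \<le> norm (indicator {- b..<- a} \<xi> * (LINT x|lborel. cmod (f x)))"
      using ft_bound[OF f(1)] by (auto simp: indicator_def intro: order_trans[OF _ abs_ge_self])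
  qed auto
  note inv = fourier_inversion_integrable[OF L2_diff[OF sb(1) sa(1)] has_fourier_diff[OF sb(1) sa(1) sb(2) sa(2)] this]
  have "(LINT \<xi>|lborel. ?D \<xi> * ee x \<xi>) = (LINT \<xi>:{- b..<- a}|lborel. ft f \<xi> * ee x \<xi>)" for x
    unfolding set_lebesgue_integral_def fun_cong[OF D] by simp
  from inv[unfolded this] show ?thesis .
qed

text \<open>The value at \<xi> is the pairing of \<open>w\<close> with a modulated conjugate of
  \<open>u\<close>. Parseval turns it into the integral of
  \<open>W \<eta> * U (\<xi> - \<eta>)\<close>, and for \<xi> < 0 one of \<eta> and \<xi> - \<eta>
  is always negative.\<close>

lemma fourier_product_support:
  assumes u: "L2 u" "has_fourier u U" "AE \<xi> in lborel. \<xi> < 0 \<longrightarrow> U \<xi> = 0"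
    and w: "L2 w" "has_fourier w W" "AE \<xi> in lborel. \<xi> < 0 \<longrightarrow> W \<xi> = 0" and "\<xi> < 0"
  shows "ft (\<lambda>x. u x * w x) \<xi> = 0"
proof -
  have UL: "L2 U" "L2 W" using u w has_fourier_L2 by blast+
  have [measurable]: "U \<in> borel_measurable borel" "W \<in> borel_measurable borel" using UL by (auto simp: L2_def)
  have m: "has_fourier (\<lambda>x. ee (- \<xi>) x * u x) (\<lambda>\<eta>. U (\<eta> - - \<xi>))" by (rule has_fourier_modulate[OF u(1,2)])
  have c: "has_fourier (\<lambda>x. cnj (ee (- \<xi>) x * u x)) (\<lambda>\<eta>. cnj (U (- \<eta> - - \<xi>)))"
    by (rule has_fourier_cnj[OF L2_ee[OF u(1)] m])
  \<comment> \<open>The reflection \<eta> to \<xi> - \<eta> preserves Lebesgue measure, so the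
    exceptional null set of \<open>U\<close> pulls back to a null set.\<close>
  have "AE \<eta> in distr lborel borel (\<lambda>\<eta>. \<xi> + (- 1) * \<eta>). \<eta> < 0 \<longrightarrow> U \<eta> = 0"
  proof -
    have "distr lborel borel (\<lambda>\<eta>. \<xi> + (- 1) * \<eta>) = lborel"
      using lborel_real_affine[of "-1" \<xi>] by (simp add: density_1)
    then show ?thesis using u(3) by (simp only:)
  qed
  then have r: "AE \<eta> in lborel. \<xi> - \<eta> < 0 \<longrightarrow> U (\<xi> - \<eta>) = 0"
    by (subst (asm) AE_distr_iff) (auto simp: pred_def)
  have z: "AE \<eta> in lborel. W \<eta> * cnj (cnj (U (- \<eta> - - \<xi>))) = 0"
    using r w(3)
  proof eventually_elim
    case (elim \<eta>)
    then show ?case using \<open>\<xi> < 0\<close> by (cases "\<eta> < 0") auto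
  qed
  have "l2ip W (\<lambda>\<eta>. cnj (U (- \<eta> - - \<xi>))) = (LINT \<eta>|(lborel::real measure). 0)"
    unfolding l2ip_def by (rule integral_cong_AE) (use z in auto)
  then have "complex_of_real (2 * pi) * l2ip w (\<lambda>x. cnj (ee (- \<xi>) x * u x)) = 0"
    using fourier_Parseval[OF w(1,2) L2_cnj[OF L2_ee[OF u(1)]] c] by simp
  then show ?thesis by (simp add: l2ip_def ft_def mult_ac)
qed

section \<open>Weighted spaces and the Sobolev embedding\<close>

text \<open>The weight is at most 1 near the origin and at most |x|^(-2s) in the tails, where s >
  1/2 gives integrability.\<close>

lemma integrable_inverse_jbr:
  assumes "s > 1 / 2" shows "integrable lborel (\<lambda>x::real. (1 + x\<^sup>2) powr (- s))"
proof -
  have hi: "((\<lambda>x. x powr (- 2 * s)) has_integral - (1 powr (- 2 * s + 1)) / (- 2 * s + 1)) {1..}"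
    by (rule has_integral_powr_to_inf) (use assms in auto)
  have "(\<lambda>x. x powr (- 2 * s)) absolutely_integrable_on {1..}"
    by (rule nonnegative_absolutely_integrable_1) (use hi in \<open>auto simp: integrable_on_def\<close>)
  then have "integrable lebesgue (\<lambda>x. indicator {1..} x *\<^sub>R x powr (- 2 * s))"
    by (simp add: set_integrable_def)
  then have t: "integrable lborel (\<lambda>x. indicator {1..} x *\<^sub>R x powr (- 2 * s))"
    by (subst (asm) integrable_completion) auto
  have t': "integrable lborel (\<lambda>x. indicator {1..} (- x) *\<^sub>R (- x) powr (- 2 * s))"
    using lborel_integrable_real_affine[OF t, of "-1" 0] by simp
  have c: "integrable lborel (\<lambda>x::real. indicator {-1..1} x :: real)"
    by (intro integrable_real_indicator) auto
  show ?thesis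
  proof (rule Bochner_Integration.integrable_bound[OF Bochner_Integration.integrable_add[OF Bochner_Integration.integrable_add[OF t t'] c]])
    have le1: "(1 + x\<^sup>2) powr (- s) \<le> 1" for x :: real
    proof -
      have "(1 + x\<^sup>2) powr (- s) \<le> (1 + x\<^sup>2) powr 0"
        using assms by (intro powr_mono) auto
      moreover have "(1 + x\<^sup>2) powr 0 = 1" using zero_le_power2[of x] by (simp add: add_nonneg_eq_0_iff)
      ultimately show ?thesis by simp
    qed
    have le2: "(1 + x\<^sup>2) powr (- s) \<le> \<bar>x\<bar> powr (- 2 * s)" if "x \<noteq> 0" for x :: real
    proof -
      have "(1 + x\<^sup>2) powr (- s) \<le> (x\<^sup>2) powr (- s)"
        using assms that by (intro powr_mono2') auto
      also have "x\<^sup>2 = \<bar>x\<bar> powr 2" using that by (simp add: powr_numeral)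
      finally show ?thesis by (simp only: powr_powr) simp
    qed
    show "AE x in lborel. norm ((1 + x\<^sup>2) powr (- s))
      \<le> norm (indicator {1..} x *\<^sub>R x powr (- 2 * s) + indicator {1..} (- x) *\<^sub>R (- x) powr (- 2 * s) + indicator {-1..1} x)"
    proof (intro AE_I2)
      fix x :: real
      consider "x > 1" | "x < - 1" | "-1 \<le> x" "x \<le> 1" by linarith
      then show "norm ((1 + x\<^sup>2) powr (- s))
        \<le> norm (indicator {1..} x *\<^sub>R x powr (- 2 * s) + indicator {1..} (- x) *\<^sub>R (- x) powr (- 2 * s) + indicator {-1..1} x)"
      proof cases
        case 1 then show ?thesis using le2[of x] by (simp add: indicator_def)
      next
        case 2 then show ?thesis using le2[of x] by (simp add: indicator_def)
      next
        case 3
        then have "indicator {-1..1} x = (1::real)" by simp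
        then show ?thesis using le1[of x]
          by (simp add: indicator_def add_increasing)
      qed
    qed
  qed auto
qed

lemma jbr_ge_1: "1 \<le> jbr x"
  by (simp add: jbr_def)

lemma jbr_powr_sq: "(jbr x powr r)\<^sup>2 = (1 + x\<^sup>2) powr r"
proof -
  have p: "1 + x\<^sup>2 > 0" using zero_le_power2[of x] by linarith
  have "(jbr x powr r)\<^sup>2 = ((jbr x)\<^sup>2) powr r"
    using jbr_ge_1[of x] by (simp add: power2_eq_square powr_mult)
  then show ?thesis using p by (simp add: jbr_def)
qed

lemma jbr_measurable[measurable]: "jbr \<in> borel_measurable borel"
  unfolding jbr_def[abs_def] by measurable

lemma L2_jbr: "s > 1 / 2 \<Longrightarrow> L2 (\<lambda>x. complex_of_real (jbr x powr (- s)))"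
  using integrable_inverse_jbr[of s] by (simp add: L2_def jbr_powr_sq)

lemma L2w_L2: assumes "L2w s f" shows "L2 (\<lambda>x. complex_of_real (jbr x powr s) * f x)"
proof -
  have [measurable]: "f \<in> borel_measurable borel" using assms by (simp add: L2w_def)
  have "integrable lborel (\<lambda>x. (cmod (complex_of_real (jbr x powr s) * f x))\<^sup>2)"
    using assms by (simp add: L2w_def norm_mult power_mult_distrib jbr_powr_sq mult.commute)
  then show ?thesis by (simp add: L2_def)
qed

text \<open>The product of \<open>jbr x powr (- s)\<close> and the weighted function has both
  factors in L2. On the line it makes \<open>u\<close> integrable; on the Fourier side, with
  exponent 1, it gives the Sobolev embedding.\<close>

lemma L2w_integrable: assumes "L2w s f" "s > 1 / 2" shows "integrable lborel f"
proof -
  have "integrable lborel (\<lambda>x. complex_of_real (jbr x powr (- s)) * (complex_of_real (jbr x powr s) * f x))"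
    by (rule L2_mult_integrable[OF L2_jbr[OF assms(2)] L2w_L2[OF assms(1)]])
  moreover have "complex_of_real (jbr x powr (- s)) * (complex_of_real (jbr x powr s) * f x) = f x" for x
  proof -
    have "jbr x powr (- s) * jbr x powr s = 1"
      using jbr_ge_1[of x] by (simp flip: powr_add)
    then show ?thesis by (simp only: mult.assoc[symmetric] of_real_mult[symmetric]) simp
  qed
  ultimately show ?thesis by simp
qed

text \<open>The transform of an H^1 function is integrable, so inversion represents the function by
  an absolutely convergent Fourier integral.\<close>

lemma Hplus_1_continuous_bounded:
  assumes h: "Hplus 1 h"
  obtains k C where "continuous_on UNIV k" "\<And>x. cmod (k x) \<le> C" "AE x in lborel. h x = k x"
proof -
  have hL: "L2 h" and w: "L2 (\<lambda>\<xi>. complex_of_real ((1 + \<xi>\<^sup>2) powr (1 / 2)) * fourier h \<xi>)"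
    using h by (auto simp: Hplus_def)
  have "L2w 1 (fourier h)"
    using w fourier_L2[OF hL] unfolding L2w_def L2_def
    by (simp add: norm_mult power_mult_distrib mult.commute powr_half_sqrt)
  then have F: "integrable lborel (fourier h)" by (rule L2w_integrable) simp
  define k where "k x = complex_of_real (1 / (2 * pi)) * (LINT \<xi>|lborel. fourier h \<xi> * ee x \<xi>)" for x
  have [measurable]: "fourier h \<in> borel_measurable borel" using F by auto
  have "continuous_on UNIV k"
    unfolding k_def continuous_on_eq_continuous_within
  proof (intro ballI continuous_intros)
    fix x
    show "isCont (\<lambda>x. LINT \<xi>|lborel. fourier h \<xi> * ee x \<xi>) x"
      unfolding continuous_at_sequentially comp_def
    proof (intro allI impI)
      fix y :: "nat \<Rightarrow> real" assume y: "y \<longlonglongrightarrow> x"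
      show "(\<lambda>n. LINT \<xi>|lborel. fourier h \<xi> * ee (y n) \<xi>) \<longlonglongrightarrow> (LINT \<xi>|lborel. fourier h \<xi> * ee x \<xi>)"
        by (rule integral_dominated_convergence[where w = "\<lambda>\<xi>. cmod (fourier h \<xi>)"])
          (use F y in \<open>auto simp: norm_mult intro!: tendsto_intros\<close>)
    qed
  qed
  moreover have "cmod (k x) \<le> 1 / (2 * pi) * (LINT \<xi>|lborel. cmod (fourier h \<xi>))" for x
  proof -
    have "cmod (LINT \<xi>|lborel. fourier h \<xi> * ee x \<xi>) \<le> (LINT \<xi>|lborel. cmod (fourier h \<xi>))"
      using integral_norm_bound[of lborel "\<lambda>\<xi>. fourier h \<xi> * ee x \<xi>"] by (simp add: norm_mult)
    then have "1 / (2 * pi) * cmod (LINT \<xi>|lborel. fourier h \<xi> * ee x \<xi>) \<le> 1 / (2 * pi) * (LINT \<xi>|lborel. cmod (fourier h \<xi>))"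
      by (intro mult_left_mono) auto
    then show ?thesis by (simp add: k_def norm_mult norm_divide)
  qed
  moreover have "AE x in lborel. h x = k x"
    unfolding k_def by (rule fourier_inversion_integrable[OF hL has_fourier_fourier[OF hL] F])
  ultimately show ?thesis using that by blast
qed

section \<open>Weak derivatives\<close>

definition smooth :: "(real \<Rightarrow> complex) \<Rightarrow> bool" where
  "smooth f \<longleftrightarrow> (\<forall>n x. ((vderiv ^^ n) f) differentiable (at x))"

text \<open>Smoothness asks for all iterated derivatives; it is enough to exhibit a class of
  differentiable functions that is closed under \<open>vderiv\<close>.\<close>

lemma smooth_coinduct:
  assumes "P f" and step: "\<And>f. P f \<Longrightarrow> (\<forall>x. f differentiable (at x)) \<and> P (vderiv f)"
  shows "smooth f"
proof -
  have "P ((vderiv ^^ n) f)" for n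
    by (induction n) (use assms in auto)
  then show ?thesis using step by (auto simp: smooth_def)
qed

lemma smooth_differentiable: "smooth f \<Longrightarrow> f differentiable (at x)"
  unfolding smooth_def by (drule spec[of _ 0]) simp

lemma smooth_vderiv: "smooth f \<Longrightarrow> smooth (vderiv f)"
  unfolding smooth_def
proof (intro allI)
  fix n x assume "\<forall>n x. (vderiv ^^ n) f differentiable at x"
  then have "(vderiv ^^ Suc n) f differentiable at x" by blast
  then show "(vderiv ^^ n) (vderiv f) differentiable at x" by (simp only: funpow_Suc_right comp_def)
qed

lemma vderiv_works: "f differentiable (at x) \<Longrightarrow> (f has_vector_derivative vderiv f x) (at x)"
  unfolding vderiv_def by (simp add: vector_derivative_works)

lemma vderiv_eqI: "(\<And>x. (f has_vector_derivative f' x) (at x)) \<Longrightarrow> vderiv f = f'"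
  unfolding vderiv_def by (auto simp: fun_eq_iff intro: vector_derivative_at)

lemma smooth_continuous: "smooth f \<Longrightarrow> continuous_on S f"
  using smooth_differentiable by (meson continuous_at_imp_continuous_on differentiable_imp_continuous_within)

text \<open>Products alone are not closed under differentiation; by the Leibniz rule finite sums of
  products are.\<close>

inductive smooth_sum_of_products :: "(real \<Rightarrow> complex) \<Rightarrow> bool" where
  prod: "smooth f \<Longrightarrow> smooth g \<Longrightarrow> smooth_sum_of_products (\<lambda>x. f x * g x)"
| add: "smooth_sum_of_products f \<Longrightarrow> smooth_sum_of_products g \<Longrightarrow> smooth_sum_of_products (\<lambda>x. f x + g x)"

lemma has_vector_derivative_mult_smooth:
  assumes "smooth f" "smooth g"
  shows "((\<lambda>x. f x * g x) has_vector_derivative (f x * vderiv g x + vderiv f x * g x)) (at x)"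
  by (intro has_vector_derivative_mult vderiv_works smooth_differentiable assms)

lemma smooth_mult: assumes "smooth f" "smooth g" shows "smooth (\<lambda>x. f x * g x)"
proof (rule smooth_coinduct[where P = smooth_sum_of_products])
  show "smooth_sum_of_products (\<lambda>x. f x * g x)" by (intro prod assms)
  fix f assume "smooth_sum_of_products f"
  then show "(\<forall>x. f differentiable (at x)) \<and> smooth_sum_of_products (vderiv f)"
  proof induction
    case (prod f g)
    note d = has_vector_derivative_mult_smooth[OF prod]
    show ?case
      unfolding vderiv_eqI[OF d]
      using d prod by (auto intro!: smooth_sum_of_products.intros smooth_vderiv differentiableI_vector)
  next
    case (add f g)
    then have d: "((\<lambda>x. f x + g x) has_vector_derivative (vderiv f x + vderiv g x)) (at x)" for x
      by (intro has_vector_derivative_add vderiv_works) auto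
    show ?case
      unfolding vderiv_eqI[OF d]
      using d add by (auto intro!: smooth_sum_of_products.intros differentiableI_vector)
  qed
qed

lemma ee_has_vector_derivative: "(ee \<kappa> has_vector_derivative \<i> * \<kappa> * ee \<kappa> x) (at x)"
proof -
  have "((\<lambda>z. exp (\<i> * complex_of_real \<kappa> * z)) has_field_derivative \<i> * complex_of_real \<kappa> * exp (\<i> * complex_of_real \<kappa> * complex_of_real x)) (at (complex_of_real x))"
    by (auto intro!: derivative_eq_intros)
  from has_vector_derivative_real_field[OF this] show ?thesis
    by (simp add: ee_def[abs_def] mult.assoc)
qed

lemma smooth_ee: "smooth (ee \<kappa>)"
proof (rule smooth_coinduct[where P = "\<lambda>f. \<exists>c. f = (\<lambda>x. c * ee \<kappa> x)"])
  show "\<exists>c. ee \<kappa> = (\<lambda>x. c * ee \<kappa> x)" by (rule exI[of _ 1]) simp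
  fix f :: "real \<Rightarrow> complex" assume "\<exists>c. f = (\<lambda>x. c * ee \<kappa> x)"
  then obtain c where f: "f = (\<lambda>x. c * ee \<kappa> x)" by blast
  have d: "(f has_vector_derivative (c * (\<i> * \<kappa>)) * ee \<kappa> x) (at x)" for x
    unfolding f using has_vector_derivative_mult_right[OF ee_has_vector_derivative, of c] by (simp add: mult.assoc)
  show "(\<forall>x. f differentiable (at x)) \<and> (\<exists>c. vderiv f = (\<lambda>x. c * ee \<kappa> x))"
    unfolding vderiv_eqI[OF d] using d by (blast intro: differentiableI_vector)
qed

lemma test_function_iff: "test_function \<eta> \<longleftrightarrow> smooth \<eta> \<and> (\<exists>R. \<forall>x. \<bar>x\<bar> > R \<longrightarrow> \<eta> x = 0)"
  by (simp add: test_function_def smooth_def)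

lemma test_function_ee_mult: "test_function \<eta> \<Longrightarrow> test_function (\<lambda>x. ee \<kappa> x * \<eta> x)"
  by (auto simp: test_function_iff intro!: smooth_mult smooth_ee)

lemma vderiv_ee_mult:
  assumes "smooth \<eta>"
  shows "vderiv (\<lambda>x. ee \<kappa> x * \<eta> x) = (\<lambda>x. ee \<kappa> x * vderiv \<eta> x + \<i> * \<kappa> * ee \<kappa> x * \<eta> x)"
proof -
  have "vderiv (ee \<kappa>) = (\<lambda>x. \<i> * \<kappa> * ee \<kappa> x)"
    by (rule vderiv_eqI[OF ee_has_vector_derivative])
  with vderiv_eqI[OF has_vector_derivative_mult_smooth[OF smooth_ee assms]] show ?thesis by simp
qed

section \<open>Bump functions\<close>

text \<open>The powers in the denominator make the family stable under differentiation: the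
  derivative of a member is a combination of members with larger k. The case k = 0 is the classical
  flat function.\<close>

definition bumpk :: "nat \<Rightarrow> real \<Rightarrow> real" where
  "bumpk k x = (if x > 0 then exp (- 1 / x) / x ^ k else 0)"

text \<open>The difference quotient at the origin, the one point where differentiability is in
  doubt. On the right the substitution x = 1 / y reduces it to the exponential beating every
  power.\<close>

lemma bumpk_quotient_tendsto: "((\<lambda>x. bumpk k x / x) \<longlongrightarrow> 0) (at 0)"
proof (rule filterlim_split_at)
  show "((\<lambda>x. bumpk k x / x) \<longlongrightarrow> 0) (at_left 0)"
  proof (rule tendsto_eventually)
    show "\<forall>\<^sub>F x in at_left 0. bumpk k x / x = 0"
      using eventually_at_left_real[of "-1" 0] by (auto elim!: eventually_mono simp: bumpk_def)
  qed
  have "((\<lambda>y. y ^ Suc k / exp y) \<longlongrightarrow> (0::real)) at_top"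
    by (rule tendsto_power_div_exp_0)
  then have "((\<lambda>y. bumpk k (inverse y) / inverse y) \<longlongrightarrow> 0) at_top"
  proof (rule Lim_transform_eventually)
    show "\<forall>\<^sub>F y in at_top. y ^ Suc k / exp y = bumpk k (inverse y) / inverse y"
      using eventually_gt_at_top[of 0]
      by eventually_elim (simp add: bumpk_def field_simps exp_minus power_inverse)
  qed
  then show "((\<lambda>x. bumpk k x / x) \<longlongrightarrow> 0) (at_right 0)"
    unfolding filterlim_at_right_to_top .
qed

lemma bumpk_deriv: "(bumpk k has_real_derivative bumpk (k + 2) x - real k * bumpk (k + 1) x) (at x)"
proof -
  consider "x > 0" | "x < 0" | "x = 0" by linarith
  then show ?thesis
  proof cases
    case 1
    have "((\<lambda>x. exp (- 1 / x) / x ^ k) has_real_derivative bumpk (k + 2) x - real k * bumpk (k + 1) x) (at x)"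
    proof -
      have pw: "x ^ m = x * x ^ (m - Suc 0)" if "m \<noteq> 0" for m
        using that by (cases m) simp_all
      show ?thesis
        using 1 by (cases k) (auto intro!: derivative_eq_intros simp: bumpk_def field_simps power2_eq_square, metis pw)
    qed
    then show ?thesis
      by (rule has_field_derivative_transform_within_open[where S = "{0<..}"]) (use 1 in \<open>auto simp: bumpk_def\<close>)
  next
    case 2
    have "((\<lambda>x. 0) has_real_derivative bumpk (k + 2) x - real k * bumpk (k + 1) x) (at x)"
      using 2 by (simp add: bumpk_def)
    then show ?thesis
      by (rule has_field_derivative_transform_within_open[where S = "{..<0}"]) (use 2 in \<open>auto simp: bumpk_def\<close>)
  next
    case 3
    then show ?thesis
      using bumpk_quotient_tendsto[of k] by (simp add: has_field_derivative_iff bumpk_def[of _ 0])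
  qed
qed

inductive bump_span :: "real \<Rightarrow> real \<Rightarrow> (real \<Rightarrow> complex) \<Rightarrow> bool" for a c where
  base: "bump_span a c (\<lambda>x. complex_of_real (bumpk k (a * x + c)))"
| scal: "bump_span a c f \<Longrightarrow> bump_span a c (\<lambda>x. d * f x)"
| add: "bump_span a c f \<Longrightarrow> bump_span a c g \<Longrightarrow> bump_span a c (\<lambda>x. f x + g x)"

lemma smooth_bump_affine: "smooth (\<lambda>x. complex_of_real (bumpk 0 (a * x + c)))"
proof (rule smooth_coinduct[where P = "bump_span a c"])
  show "bump_span a c (\<lambda>x. complex_of_real (bumpk 0 (a * x + c)))" by (rule base)
  fix f assume "bump_span a c f"
  then show "(\<forall>x. f differentiable (at x)) \<and> bump_span a c (vderiv f)"
  proof induction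
    case (base k)
    have "((\<lambda>x. bumpk k (a * x + c)) has_real_derivative (bumpk (k + 2) (a * x + c) - real k * bumpk (k + 1) (a * x + c)) * a) (at x)" for x
      by (rule DERIV_chain2[OF bumpk_deriv]) (auto intro!: derivative_eq_intros)
    then have d: "((\<lambda>x. complex_of_real (bumpk k (a * x + c))) has_vector_derivative
      (complex_of_real a * complex_of_real (bumpk (k + 2) (a * x + c)) + complex_of_real (- a * k) * complex_of_real (bumpk (k + 1) (a * x + c)))) (at x)" for x
      by (rule has_vector_derivative_eq_rhs[OF has_vector_derivative_of_real]) (simp add: algebra_simps)
    have "bump_span a c (\<lambda>x. complex_of_real a * complex_of_real (bumpk (k + 2) (a * x + c)) + complex_of_real (- a * k) * complex_of_real (bumpk (k + 1) (a * x + c)))"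
      by (intro bump_span.intros)
    then show ?case
      unfolding vderiv_eqI[OF d] using d by (blast intro: differentiableI_vector)
  next
    case (scal f d)
    then have d: "((\<lambda>x. d * f x) has_vector_derivative (d * vderiv f x)) (at x)" for x
      by (intro has_vector_derivative_mult_right vderiv_works) auto
    show ?case
      unfolding vderiv_eqI[OF d] using d scal by (auto intro!: bump_span.intros differentiableI_vector)
  next
    case (add f g)
    then have d: "((\<lambda>x. f x + g x) has_vector_derivative (vderiv f x + vderiv g x)) (at x)" for x
      by (intro has_vector_derivative_add vderiv_works) auto
    show ?case
      unfolding vderiv_eqI[OF d] using d add by (auto intro!: bump_span.intros differentiableI_vector)
  qed
qed

definition bump :: "real \<Rightarrow> real \<Rightarrow> real" where
  "bump \<epsilon> x = bumpk 0 (x + \<epsilon>) * bumpk 0 (\<epsilon> - x)"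

lemma bump_pos: "\<bar>x\<bar> < \<epsilon> \<Longrightarrow> bump \<epsilon> x > 0"
  by (auto simp: bump_def bumpk_def abs_less_iff)

lemma bump_nonneg: "bump \<epsilon> x \<ge> 0"
  by (auto simp: bump_def bumpk_def)

lemma bump_zero: "\<bar>x\<bar> \<ge> \<epsilon> \<Longrightarrow> bump \<epsilon> x = 0"
  by (auto simp: bump_def bumpk_def)

lemma smooth_bump_shift: "smooth (\<lambda>x. complex_of_real (bump \<epsilon> (x - a)))"
  using smooth_mult[OF smooth_bump_affine[of 1 "\<epsilon> - a"] smooth_bump_affine[of "-1" "\<epsilon> + a"]]
  by (simp add: bump_def algebra_simps)

lemma continuous_on_bump: "continuous_on S (bump \<epsilon>)"
proof -
  have "continuous_on S (\<lambda>x. Re (complex_of_real (bump \<epsilon> (x - 0))))"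
    by (intro continuous_intros smooth_continuous[OF smooth_bump_shift])
  then show ?thesis by simp
qed

lemma smooth_if_vderiv:
  assumes "\<And>x. (f has_vector_derivative g x) (at x)" "smooth g" shows "smooth f"
  unfolding smooth_def
proof (intro allI)
  fix n x
  show "(vderiv ^^ n) f differentiable at x"
  proof (cases n)
    case 0 then show ?thesis using assms(1) by (auto intro: differentiableI_vector)
  next
    case (Suc m)
    then have "(vderiv ^^ n) f = (vderiv ^^ m) g"
      by (simp only: Suc funpow_Suc_right comp_def vderiv_eqI[OF assms(1)])
    then show ?thesis using assms(2) by (simp add: smooth_def)
  qed
qed

lemma smooth_diff: assumes "smooth f" "smooth g" shows "smooth (\<lambda>x. f x - g x)"
proof (rule smooth_coinduct[where P = "\<lambda>h. \<exists>f g. smooth f \<and> smooth g \<and> h = (\<lambda>x. f x - g x)"])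
  show "\<exists>f' g'. smooth f' \<and> smooth g' \<and> (\<lambda>x. f x - g x) = (\<lambda>x. f' x - g' x)" using assms by blast
  fix h :: "real \<Rightarrow> complex" assume "\<exists>f g. smooth f \<and> smooth g \<and> h = (\<lambda>x. f x - g x)"
  then obtain f g where h: "smooth f" "smooth g" "h = (\<lambda>x. f x - g x)" by blast
  have d: "(h has_vector_derivative (vderiv f x - vderiv g x)) (at x)" for x
    unfolding h(3) by (intro has_vector_derivative_diff vderiv_works smooth_differentiable h)
  show "(\<forall>x. h differentiable (at x)) \<and> (\<exists>f g. smooth f \<and> smooth g \<and> vderiv h = (\<lambda>x. f x - g x))"
    unfolding vderiv_eqI[OF d] using d h smooth_vderiv by (blast intro: differentiableI_vector)
qed

lemma bump_primitive:
  assumes "\<epsilon> > 0"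
  obtains P m where "\<And>x. (P has_real_derivative bump \<epsilon> x) (at x)" "\<And>x. x \<le> - \<epsilon> \<Longrightarrow> P x = 0" "\<And>x. x \<ge> \<epsilon> \<Longrightarrow> P x = m"
proof -
  \<comment> \<open>Starting one unit to the left of the support leaves room for a two-sided
    derivative at -\<epsilon>.\<close>
  define P where "P x = integral {- \<epsilon> - 1..x} (bump \<epsilon>)" for x
  have d1: "(P has_real_derivative bump \<epsilon> x) (at x)" if "x > - \<epsilon> - 1" for x
  proof -
    have "(P has_real_derivative bump \<epsilon> x) (at x within {- \<epsilon> - 1..x + 1})"
      unfolding P_def by (rule integral_has_real_derivative[OF continuous_on_bump]) (use that in auto)
    then show ?thesis using that by (subst (asm) at_within_interior) auto
  qed
  have z: "P x = 0" if "x \<le> - \<epsilon>" for x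
  proof -
    have "P x = integral {- \<epsilon> - 1..x} (\<lambda>_. 0)"
      unfolding P_def by (rule Henstock_Kurzweil_Integration.integral_cong) (use that bump_zero in auto)
    then show ?thesis by simp
  qed
  have d: "(P has_real_derivative bump \<epsilon> x) (at x)" for x
  proof (cases "x > - \<epsilon> - 1")
    case False
    then have "((\<lambda>x. 0) has_real_derivative bump \<epsilon> x) (at x)" using bump_zero[of \<epsilon> x] assms by simp
    then show ?thesis
      by (rule has_field_derivative_transform_within_open[where S = "{..< - \<epsilon>}"]) (use z False in auto)
  qed (rule d1)
  have "P x = P \<epsilon>" if "x \<ge> \<epsilon>" for x
  proof (cases "x = \<epsilon>")
    case False
    show ?thesis
    proof (rule DERIV_isconst_end[of \<epsilon> x P])
      show "continuous_on {\<epsilon>..x} P"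
        using d by (meson DERIV_isCont continuous_at_imp_continuous_on)
      fix y assume "\<epsilon> < y" "y < x"
      then show "(P has_real_derivative 0) (at y)" using d[of y] bump_zero[of \<epsilon> y] by simp
    qed (use that False in auto)
  qed simp
  then show ?thesis using that d z by blast
qed

section \<open>Primitives of integrable functions\<close>

definition prim :: "(real \<Rightarrow> complex) \<Rightarrow> real \<Rightarrow> complex" where
  "prim V x = (LINT y:{..x}|lborel. V y)"

lemma integrable_on_set:
  fixes V :: "real \<Rightarrow> complex"
  shows "integrable lborel V \<Longrightarrow> S \<in> sets borel \<Longrightarrow> integrable lborel (\<lambda>y. indicator S y *\<^sub>R V y)"
  using integrable_mult_indicator[of S lborel V] by simp

lemma prim_bound: assumes "integrable lborel V" shows "cmod (prim V x) \<le> (LINT y|lborel. cmod (V y))"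
  unfolding prim_def set_lebesgue_integral_def
  by (rule order_trans[OF integral_norm_bound], rule integral_mono)
    (use assms integrable_norm[OF integrable_on_set[OF assms, of "{..x}"]] in \<open>auto simp: indicator_def\<close>)

lemma prim_diff:
  assumes "integrable lborel V" "x \<le> y" shows "prim V y - prim V x = (LINT t:{x<..y}|lborel. V t)"
proof -
  have "prim V y - prim V x = (LINT t|lborel. indicator {..y} t *\<^sub>R V t - indicator {..x} t *\<^sub>R V t)"
    unfolding prim_def set_lebesgue_integral_def
    by (rule Bochner_Integration.integral_diff[symmetric]) (use assms integrable_on_set in auto)
  also have "\<dots> = (LINT t:{x<..y}|lborel. V t)"
    unfolding set_lebesgue_integral_def
    by (rule Bochner_Integration.integral_cong) (use assms in \<open>auto simp: indicator_def\<close>)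
  finally show ?thesis .
qed

lemma prim_tail:
  assumes "integrable lborel V" shows "(LINT t|lborel. V t) - prim V x = (LINT t:{x<..}|lborel. V t)"
proof -
  have "(LINT t|lborel. V t) - prim V x = (LINT t|lborel. V t - indicator {..x} t *\<^sub>R V t)"
    unfolding prim_def set_lebesgue_integral_def
    by (rule Bochner_Integration.integral_diff[symmetric]) (use assms integrable_on_set in auto)
  also have "\<dots> = (LINT t:{x<..}|lborel. V t)"
    unfolding set_lebesgue_integral_def
    by (rule Bochner_Integration.integral_cong) (auto simp: indicator_def)
  finally show ?thesis .
qed

lemma prim_tendsto:
  assumes V: "integrable lborel V"
  shows prim_at_bot: "(prim V \<longlongrightarrow> 0) at_bot" and prim_at_top: "(prim V \<longlongrightarrow> (LINT y|lborel. V y)) at_top"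
    and prim_continuous: "continuous_on UNIV (prim V)"
proof -
  have [measurable]: "V \<in> borel_measurable borel" using V by auto
  have "((\<lambda>x. LINT y|lborel. indicator {..x} y *\<^sub>R V y) \<longlongrightarrow> (LINT y|lborel. V y)) at_top"
  proof (rule integral_dominated_convergence_at_top[where w = "\<lambda>y. cmod (V y)"])
    show "AE y in lborel. ((\<lambda>x. indicator {..x} y *\<^sub>R V y) \<longlongrightarrow> V y) at_top"
    proof (intro AE_I2 tendsto_eventually)
      fix y :: real
      show "\<forall>\<^sub>F x in at_top. indicator {..x} y *\<^sub>R V y = V y"
        using eventually_ge_at_top[of y] by eventually_elim auto
    qed
  qed (use V in \<open>auto intro!: always_eventually AE_I2 simp: indicator_def\<close>)
  then show "(prim V \<longlongrightarrow> (LINT y|lborel. V y)) at_top"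
    by (simp add: prim_def[abs_def] set_lebesgue_integral_def)
  have "((\<lambda>x. LINT y|lborel. indicator {..- x} y *\<^sub>R V y) \<longlongrightarrow> (LINT y|(lborel::real measure). 0)) at_top"
  proof (rule integral_dominated_convergence_at_top[where w = "\<lambda>y. cmod (V y)"])
    show "AE y in lborel. ((\<lambda>x. indicator {..- x} y *\<^sub>R V y) \<longlongrightarrow> 0) at_top"
    proof (intro AE_I2 tendsto_eventually)
      fix y :: real
      show "\<forall>\<^sub>F x in at_top. indicator {..- x} y *\<^sub>R V y = 0"
        using eventually_gt_at_top[of "- y"] by eventually_elim (auto simp: indicator_def)
    qed
  qed (use V in \<open>auto intro!: always_eventually AE_I2 simp: indicator_def\<close>)
  then show "(prim V \<longlongrightarrow> 0) at_bot"
    by (simp add: filterlim_at_bot_mirror prim_def[abs_def] set_lebesgue_integral_def)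
  show "continuous_on UNIV (prim V)"
    unfolding continuous_on_eq_continuous_within
  proof (intro ballI)
    fix x
    show "isCont (prim V) x"
      unfolding continuous_at_sequentially comp_def
    proof (intro allI impI)
      fix z :: "nat \<Rightarrow> real" assume z: "z \<longlonglongrightarrow> x"
      have "(\<lambda>n. LINT y|lborel. indicator {..z n} y *\<^sub>R V y) \<longlonglongrightarrow> (LINT y|lborel. indicator {..x} y *\<^sub>R V y)"
      proof (rule integral_dominated_convergence[where w = "\<lambda>y. cmod (V y)"])
        show "AE y in lborel. (\<lambda>n. indicator {..z n} y *\<^sub>R V y) \<longlonglongrightarrow> indicator {..x} y *\<^sub>R V y"
          using AE_lborel_singleton[of x]
        proof eventually_elim
          case (elim y)
          show ?case
          proof (rule tendsto_eventually, cases "y < x")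
            case True
            show "\<forall>\<^sub>F n in sequentially. indicator {..z n} y *\<^sub>R V y = indicator {..x} y *\<^sub>R V y"
              using order_tendstoD(1)[OF z True] by eventually_elim (use True in auto)
          next
            case False
            then have "x < y" using elim by simp
            show "\<forall>\<^sub>F n in sequentially. indicator {..z n} y *\<^sub>R V y = indicator {..x} y *\<^sub>R V y"
              using order_tendstoD(2)[OF z \<open>x < y\<close>] by eventually_elim (use \<open>x < y\<close> in auto)
          qed
        qed
      qed (use V in \<open>auto intro!: AE_I2 simp: indicator_def\<close>)
      then show "(\<lambda>n. prim V (z n)) \<longlonglongrightarrow> prim V x"
        by (simp add: prim_def set_lebesgue_integral_def)
    qed
  qed
qed

text \<open>Integration by parts as an exchange of integrals with kernel 1 for y \<le> x; neither
  factor has to be differentiable.\<close>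

lemma prim_by_parts:
  assumes V: "integrable lborel V" and W: "integrable lborel W"
  shows "(LINT x|lborel. W x * prim V x) = (LINT y|lborel. V y * (LINT x:{y..}|lborel. W x))"
    and "integrable lborel (\<lambda>x. W x * prim V x)"
    and "integrable lborel (\<lambda>y. V y * (LINT x:{y..}|lborel. W x))"
proof -
  let ?K = "\<lambda>x y. if y \<le> x then 1 else 0 :: complex"
  have K: "(\<lambda>(x, y). ?K x y) \<in> borel_measurable (borel \<Otimes>\<^sub>M (borel :: real measure))"
    by measurable
  have K': "(\<lambda>(y, x). ?K x y) \<in> borel_measurable (borel \<Otimes>\<^sub>M (borel :: real measure))"
    by measurable
  have p: "prim V x = (LINT y|lborel. ?K x y * V y)" for x
    unfolding prim_def set_lebesgue_integral_def by (rule Bochner_Integration.integral_cong) auto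
  have q: "(LINT x:{y..}|lborel. W x) = (LINT x|lborel. ?K x y * W x)" for y
    unfolding set_lebesgue_integral_def by (rule Bochner_Integration.integral_cong) auto
  show "(LINT x|lborel. W x * prim V x) = (LINT y|lborel. V y * (LINT x:{y..}|lborel. W x))"
    unfolding p q by (rule Fubini_kernel[OF W V K, of 1]) auto
  show "integrable lborel (\<lambda>x. W x * prim V x)"
    unfolding p by (rule integrable_kernel[OF W V K, of 1]) auto
  show "integrable lborel (\<lambda>y. V y * (LINT x:{y..}|lborel. W x))"
    unfolding q by (rule integrable_kernel[OF V W K', of 1]) auto
qed

section \<open>Test functions and weak derivatives\<close>

lemma integrable_compact_support:
  fixes f :: "real \<Rightarrow> complex"
  assumes "continuous_on UNIV f" "\<And>x. \<bar>x\<bar> > R \<Longrightarrow> f x = 0"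
  shows "integrable lborel f"
proof -
  have "set_integrable lborel {-R..R} f"
    by (intro borel_integrable_atLeastAtMost' continuous_on_subset[OF assms(1)]) simp
  moreover have "(\<lambda>x. indicator {-R..R} x *\<^sub>R f x) = f"
    using assms(2) by (auto simp: fun_eq_iff indicator_def abs_le_iff not_le intro!: assms(2))
  ultimately show ?thesis by (simp add: set_integrable_def)
qed

lemma test_function_cases:
  assumes "test_function \<eta>"
  obtains R where "smooth \<eta>" "\<And>x. \<bar>x\<bar> > R \<Longrightarrow> \<eta> x = 0" "\<And>x. \<bar>x\<bar> > R \<Longrightarrow> vderiv \<eta> x = 0"
proof -
  obtain R where R: "smooth \<eta>" "\<And>x. \<bar>x\<bar> > R \<Longrightarrow> \<eta> x = 0"
    using assms by (auto simp: test_function_iff)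
  have "vderiv \<eta> x = 0" if x: "\<bar>x\<bar> > R" for x
    unfolding vderiv_def
  proof (rule vector_derivative_at, rule has_vector_derivative_transform_within_open)
    show "((\<lambda>x. 0) has_vector_derivative 0) (at x)" by simp
    show "open {x. R < \<bar>x\<bar>}" by (intro open_Collect_less continuous_intros)
  qed (use R x in auto)
  with R that show ?thesis by blast
qed

lemma test_function_facts:
  assumes "test_function \<eta>"
  shows test_function_smooth: "smooth \<eta>"
    and test_function_continuous: "continuous_on UNIV \<eta>"
    and test_function_vderiv_continuous: "continuous_on UNIV (vderiv \<eta>)"
    and test_function_integrable: "continuous_on UNIV f \<Longrightarrow> integrable lborel (\<lambda>x. f x * \<eta> x)"
    and test_function_vderiv_integrable: "continuous_on UNIV f \<Longrightarrow> integrable lborel (\<lambda>x. f x * vderiv \<eta> x)"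
    and test_function_vderiv_tail: "(LINT x:{y..}|lborel. vderiv \<eta> x) = - \<eta> y"
    and test_function_bounded: "\<exists>B. \<forall>x. cmod (\<eta> x) \<le> B"
proof -
  obtain R where R: "smooth \<eta>" "\<And>x. \<bar>x\<bar> > R \<Longrightarrow> \<eta> x = 0" "\<And>x. \<bar>x\<bar> > R \<Longrightarrow> vderiv \<eta> x = 0"
    using test_function_cases[OF assms] by blast
  show "smooth \<eta>" by fact
  show c: "continuous_on UNIV \<eta>" "continuous_on UNIV (vderiv \<eta>)"
    using R(1) smooth_vderiv smooth_continuous by blast+
  show "integrable lborel (\<lambda>x. f x * \<eta> x)" if "continuous_on UNIV f"
    by (rule integrable_compact_support[where R = R]) (use that c R in \<open>auto intro!: continuous_intros\<close>)
  show "integrable lborel (\<lambda>x. f x * vderiv \<eta> x)" if "continuous_on UNIV f"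
    by (rule integrable_compact_support[where R = R]) (use that c R in \<open>auto intro!: continuous_intros\<close>)
  show "(LINT x:{y..}|lborel. vderiv \<eta> x) = - \<eta> y"
  proof -
    \<comment> \<open>A right endpoint beyond the support and not below y, so that the fundamental
      theorem applies on [y, S] and the upper boundary term vanishes.\<close>
    define S where "S = max y (\<bar>R\<bar> + 1)"
    have S: "y \<le> S" "\<bar>S\<bar> > R" by (auto simp: S_def)
    have "(LINT x:{y..}|lborel. vderiv \<eta> x) = (LINT x|lborel. indicator {y..S} x *\<^sub>R vderiv \<eta> x)"
      unfolding set_lebesgue_integral_def
      by (rule Bochner_Integration.integral_cong) (use R(3) in \<open>auto simp: indicator_def S_def max_def split: if_splits\<close>)
    also have "\<dots> = \<eta> S - \<eta> y"
      by (rule integral_FTC_atLeastAtMost[OF S(1)])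
        (auto intro!: has_vector_derivative_at_within vderiv_works smooth_differentiable R continuous_on_subset[OF c(2)])
    finally show ?thesis using R(2)[OF S(2)] by simp
  qed
  have "compact (\<eta> ` {-R..R})" by (intro compact_continuous_image continuous_on_subset[OF c(1)]) auto
  then have "bounded (\<eta> ` {-R..R})" by (rule compact_imp_bounded)
  then obtain B where "\<forall>y\<in>\<eta> ` {-R..R}. cmod y \<le> B" unfolding bounded_iff by blast
  then have B: "\<And>x. x \<in> {-R..R} \<Longrightarrow> cmod (\<eta> x) \<le> B" by blast
  have "cmod (\<eta> x) \<le> max B 0" for x
    using B[of x] R(2)[of x] by (cases "\<bar>x\<bar> > R") (auto simp: abs_le_iff not_less intro: max.coboundedI1)
  then show "\<exists>B. \<forall>x. cmod (\<eta> x) \<le> B" by blast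
qed

text \<open>Integration by parts with the tail integral of \<open>vderiv \<eta>\<close>, which is
  -\<eta>. The constant c drops out because \<eta> vanishes far to the left, so its derivative has
  total integral 0.\<close>

lemma prim_weak_derivative:
  assumes V: "integrable lborel V" and \<eta>: "test_function \<eta>"
  shows "(LINT x|lborel. (c + prim V x) * vderiv \<eta> x) = - (LINT x|lborel. V x * \<eta> x)"
proof -
  have i: "integrable lborel (vderiv \<eta>)" using test_function_vderiv_integrable[OF \<eta>, of "\<lambda>_. 1"] by simp
  have lim: "((\<lambda>y. LINT x:{- y..}|lborel. vderiv \<eta> x) \<longlongrightarrow> (LINT x|lborel. vderiv \<eta> x)) at_top"
    unfolding set_lebesgue_integral_def
  proof (rule integral_dominated_convergence_at_top[where w = "\<lambda>y. cmod (vderiv \<eta> y)"])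
    show "AE x in lborel. ((\<lambda>y. indicator {- y..} x *\<^sub>R vderiv \<eta> x) \<longlongrightarrow> vderiv \<eta> x) at_top"
    proof (intro AE_I2 tendsto_eventually)
      fix x :: real
      show "\<forall>\<^sub>F y in at_top. indicator {- y..} x *\<^sub>R vderiv \<eta> x = vderiv \<eta> x"
        using eventually_ge_at_top[of "- x"] by eventually_elim auto
    qed
  qed (use i in \<open>auto intro!: always_eventually AE_I2 simp: indicator_def\<close>)
  obtain R where R: "\<And>x. \<bar>x\<bar> > R \<Longrightarrow> \<eta> x = 0" using test_function_cases[OF \<eta>] by blast
  have "\<forall>\<^sub>F y in at_top. (LINT x:{- y..}|lborel. vderiv \<eta> x) = 0"
    using eventually_gt_at_top[of "\<bar>R\<bar>"]
    by eventually_elim (auto simp: test_function_vderiv_tail[OF \<eta>] intro!: R)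
  then have z: "(LINT x|lborel. vderiv \<eta> x) = 0"
    using tendsto_unique[OF trivial_limit_at_top_linorder lim tendsto_eventually] by blast
  have "(LINT x|lborel. (c + prim V x) * vderiv \<eta> x) = (LINT x|lborel. c * vderiv \<eta> x) + (LINT x|lborel. vderiv \<eta> x * prim V x)"
    unfolding distrib_right mult.commute[of "prim V _"]
    by (rule Bochner_Integration.integral_add) (use i prim_by_parts(2)[OF V i] in auto)
  also have "\<dots> = (LINT y|lborel. V y * (LINT x:{y..}|lborel. vderiv \<eta> x))"
    using z by (simp add: prim_by_parts(1)[OF V i])
  finally show ?thesis by (simp add: test_function_vderiv_tail[OF \<eta>])
qed

text \<open>Du Bois-Reymond: testing against a primitive of the difference of two translates of a
  narrow bump compares the values of \<open>q\<close> at two points.\<close>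

lemma weak_derivative_zero_const:
  assumes q: "continuous_on UNIV q" and z: "\<And>\<eta>. test_function \<eta> \<Longrightarrow> (LINT x|lborel. q x * vderiv \<eta> x) = 0"
  shows "q a = q b"
proof (rule ccontr)
  assume ne: "q a \<noteq> q b"
  define d where "d x = q (x + a) - q (x + b)" for x
  \<comment> \<open>Pairing with \<open>d 0\<close> replaces the complex difference by a real
    function that is positive near 0, to which a sign argument applies.\<close>
  define r where "r x = Re (d x * cnj (d 0))" for x
  have dc: "continuous_on UNIV d" unfolding d_def
    by (intro continuous_intros continuous_on_compose2[OF q]) auto
  have rc: "continuous_on UNIV r" unfolding r_def by (intro continuous_intros dc)
  have "r 0 = (cmod (d 0))\<^sup>2" unfolding r_def complex_norm_square[symmetric] by simp
  then have r0: "r 0 > 0" using ne by (simp add: d_def)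
  have "\<forall>\<^sub>F x in nhds 0. r x > 0"
    using order_tendstoD(1)[OF _ r0, of r "nhds 0"] rc
    by (auto simp: continuous_on_eq_continuous_at isCont_def tendsto_at_iff_tendsto_nhds)
  then obtain \<epsilon> where e: "\<epsilon> > 0" "\<And>x. \<bar>x\<bar> < \<epsilon> \<Longrightarrow> r x > 0"
    by (auto simp: eventually_nhds_metric dist_real_def)
  obtain P m where P: "\<And>x. (P has_real_derivative bump \<epsilon> x) (at x)" "\<And>x. x \<le> - \<epsilon> \<Longrightarrow> P x = 0" "\<And>x. x \<ge> \<epsilon> \<Longrightarrow> P x = m"
    using bump_primitive[OF e(1)] by blast
  have Pd: "((\<lambda>x. complex_of_real (P (x - c))) has_vector_derivative complex_of_real (bump \<epsilon> (x - c))) (at x)" for x c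
  proof (rule has_vector_derivative_of_real)
    have "((\<lambda>x. P (x - c)) has_real_derivative bump \<epsilon> (x - c) * 1) (at x)"
      by (rule DERIV_chain2[where f = P and g = "\<lambda>x. x - c"]) (auto intro!: derivative_eq_intros P)
    then show "((\<lambda>x. P (x - c)) has_real_derivative bump \<epsilon> (x - c)) (at x)" by simp
  qed
  define \<eta> where "\<eta> x = complex_of_real (P (x - a)) - complex_of_real (P (x - b))" for x
  have \<eta>d: "(\<eta> has_vector_derivative (complex_of_real (bump \<epsilon> (x - a)) - complex_of_real (bump \<epsilon> (x - b)))) (at x)" for x
    unfolding \<eta>_def by (intro has_vector_derivative_diff Pd)
  have "smooth \<eta>"
    by (rule smooth_if_vderiv[OF \<eta>d]) (intro smooth_diff smooth_bump_shift)
  moreover have "\<eta> x = 0" if "\<bar>x\<bar> > \<epsilon> + \<bar>a\<bar> + \<bar>b\<bar>" for x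
  proof (cases "x > 0")
    \<comment> \<open>Right of both bumps the two primitives have reached the common mass m, which
      cancels; this gives compact support.\<close>
    case True
    then have "x - a \<ge> \<epsilon>" "x - b \<ge> \<epsilon>" using that by (auto simp: abs_if split: if_splits)
    then show ?thesis using P(3) by (simp add: \<eta>_def)
  next
    case False
    then have "x - a \<le> - \<epsilon>" "x - b \<le> - \<epsilon>" using that by (auto simp: abs_if split: if_splits)
    then show ?thesis using P(2) by (simp add: \<eta>_def)
  qed
  ultimately have "test_function \<eta>" by (auto simp: test_function_iff)
  from z[OF this] have i0: "(LINT x|lborel. q x * (complex_of_real (bump \<epsilon> (x - a)) - complex_of_real (bump \<epsilon> (x - b)))) = 0"
    by (simp add: vderiv_eqI[OF \<eta>d])
  have int: "integrable lborel (\<lambda>x. f x * complex_of_real (bump \<epsilon> (x - c)))" if "continuous_on UNIV f" for f c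
  proof (rule integrable_compact_support[where R = "\<epsilon> + \<bar>c\<bar>"])
    show "continuous_on UNIV (\<lambda>x. f x * complex_of_real (bump \<epsilon> (x - c)))"
      by (intro continuous_intros that smooth_continuous[OF smooth_bump_shift])
    show "f x * complex_of_real (bump \<epsilon> (x - c)) = 0" if "\<bar>x\<bar> > \<epsilon> + \<bar>c\<bar>" for x
      using that by (simp add: bump_zero)
  qed
  have "continuous_on UNIV (\<lambda>x. q (x + c))" for c
    by (intro continuous_on_compose2[OF q] continuous_intros) auto
  from int[OF this, of _ 0] have q0: "integrable lborel (\<lambda>x. q (x + c) * complex_of_real (bump \<epsilon> x))" for c
    by simp
  have sh: "(LINT x|lborel. q x * complex_of_real (bump \<epsilon> (x - c))) = (LINT x|lborel. q (x + c) * complex_of_real (bump \<epsilon> x))" for c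
    using lborel_integral_real_affine[of 1 "\<lambda>x. q x * complex_of_real (bump \<epsilon> (x - c))" c] by (simp add: add.commute)
  have "0 = (LINT x|lborel. q x * complex_of_real (bump \<epsilon> (x - a)) - q x * complex_of_real (bump \<epsilon> (x - b)))"
    using i0 by (simp only: right_diff_distrib)
  also have "\<dots> = (LINT x|lborel. q (x + a) * complex_of_real (bump \<epsilon> x)) - (LINT x|lborel. q (x + b) * complex_of_real (bump \<epsilon> x))"
    unfolding sh[symmetric] by (intro Bochner_Integration.integral_diff int q)
  also have "\<dots> = (LINT x|lborel. q (x + a) * complex_of_real (bump \<epsilon> x) - q (x + b) * complex_of_real (bump \<epsilon> x))"
    by (intro Bochner_Integration.integral_diff[symmetric] q0)
  finally have "0 = (LINT x|lborel. d x * complex_of_real (bump \<epsilon> x))"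
    by (simp only: d_def left_diff_distrib)
  then have "0 = (LINT x|lborel. cnj (d 0) * (d x * complex_of_real (bump \<epsilon> x)))" by simp
  then have "0 = Re (LINT x|lborel. cnj (d 0) * (d x * complex_of_real (bump \<epsilon> x)))"
    by (metis zero_complex.sel(1))
  also have "\<dots> = (LINT x|lborel. Re (cnj (d 0) * (d x * complex_of_real (bump \<epsilon> x))))"
    by (rule integral_Re[symmetric]) (use int[OF dc, of 0] in auto)
  also have "\<dots> = (LINT x|lborel. r x * bump \<epsilon> x)"
    by (intro Bochner_Integration.integral_cong) (auto simp: r_def algebra_simps)
  finally have rz: "(LINT x|lborel. r x * bump \<epsilon> x) = 0" by simp
  have nn: "0 \<le> r x * bump \<epsilon> x" for x
    using e(2)[of x] bump_nonneg[of \<epsilon> x] bump_zero[of \<epsilon> x] by (cases "\<bar>x\<bar> < \<epsilon>") auto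
  have ri: "integrable lborel (\<lambda>x. r x * bump \<epsilon> x)"
    using int[of "\<lambda>x. complex_of_real (r x)" 0] rc
    by (simp add: continuous_on_of_real complex_of_real_integrable_eq flip: of_real_mult)
  have "AE x in lborel. r x * bump \<epsilon> x = 0"
    using integral_nonneg_eq_0_iff_AE[OF ri] nn rz by auto
  then have "AE x in lborel. x \<notin> {- \<epsilon><..<\<epsilon>}"
  proof eventually_elim
    case (elim x)
    have "\<not> \<bar>x\<bar> < \<epsilon>" using elim e(2)[of x] bump_pos[of x \<epsilon>] by auto
    then show ?case by (auto simp: abs_less_iff)
  qed
  then have "{- \<epsilon><..<\<epsilon>} \<in> null_sets lborel"
    by (subst AE_iff_null_sets) auto
  then have "emeasure lborel {- \<epsilon><..<\<epsilon>} = 0" by (rule null_setsD1)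
  then show False using e(1) by simp
qed

lemma weak_derivative_prim:
  assumes g: "continuous_on UNIV g" and V: "integrable lborel V"
    and w: "\<And>\<eta>. test_function \<eta> \<Longrightarrow> (LINT x|lborel. g x * vderiv \<eta> x) = - (LINT x|lborel. V x * \<eta> x)"
  shows "\<exists>c. \<forall>x. g x = c + prim V x"
proof -
  let ?q = "\<lambda>x. g x - prim V x"
  have c: "continuous_on UNIV ?q" by (intro continuous_intros g prim_continuous V)
  have "(LINT x|lborel. ?q x * vderiv \<eta> x) = 0" if "test_function \<eta>" for \<eta>
    using w[OF that] prim_weak_derivative[OF V that, of 0]
      test_function_vderiv_integrable[OF that g] test_function_vderiv_integrable[OF that prim_continuous[OF V]]
    by (simp add: left_diff_distrib)
  then have "?q x = ?q 0" for x by (rule weak_derivative_zero_const[OF c])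
  then have "g x = ?q 0 + prim V x" for x by (metis diff_add_cancel)
  then show ?thesis by blast
qed

lemma continuous_AE_zero:
  fixes g :: "real \<Rightarrow> complex"
  assumes "continuous_on UNIV g" "AE x in lborel. g x = 0" shows "g x = 0"
proof (rule ccontr)
  assume "g x \<noteq> 0"
  then have "\<forall>\<^sub>F y in nhds x. g y \<noteq> 0"
    using assms(1) by (intro tendsto_imp_eventually_ne) (auto simp: continuous_on_eq_continuous_at isCont_def tendsto_at_iff_tendsto_nhds)
  then obtain e where e: "e > 0" "\<And>y. dist y x < e \<Longrightarrow> g y \<noteq> 0"
    by (auto simp: eventually_nhds_metric)
  have "AE y in lborel. y \<notin> {x<..<x + e}"
    using assms(2)
  proof eventually_elim
    case (elim y)
    then show ?case using e(2)[of y] by (auto simp: dist_real_def)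
  qed
  then have "{x<..<x + e} \<in> null_sets lborel"
    by (subst AE_iff_null_sets) auto
  then have "emeasure lborel {x<..<x + e} = 0" by (rule null_setsD1)
  then show False using e(1) by simp
qed

section \<open>Energy and Fourier transform of a primitive\<close>

lemma prim_cong_AE:
  assumes "integrable lborel V" "integrable lborel W" "AE x in lborel. V x = W x"
  shows "prim V = prim W"
proof
  fix x
  show "prim V x = prim W x"
    unfolding prim_def set_lebesgue_integral_def
  proof (rule integral_cong_AE)
    show "AE y in lborel. indicator {..x} y *\<^sub>R V y = indicator {..x} y *\<^sub>R W y"
      using assms(3) by eventually_elim simp
  qed (use assms in auto)
qed

lemma prim_add:
  assumes "integrable lborel V" "integrable lborel W"
  shows "prim (\<lambda>x. V x + c * W x) x = prim V x + c * prim W x"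
proof -
  have "prim (\<lambda>x. V x + c * W x) x = (LINT y|lborel. indicator {..x} y *\<^sub>R V y + c * (indicator {..x} y *\<^sub>R W y))"
    unfolding prim_def set_lebesgue_integral_def by (simp add: scaleR_add_right)
  also have "\<dots> = (LINT y|lborel. indicator {..x} y *\<^sub>R V y) + (LINT y|lborel. c * (indicator {..x} y *\<^sub>R W y))"
    by (intro Bochner_Integration.integral_add integrable_mult_right integrable_on_set assms) auto
  finally show ?thesis unfolding prim_def set_lebesgue_integral_def by (simp only: integral_mult_right_zero)
qed

lemma tail_integral_closed: "(LINT x:{y..}|lborel. W x) = (LINT x:{y<..}|lborel. W x)"
  if "integrable lborel W" for W :: "real \<Rightarrow> complex"
  unfolding set_lebesgue_integral_def
proof (rule integral_cong_AE)
  show "AE x in lborel. indicator {y..} x *\<^sub>R W x = indicator {y<..} x *\<^sub>R W x"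
    using AE_lborel_singleton[of y] by eventually_elim (auto simp: indicator_def)
qed (use that in auto)

lemma set_integral_cnj: "(LINT x:S|lborel. cnj (W x)) = cnj (LINT x:S|lborel. W x)" for W :: "real \<Rightarrow> complex"
  unfolding set_lebesgue_integral_def by (subst Bochner_Integration.integral_cnj[symmetric]) simp

text \<open>The derivative of |g|^2 integrated over the line. As g need not be differentiable, the
  argument is a symmetrisation: integration by parts shows \<open>cnj J = I * cnj I - J\<close>,
  hence twice the real part of J is |I|^2.\<close>

lemma prim_energy:
  assumes V: "integrable lborel V" and g: "\<And>x. g x = c + prim V x"
  shows "(cmod (c + (LINT x|lborel. V x)))\<^sup>2 = (cmod c)\<^sup>2 + 2 * Re (LINT x|lborel. V x * cnj (g x))"
proof -
  define I where "I = (LINT x|lborel. V x)"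
  define J where "J = (LINT x|lborel. V x * cnj (prim V x))"
  have W: "integrable lborel (\<lambda>x. cnj (V x))" using V by simp
  have Ji: "integrable lborel (\<lambda>x. V x * cnj (prim V x))"
    using integrable_cnj[OF prim_by_parts(2)[OF V W]] by simp
  have "cnj J = (LINT x|lborel. cnj (V x) * prim V x)"
    unfolding J_def by (subst Bochner_Integration.integral_cnj[symmetric]) simp
  also have "\<dots> = (LINT y|lborel. V y * (LINT x:{y..}|lborel. cnj (V x)))"
    by (rule prim_by_parts(1)[OF V W])
  also have "\<dots> = (LINT y|lborel. V y * cnj (I - prim V y))"
    by (simp add: set_integral_cnj tail_integral_closed[OF V] prim_tail[OF V] I_def)
  also have "\<dots> = (LINT y|lborel. V y * cnj I - V y * cnj (prim V y))"
    by (simp add: right_diff_distrib)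
  also have "\<dots> = I * cnj I - J"
    unfolding J_def by (subst Bochner_Integration.integral_diff) (use V Ji in \<open>auto simp: I_def\<close>)
  finally have "cnj J + J = I * cnj I" by simp
  then have reJ: "2 * Re J = (cmod I)\<^sup>2"
    using complex_add_cnj[of J] complex_norm_square[of I] by (metis Re_complex_of_real add.commute)
  have "(LINT x|lborel. V x * cnj (g x)) = (LINT x|lborel. V x * cnj c + V x * cnj (prim V x))"
    by (simp add: g distrib_left)
  also have "\<dots> = I * cnj c + J"
    unfolding J_def by (subst Bochner_Integration.integral_add) (use V Ji in \<open>auto simp: I_def\<close>)
  finally have "2 * Re (LINT x|lborel. V x * cnj (g x)) = 2 * Re (I * cnj c) + (cmod I)\<^sup>2"
    using reJ by simp
  moreover have "(cmod (c + I))\<^sup>2 = (cmod c)\<^sup>2 + 2 * Re (I * cnj c) + (cmod I)\<^sup>2"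
    unfolding cmod_power2 by (simp add: power2_eq_square algebra_simps)
  ultimately show ?thesis by (simp add: I_def)
qed

text \<open>For the truncated primitive, integration by parts leaves boundary terms that vanish in
  the limit because the primitive tends to 0 at both ends; at the right end this is the hypothesis
  on the total integral. The resulting limit is pointwise for \<xi> \<noteq> 0, while
  \<open>G\<close> is an L2 limit; an almost everywhere convergent subsequence identifies the
  two.\<close>

lemma prim_fourier:
  assumes V: "integrable lborel V" and I: "(LINT x|lborel. V x) = 0"
    and g: "L2 (prim V)" "has_fourier (prim V) G"
  shows "AE \<xi> in lborel. \<i> * complex_of_real \<xi> * G \<xi> = ft V \<xi>"
proof -
  have [measurable]: "V \<in> borel_measurable borel" using V by auto
  have lim: "(\<lambda>n. \<i> * complex_of_real \<xi> * ft (trunc (prim V) (real n)) \<xi>) \<longlonglongrightarrow> ft V \<xi>" if "\<xi> \<noteq> 0" for \<xi>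
  proof -
    let ?W = "\<lambda>R x. indicator {-R..R} x *\<^sub>R ee (- \<xi>) x"
    \<comment> \<open>The contributions of the lower and the upper endpoint when the character is
      integrated over the part of [-R, R] to the right of y.\<close>
    let ?S = "\<lambda>R y. if y \<le> R then ee (- \<xi>) (max y (- R)) else 0"
    let ?T = "\<lambda>R y. if y \<le> R then ee (- \<xi>) R else 0"
    have W: "integrable lborel (?W R)" for R
      using borel_integrable_atLeastAtMost'[of "-R" R "ee (- \<xi>)"] by (simp add: set_integrable_def continuous_intros)
    have tail: "\<i> * complex_of_real \<xi> * (LINT x:{y..}|lborel. ?W R x) = ?S R y - ?T R y" if "R \<ge> 0" for R y
    proof (cases "y \<le> R")
      case True
      let ?a = "max y (- R)"
      have "(LINT x:{y..}|lborel. ?W R x) = (LINT x|lborel. indicator {?a..R} x *\<^sub>R ee (- \<xi>) x)"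
        unfolding set_lebesgue_integral_def by (rule Bochner_Integration.integral_cong) (auto simp: indicator_def)
      moreover have "(LINT x|lborel. indicator {?a..R} x *\<^sub>R ((\<i> * complex_of_real (- \<xi>)) * ee (- \<xi>) x)) = ee (- \<xi>) R - ee (- \<xi>) ?a"
      proof (rule integral_FTC_atLeastAtMost)
        show "?a \<le> R" using True \<open>R \<ge> 0\<close> by simp
        show "(ee (- \<xi>) has_vector_derivative (\<i> * complex_of_real (- \<xi>)) * ee (- \<xi>) x) (at x within {?a..R})" for x
          using ee_has_vector_derivative has_vector_derivative_at_within by blast
      qed (intro continuous_intros)
      ultimately have "(\<i> * complex_of_real (- \<xi>)) * (LINT x:{y..}|lborel. ?W R x) = ee (- \<xi>) R - ee (- \<xi>) ?a"
        by (simp add: mult_scaleR_right[symmetric] del: mult_scaleR_right)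
      then show ?thesis using True by (simp add: algebra_simps)
    next
      case False
      then have "(\<lambda>x. indicator {y..} x *\<^sub>R ?W R x) = (\<lambda>x. 0)" by (auto simp: indicator_def fun_eq_iff)
      then have "(LINT x:{y..}|lborel. ?W R x) = 0" unfolding set_lebesgue_integral_def by simp
      then show ?thesis using False by simp
    qed
    have Si: "integrable lborel (\<lambda>y. ?S R y * V y)" for R
      by (rule integrable_bounded_mult[OF V, where B = 1]) auto
    have Ti: "integrable lborel (\<lambda>y. ?T R y * V y)" for R
      by (rule integrable_bounded_mult[OF V, where B = 1]) auto
    have eq: "\<i> * complex_of_real \<xi> * ft (trunc (prim V) R) \<xi> = (LINT y|lborel. ?S R y * V y) - ee (- \<xi>) R * prim V R" if "R \<ge> 0" for R
    proof -
      have "ft (trunc (prim V) R) \<xi> = (LINT x|lborel. ?W R x * prim V x)"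
        unfolding ft_def trunc_def by (rule Bochner_Integration.integral_cong) (auto simp: indicator_def)
      also have "\<dots> = (LINT y|lborel. V y * (LINT x:{y..}|lborel. ?W R x))"
        by (rule prim_by_parts(1)[OF V W])
      finally have "\<i> * complex_of_real \<xi> * ft (trunc (prim V) R) \<xi> = (LINT y|lborel. (\<i> * complex_of_real \<xi> * (LINT x:{y..}|lborel. ?W R x)) * V y)"
        by (simp add: mult_ac flip: integral_mult_right_zero)
      also have "\<dots> = (LINT y|lborel. ?S R y * V y - ?T R y * V y)"
        unfolding tail[OF that] by (simp only: left_diff_distrib)
      also have "\<dots> = (LINT y|lborel. ?S R y * V y) - (LINT y|lborel. ?T R y * V y)"
        by (rule Bochner_Integration.integral_diff[OF Si Ti])
      also have "(LINT y|lborel. ?T R y * V y) = (LINT y|lborel. ee (- \<xi>) R * (indicator {..R} y *\<^sub>R V y))"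
        by (rule Bochner_Integration.integral_cong) auto
      also have "\<dots> = ee (- \<xi>) R * prim V R"
        by (simp only: prim_def set_lebesgue_integral_def integral_mult_right_zero)
      finally show ?thesis .
    qed
    have "(\<lambda>n. LINT y|lborel. ?S (real n) y * V y) \<longlonglongrightarrow> (LINT y|lborel. ee (- \<xi>) y * V y)"
    proof (rule integral_dominated_convergence[where w = "\<lambda>y. cmod (V y)"])
      show "AE y in lborel. (\<lambda>n. ?S (real n) y * V y) \<longlonglongrightarrow> ee (- \<xi>) y * V y"
      proof (intro AE_I2 tendsto_eventually)
        fix y
        have "\<forall>\<^sub>F n in sequentially. \<bar>y\<bar> \<le> real n"
          using filterlim_real_sequentially unfolding filterlim_at_top by blast
        then show "\<forall>\<^sub>F n in sequentially. ?S (real n) y * V y = ee (- \<xi>) y * V y"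
        proof eventually_elim
          case (elim n)
          then have "max y (- real n) = y" "y \<le> real n" by auto
          then show ?case by simp
        qed
      qed
    qed (use V in \<open>auto simp: norm_mult\<close>)
    moreover have "(\<lambda>n. ee (- \<xi>) (real n) * prim V (real n)) \<longlonglongrightarrow> 0"
    proof (rule Lim_null_comparison)
      have "(\<lambda>n. prim V (real n)) \<longlonglongrightarrow> 0"
        using filterlim_compose[OF prim_at_top[OF V] filterlim_real_sequentially] I by simp
      then show "(\<lambda>n. cmod (prim V (real n))) \<longlonglongrightarrow> 0" by (rule tendsto_norm_zero)
    qed (simp add: norm_mult)
    ultimately have "(\<lambda>n. (LINT y|lborel. ?S (real n) y * V y) - ee (- \<xi>) (real n) * prim V (real n)) \<longlonglongrightarrow> (LINT y|lborel. ee (- \<xi>) y * V y) - 0"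
      by (rule tendsto_diff)
    moreover have "ft V \<xi> = (LINT y|lborel. ee (- \<xi>) y * V y)" by (simp only: ft_def mult.commute)
    ultimately show ?thesis unfolding eq[OF of_nat_0_le_iff] by simp
  qed
  have G: "L2 G" "((\<lambda>R. l2n (\<lambda>\<xi>. ft (trunc (prim V) R) \<xi> - G \<xi>)) \<longlongrightarrow> 0) at_top"
    using g has_fourier_iff by blast+
  have "L2 (ft (trunc (prim V) (real n)))" for n
    by (intro ft_L2 trunc_integrable trunc_L2 g)
  from L2_tendsto_AE_subseq[OF this G(1) filterlim_compose[OF G(2) filterlim_real_sequentially]]
  obtain r where r: "strict_mono r" "AE \<xi> in lborel. (\<lambda>n. ft (trunc (prim V) (real (r n))) \<xi>) \<longlonglongrightarrow> G \<xi>"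
    by blast
  show ?thesis
    using r(2) AE_lborel_singleton[of 0]
  proof eventually_elim
    case (elim \<xi>)
    have "(\<lambda>n. \<i> * complex_of_real \<xi> * ft (trunc (prim V) (real (r n))) \<xi>) \<longlonglongrightarrow> \<i> * complex_of_real \<xi> * G \<xi>"
      by (intro tendsto_mult_left elim)
    moreover have "(\<lambda>n. \<i> * complex_of_real \<xi> * ft (trunc (prim V) (real (r n))) \<xi>) \<longlonglongrightarrow> ft V \<xi>"
      using LIMSEQ_subseq_LIMSEQ[OF lim[OF elim(2)] r(1)] by (simp add: comp_def)
    ultimately show ?case by (rule LIMSEQ_unique)
  qed
qed

section \<open>Dependence of the projector on the spectral parameter\<close>

lemma ee_diff_le: "cmod (ee a z - ee b z) \<le> \<bar>z\<bar> * \<bar>a - b\<bar>"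
proof -
  have "ee a z - ee b z = ee b z * (ee (a - b) z - 1)"
    by (simp add: right_diff_distrib ee_add)
  then have "cmod (ee a z - ee b z) = cmod (iexp ((a - b) * z) - 1)"
    by (simp add: norm_mult ee_def)
  also have "\<dots> \<le> \<bar>(a - b) * z\<bar>" using iexp_approx1[of "(a - b) * z" 0] by simp
  finally show ?thesis by (simp add: abs_mult mult.commute)
qed

lemma interval_integral_bound:
  fixes H :: "real \<Rightarrow> complex"
  assumes [measurable]: "H \<in> borel_measurable borel" and H: "\<And>\<xi>. p \<le> \<xi> \<Longrightarrow> \<xi> \<le> q \<Longrightarrow> cmod (H \<xi>) \<le> K" and "p \<le> q" "0 \<le> K"
  shows "cmod (LINT \<xi>:{p..<q}|lborel. H \<xi>) \<le> (q - p) * K"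
proof -
  have "ennreal (cmod (LINT \<xi>:{p..<q}|lborel. H \<xi>)) \<le> (\<integral>\<^sup>+\<xi>. ennreal (cmod (indicator {p..<q} \<xi> *\<^sub>R H \<xi>)) \<partial>lborel)"
    unfolding set_lebesgue_integral_def by (rule norm_integral_le_nn_integral)
  also have "\<dots> \<le> (\<integral>\<^sup>+\<xi>. ennreal K * indicator {p..<q} \<xi> \<partial>lborel)"
    by (intro nn_integral_mono) (auto simp: indicator_def intro!: ennreal_leI H)
  also have "\<dots> = ennreal ((q - p) * K)"
    using assms by (simp add: nn_integral_cmult_indicator ennreal_mult mult.commute)
  finally show ?thesis using assms by (simp add: ennreal_le_iff)
qed

lemma interval_integral_diff_const:
  fixes H :: "real \<Rightarrow> complex"
  assumes [measurable]: "H \<in> borel_measurable borel" and H: "\<And>\<xi>. cmod (H \<xi>) \<le> K" and "p \<le> q"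
  shows "(LINT \<xi>:{p..<q}|lborel. H \<xi> - c) = (LINT \<xi>:{p..<q}|lborel. H \<xi>) - complex_of_real (q - p) * c"
proof -
  have i: "integrable lborel (\<lambda>\<xi>. complex_of_real (indicator {p..<q} \<xi>))"
    using \<open>p \<le> q\<close> by (subst complex_of_real_integrable_eq) (intro integrable_real_indicator; simp)
  have iH: "integrable lborel (\<lambda>\<xi>. indicator {p..<q} \<xi> *\<^sub>R H \<xi>)"
    using integrable_bounded_mult[OF i, of H K] H by (simp add: scaleR_conv_of_real mult.commute)
  have ic: "integrable lborel (\<lambda>\<xi>. indicator {p..<q} \<xi> *\<^sub>R c)"
    using integrable_mult_left[OF i, of c] by (simp add: scaleR_conv_of_real)
  have "(LINT \<xi>:{p..<q}|lborel. H \<xi> - c) = (LINT \<xi>:{p..<q}|lborel. H \<xi>) - (LINT \<xi>|lborel. indicator {p..<q} \<xi> *\<^sub>R c)"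
    unfolding set_lebesgue_integral_def scaleR_diff_right by (rule Bochner_Integration.integral_diff[OF iH ic])
  also have "(LINT \<xi>|lborel. indicator {p..<q} \<xi> *\<^sub>R c) = complex_of_real (q - p) * c"
    using \<open>p \<le> q\<close> by (simp add: scaleR_conv_of_real[of _ c] flip: of_real_diff)
  finally show ?thesis .
qed

text \<open>Band length times the sup of the transform; the factor 1 / (2 pi) is estimated by 1. It
  makes \<open>T\<close> Lipschitz in the spectral parameter.\<close>

lemma sz_diff_bound:
  assumes f: "integrable lborel f" "L2 f"
  shows "AE x in lborel. cmod (sz b f x - sz a f x) \<le> \<bar>b - a\<bar> * (LINT y|lborel. cmod (f y))"
proof -
  have [measurable]: "ft f \<in> borel_measurable borel" using f(1) by (rule ft_measurable)
  have *: "AE x in lborel. cmod (sz b f x - sz a f x) \<le> (b - a) * (LINT y|lborel. cmod (f y))" if "a < b" for a b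
    using sz_diff[OF f that]
  proof eventually_elim
    case (elim x)
    have b: "cmod (LINT \<xi>:{- b..<- a}|lborel. ft f \<xi> * ee x \<xi>) \<le> (- a - (- b)) * (LINT y|lborel. cmod (f y))"
      using that by (intro interval_integral_bound) (auto simp: norm_mult ft_bound[OF f(1)])
    have "cmod (sz b f x - sz a f x) = 1 / (2 * pi) * cmod (LINT \<xi>:{- b..<- a}|lborel. ft f \<xi> * ee x \<xi>)"
      unfolding elim by (simp add: norm_mult norm_divide)
    also have "\<dots> \<le> 1 * cmod (LINT \<xi>:{- b..<- a}|lborel. ft f \<xi> * ee x \<xi>)"
      using pi_gt3 by (intro mult_right_mono) auto
    finally show ?case using b by simp
  qed
  consider "a < b" | "b < a" | "a = b" by linarith
  then show ?thesis
  proof cases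
    case 1 then show ?thesis using *[OF 1] by simp
  next
    case 2 then show ?thesis using *[OF 2] by (simp add: norm_minus_commute)
  qed simp
qed

text \<open>The linear phase bound alone would require a first moment of \<open>f\<close>. Capping
  it by 2 keeps the integrand integrable for integrable \<open>f\<close>, and the bound still tends
  to 0 with \<delta> by dominated convergence.\<close>

lemma ft_ee_diff_bound:
  assumes f: "integrable lborel f" and \<xi>: "\<bar>\<xi> - \<zeta>\<bar> \<le> \<delta>"
  shows "cmod (ft f \<xi> * ee x \<xi> - ft f \<zeta> * ee x \<zeta>) \<le> (LINT y|lborel. cmod (f y) * min 2 (\<bar>x - y\<bar> * \<delta>))"
proof -
  have [measurable]: "f \<in> borel_measurable borel" using f by auto
  have e: "ft f \<xi> * ee x \<xi> = (LINT y|lborel. f y * ee \<xi> (x - y))" for \<xi>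
  proof -
    have "ee (- \<xi>) y * ee x \<xi> = ee \<xi> (x - y)" for y
      by (simp add: ee_def algebra_simps flip: exp_add)
    then have "f y * ee (- \<xi>) y * ee x \<xi> = f y * ee \<xi> (x - y)" for y by (simp only: mult.assoc)
    then show ?thesis unfolding ft_def integral_mult_left_zero[symmetric] by (simp only:)
  qed
  have i: "integrable lborel (\<lambda>y. f y * ee \<xi> (x - y))" for \<xi>
    using integrable_ee[OF f, of "\<lambda>_. \<xi>" "\<lambda>y. x - y"] by (simp add: mult.commute)
  have "0 \<le> \<delta>" using \<xi> by linarith
  have "ft f \<xi> * ee x \<xi> - ft f \<zeta> * ee x \<zeta> = (LINT y|lborel. f y * ee \<xi> (x - y) - f y * ee \<zeta> (x - y))"
    unfolding e by (rule Bochner_Integration.integral_diff[symmetric, OF i i])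
  then have "cmod (ft f \<xi> * ee x \<xi> - ft f \<zeta> * ee x \<zeta>) \<le> (LINT y|lborel. cmod (f y * ee \<xi> (x - y) - f y * ee \<zeta> (x - y)))"
    by (simp only: integral_norm_bound)
  also have "\<dots> \<le> (LINT y|lborel. cmod (f y) * min 2 (\<bar>x - y\<bar> * \<delta>))"
  proof (rule integral_mono)
    show "integrable lborel (\<lambda>y. cmod (f y * ee \<xi> (x - y) - f y * ee \<zeta> (x - y)))"
      by (intro integrable_norm Bochner_Integration.integrable_diff i)
    show "integrable lborel (\<lambda>y. cmod (f y) * min 2 (\<bar>x - y\<bar> * \<delta>))"
    proof (rule Bochner_Integration.integrable_bound[where f = "\<lambda>y. 2 * cmod (f y)"])
      have "cmod (f y) * min 2 (\<bar>x - y\<bar> * \<delta>) \<le> 2 * cmod (f y)" for y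
        using mult_left_mono[of "min 2 (\<bar>x - y\<bar> * \<delta>)" 2 "cmod (f y)"] by (simp add: mult.commute)
      then show "AE y in lborel. norm (cmod (f y) * min 2 (\<bar>x - y\<bar> * \<delta>)) \<le> norm (2 * cmod (f y))"
        using \<open>0 \<le> \<delta>\<close> by (simp add: abs_mult)
    qed (use f in auto)
    fix y
    have "cmod (ee \<xi> (x - y) - ee \<zeta> (x - y)) \<le> 2"
      using norm_triangle_ineq4[of "ee \<xi> (x - y)" "ee \<zeta> (x - y)"] by simp
    moreover have "cmod (ee \<xi> (x - y) - ee \<zeta> (x - y)) \<le> \<bar>x - y\<bar> * \<delta>"
      using ee_diff_le[of \<xi> "x - y" \<zeta>] mult_left_mono[OF \<xi>, of "\<bar>x - y\<bar>"] by linarith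
    ultimately have "cmod (f y) * cmod (ee \<xi> (x - y) - ee \<zeta> (x - y)) \<le> cmod (f y) * min 2 (\<bar>x - y\<bar> * \<delta>)"
      by (intro mult_left_mono) auto
    then show "cmod (f y * ee \<xi> (x - y) - f y * ee \<zeta> (x - y)) \<le> cmod (f y) * min 2 (\<bar>x - y\<bar> * \<delta>)"
      by (simp only: right_diff_distrib[symmetric] norm_mult)
  qed
  finally show ?thesis .
qed

text \<open>On the band the integrand is replaced by its value at the endpoint -a. The main term is
  therefore a multiple of a single character, which multiplied by \<open>u\<close> gives the source
  term of the equation for \<phi>.\<close>

lemma sz_deriv_bound:
  assumes f: "integrable lborel f" "L2 f"
  shows "AE x in lborel. cmod (sz b f x - sz a f x - complex_of_real (b - a) * (complex_of_real (1 / (2 * pi)) * ft f (- a)) * ee (- a) x)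
    \<le> \<bar>b - a\<bar> * (LINT y|lborel. cmod (f y) * min 2 (\<bar>x - y\<bar> * \<bar>b - a\<bar>))"
proof -
  have [measurable]: "ft f \<in> borel_measurable borel" using f(1) by (rule ft_measurable)
  let ?w = "\<lambda>x. LINT y|lborel. cmod (f y) * min 2 (\<bar>x - y\<bar> * \<bar>b - a\<bar>)"
  let ?c = "\<lambda>x. ft f (- a) * ee x (- a)"
  let ?p = "complex_of_real (1 / (2 * pi))"
  have w0: "0 \<le> ?w x" for x by (intro integral_nonneg_AE AE_I2) auto
  \<comment> \<open>Formulated for an interval on either side of -a, so that it serves both signs of
    b - a.\<close>
  have core: "cmod (?p * (LINT \<xi>:{p..<q}|lborel. ft f \<xi> * ee x \<xi>) - complex_of_real (q - p) * (?p * ?c x)) \<le> (q - p) * ?w x"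
    if "p \<le> q" and pq: "\<And>\<xi>. p \<le> \<xi> \<Longrightarrow> \<xi> \<le> q \<Longrightarrow> \<bar>\<xi> - (- a)\<bar> \<le> \<bar>b - a\<bar>" for p q x
  proof -
    have d: "(LINT \<xi>:{p..<q}|lborel. ft f \<xi> * ee x \<xi> - ?c x) = (LINT \<xi>:{p..<q}|lborel. ft f \<xi> * ee x \<xi>) - complex_of_real (q - p) * ?c x"
      by (rule interval_integral_diff_const[where K = "LINT y|lborel. cmod (f y)"]) (use that ft_bound[OF f(1)] in \<open>auto simp: norm_mult\<close>)
    have "?p * (LINT \<xi>:{p..<q}|lborel. ft f \<xi> * ee x \<xi>) - complex_of_real (q - p) * (?p * ?c x) = ?p * (LINT \<xi>:{p..<q}|lborel. ft f \<xi> * ee x \<xi> - ?c x)"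
      unfolding d by (simp only: right_diff_distrib mult.left_commute)
    then have "cmod (?p * (LINT \<xi>:{p..<q}|lborel. ft f \<xi> * ee x \<xi>) - complex_of_real (q - p) * (?p * ?c x)) = 1 / (2 * pi) * cmod (LINT \<xi>:{p..<q}|lborel. ft f \<xi> * ee x \<xi> - ?c x)"
      by (simp add: norm_mult norm_divide)
    also have "\<dots> \<le> 1 * cmod (LINT \<xi>:{p..<q}|lborel. ft f \<xi> * ee x \<xi> - ?c x)"
      using pi_gt3 by (intro mult_right_mono) auto
    also have "cmod (LINT \<xi>:{p..<q}|lborel. ft f \<xi> * ee x \<xi> - ?c x) \<le> (q - p) * ?w x"
      by (rule interval_integral_bound[OF _ ft_ee_diff_bound[OF f(1) pq] \<open>p \<le> q\<close> w0]) auto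
    finally show ?thesis by simp
  qed
  consider "a < b" | "b < a" | "a = b" by linarith
  then show ?thesis
  proof cases
    case 1
    show ?thesis
      using sz_diff[OF f 1]
    proof eventually_elim
      case (elim x)
      show ?case using core[of "- b" "- a" x] 1 unfolding elim by (simp add: ee_commute[of x] mult_ac)
    qed
  next
    case 2
    show ?thesis
      using sz_diff[OF f 2]
    proof eventually_elim
      case (elim x)
      have "sz b f x - sz a f x - complex_of_real (b - a) * (?p * ft f (- a)) * ee (- a) x
        = - (?p * (LINT \<xi>:{- a..<- b}|lborel. ft f \<xi> * ee x \<xi>) - complex_of_real (- b - - a) * (?p * ?c x))"
      proof -
        have gen: "X - Y = A \<Longrightarrow> Y - X - complex_of_real (b - a) * (p * F) * E = - (A - complex_of_real (- b - - a) * (p * (F * E)))"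
          for X Y A F E p :: complex by (auto simp: algebra_simps)
        show ?thesis unfolding ee_commute[of x "- a"] by (rule gen[OF elim])
      qed
      then have "cmod (sz b f x - sz a f x - complex_of_real (b - a) * (?p * ft f (- a)) * ee (- a) x)
        = cmod (?p * (LINT \<xi>:{- a..<- b}|lborel. ft f \<xi> * ee x \<xi>) - complex_of_real (- b - - a) * (?p * ?c x))"
        by (simp only: norm_minus_cancel)
      also have "\<dots> \<le> (- b - - a) * ?w x" by (rule core) (use 2 in auto)
      finally show ?case using 2 by simp
    qed
  next
    case 3 then show ?thesis by simp
  qed
qed

section \<open>Eigenfunctions: limits and change of representative\<close>

lemma L2_limit_zero:
  assumes g: "L2 g" and a: "(g \<longlongrightarrow> a) at_top" shows "a = 0"
proof (rule ccontr)
  assume "a \<noteq> 0"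
  then have "\<forall>\<^sub>F x in at_top. cmod (g x) > cmod a / 2"
    using order_tendstoD(1)[OF tendsto_norm[OF a], of "cmod a / 2"] by simp
  then obtain N where N: "\<And>x. x \<ge> N \<Longrightarrow> cmod (g x) > cmod a / 2"
    by (auto simp: eventually_at_top_linorder)
  let ?c = "(cmod a / 2)\<^sup>2"
  have le: "real n * ?c \<le> (l2n g)\<^sup>2" for n
  proof -
    have "(LINT x|lborel. indicator {N..N + real n} x * ?c) \<le> (LINT x|lborel. (cmod (g x))\<^sup>2)"
    proof (rule integral_mono)
      show "integrable lborel (\<lambda>x. indicator {N..N + real n} x * ?c)"
        by (intro integrable_mult_left integrable_real_indicator) auto
      show "indicator {N..N + real n} x * ?c \<le> (cmod (g x))\<^sup>2" for x
        using N[of x] by (auto simp: indicator_def intro!: power_mono less_imp_le)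
    qed (rule L2_sq[OF g])
    then show ?thesis by (simp add: l2n_sq)
  qed
  obtain n :: nat where "(l2n g)\<^sup>2 / ?c < real n" using reals_Archimedean2 by blast
  with le[of n] \<open>a \<noteq> 0\<close> show False by (simp add: field_simps)
qed

text \<open>An eigenfunction is given up to null sets, whereas the passage to the gauge asks for a
  continuous function; this allows the Sobolev representative to be substituted.\<close>

lemma lax_eq_cong_AE:
  assumes "h \<in> borel_measurable borel" "h' \<in> borel_measurable borel" "u \<in> borel_measurable borel" "AE x in lborel. h x = h' x"
    and l: "lax_eq u h (\<lambda>x. c * h x)"
  shows "lax_eq u h' (\<lambda>x. c * h' x)"
  unfolding lax_eq_def
proof (intro allI impI)
  fix \<eta> assume \<eta>: "test_function \<eta>"
  have [measurable]: "\<eta> \<in> borel_measurable borel" "vderiv \<eta> \<in> borel_measurable borel"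
    using test_function_continuous[OF \<eta>] test_function_vderiv_continuous[OF \<eta>] by (auto intro: borel_measurable_continuous_onI)
  have [measurable]: "h \<in> borel_measurable borel" "h' \<in> borel_measurable borel" "u \<in> borel_measurable borel" by fact+
  have 1: "(LINT x|lborel. \<i> * h x * vderiv \<eta> x) = (LINT x|lborel. \<i> * h' x * vderiv \<eta> x)"
    by (rule integral_cong_AE) (use assms(4) in auto)
  have "AE x in lborel. cnj (u x) * h x = cnj (u x) * h' x"
    using assms(4) by eventually_elim simp
  then have 2: "szego (\<lambda>y. cnj (u y) * h y) = szego (\<lambda>y. cnj (u y) * h' y)"
    by (rule szego_cong) auto
  have 3: "(LINT x|lborel. c * h x * \<eta> x) = (LINT x|lborel. c * h' x * \<eta> x)"
    by (rule integral_cong_AE) (use assms(4) in auto)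
  show "(LINT x|lborel. \<i> * h' x * vderiv \<eta> x) - (LINT x|lborel. u x * szego (\<lambda>y. cnj (u y) * h' y) x * \<eta> x) = (LINT x|lborel. c * h' x * \<eta> x)"
    using l \<eta> unfolding lax_eq_def 1[symmetric] 2[symmetric] 3[symmetric] by blast
qed

section \<open>The Lax operator\<close>

locale lax_potential =
  fixes u :: "real \<Rightarrow> complex" and s :: real
  assumes s: "s > 1 / 2" and Hu: "Hplus 1 u" and Wu: "L2w s u"
begin

lemma u_L2: "L2 u" using Hu by (simp add: Hplus_def)

lemma u_measurable[measurable]: "u \<in> borel_measurable borel" using u_L2 by (simp add: L2_def)

lemma u_integrable: "integrable lborel u" by (rule L2w_integrable[OF Wu s])

lemma u_bounded: obtains C where "AE x in lborel. cmod (u x) \<le> C"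
proof -
  obtain k C where k: "continuous_on UNIV k" "\<And>x. cmod (k x) \<le> C" "AE x in lborel. u x = k x"
    using Hplus_1_continuous_bounded[OF Hu] by blast
  have "AE x in lborel. cmod (u x) \<le> C" using k(3) by eventually_elim (simp add: k(2))
  then show ?thesis using that by blast
qed

lemma L2_u_bounded:
  assumes "g \<in> borel_measurable borel" "\<And>x. cmod (g x) \<le> B"
  shows "L2 (\<lambda>x. cnj (u x) * g x)"
  using L2_bounded_mult[OF L2_cnj[OF u_L2] assms(1), of B] assms(2) by (simp add: mult.commute)

text \<open>The growth allowed to \<open>h\<close> is compensated exactly by the weight available
  for \<open>u\<close>.\<close>

lemma L2_u_Linfw:
  assumes "Linfw (- s) h" shows "L2 (\<lambda>x. cnj (u x) * h x)"
proof -
  have [measurable]: "h \<in> borel_measurable borel" using assms by (simp add: Linfw_def)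
  obtain C where C: "AE x in lborel. jbr x powr (- s) * cmod (h x) \<le> C" using assms by (auto simp: Linfw_def)
  have "L2 (\<lambda>x. (complex_of_real (jbr x powr (- s)) * h x) * (cnj (complex_of_real (jbr x powr s) * u x)))"
    by (rule L2_bounded_mult[OF L2_cnj[OF L2w_L2[OF Wu]], where B = C]) (use C in \<open>auto simp: norm_mult\<close>)
  moreover have "(complex_of_real (jbr x powr (- s)) * h x) * (cnj (complex_of_real (jbr x powr s) * u x)) = cnj (u x) * h x" for x
  proof -
    have "jbr x powr (- s) * jbr x powr s = 1"
      using jbr_ge_1[of x] by (simp flip: powr_add)
    then have "complex_of_real (jbr x powr (- s)) * complex_of_real (jbr x powr s) = 1"
      by (metis of_real_1 of_real_mult)
    then show ?thesis by (simp add: mult_ac)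
  qed
  ultimately show ?thesis by (simp only:)
qed

section \<open>The equation in the gauge\<close>

definition V :: "real \<Rightarrow> (real \<Rightarrow> complex) \<Rightarrow> real \<Rightarrow> complex" where
  "V \<kappa> g x = \<i> * (u x * sz \<kappa> (\<lambda>y. cnj (u y) * g y) x)"

definition src :: "real \<Rightarrow> real \<Rightarrow> complex" where
  "src \<kappa> x = \<i> * (ee (- \<kappa>) x * u x)"

lemma V_integrable: "L2 (\<lambda>x. cnj (u x) * g x) \<Longrightarrow> integrable lborel (V \<kappa> g)"
  unfolding V_def[abs_def] by (intro integrable_mult_right L2_mult_integrable u_L2 sz_L2)

lemma src_integrable: "integrable lborel (src \<kappa>)"
  unfolding src_def[abs_def] by (intro integrable_mult_right integrable_ee u_integrable) auto

lemma V_lincomb: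
  assumes "L2 (\<lambda>x. cnj (u x) * g x)" "L2 (\<lambda>x. cnj (u x) * h x)"
  shows "AE x in lborel. V \<kappa> (\<lambda>x. g x + c * h x) x = V \<kappa> g x + c * V \<kappa> h x"
proof -
  have "(\<lambda>x. cnj (u x) * (g x + c * h x)) = (\<lambda>x. 1 * (cnj (u x) * g x) + c * (cnj (u x) * h x))"
    by (simp add: fun_eq_iff algebra_simps)
  with sz_lincomb[OF assms, of \<kappa> 1 c]
  have "AE x in lborel. sz \<kappa> (\<lambda>x. cnj (u x) * (g x + c * h x)) x = sz \<kappa> (\<lambda>x. cnj (u x) * g x) x + c * sz \<kappa> (\<lambda>x. cnj (u x) * h x) x"
    by simp
  then show ?thesis by eventually_elim (simp add: V_def algebra_simps)
qed

text \<open>After the gauge transformation \<open>g = e\<^sub>-\<^sub>\<kappa> h\<close> the equation \<open>L\<^sub>u h = \<kappa> h + c u\<close> reads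
  \<open>g' = V \<kappa> g + c src \<kappa>\<close>.\<close>

definition sol :: "real \<Rightarrow> complex \<Rightarrow> (real \<Rightarrow> complex) \<Rightarrow> bool" where
  "sol \<kappa> c g \<longleftrightarrow> L2 (\<lambda>x. cnj (u x) * g x) \<and> (\<exists>c0. \<forall>x. g x = c0 + prim (\<lambda>y. V \<kappa> g y + c * src \<kappa> y) x)"

lemma gauge_V:
  "\<i> * (ee (- \<kappa>) x * (u x * szego (\<lambda>y. cnj (u y) * h y) x)) = V \<kappa> (\<lambda>x. ee (- \<kappa>) x * h x) x"
proof -
  have "(\<lambda>y. ee \<kappa> y * (cnj (u y) * (ee (- \<kappa>) y * h y))) = (\<lambda>y. cnj (u y) * h y)"
    by (rule ext) (simp add: mult.left_commute[of _ "cnj (u _)"])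
  then show ?thesis by (simp add: V_def sz_def mult_ac)
qed

lemma L2_u_gauge: "L2 (\<lambda>x. cnj (u x) * h x) \<Longrightarrow> L2 (\<lambda>x. cnj (u x) * (ee \<kappa> x * h x))"
  using L2_ee[of "\<lambda>x. cnj (u x) * h x" \<kappa>] by (simp add: mult.left_commute)

text \<open>The gauge factor is moved onto the test function. Differentiating it there produces a
  multiple of \<kappa> that cancels the spectral term, and what remains states that the weak
  derivative is integrable; continuity then makes the solution a primitive.\<close>

lemma lax_eq_imp_sol:
  assumes h: "continuous_on UNIV h" "L2 (\<lambda>x. cnj (u x) * h x)"
    and lax: "lax_eq u h (\<lambda>x. complex_of_real \<kappa> * h x + c * u x)"
  shows "sol \<kappa> c (\<lambda>x. ee (- \<kappa>) x * h x)"
proof -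
  let ?g = "\<lambda>x. ee (- \<kappa>) x * h x"
  let ?w = "szego (\<lambda>y. cnj (u y) * h y)"
  let ?F = "\<lambda>y. V \<kappa> ?g y + c * src \<kappa> y"
  have gL: "L2 (\<lambda>x. cnj (u x) * ?g x)" by (rule L2_u_gauge[OF h(2)])
  have wL: "L2 ?w" by (rule szego_has_fourier(1)[OF h(2) has_fourier_fourier[OF h(2)]])
  have uw: "integrable lborel (\<lambda>x. u x * ?w x)" by (rule L2_mult_integrable[OF u_L2 wL])
  have Fi: "integrable lborel ?F" by (intro Bochner_Integration.integrable_add integrable_mult_right V_integrable src_integrable gL)
  have gc: "continuous_on UNIV ?g" by (intro continuous_intros h)
  have "\<exists>c0. \<forall>x. ?g x = c0 + prim ?F x"
  proof (rule weak_derivative_prim[OF gc Fi])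
    fix \<eta> assume \<eta>: "test_function \<eta>"
    let ?\<theta> = "\<lambda>x. ee (- \<kappa>) x * \<eta> x"
    have \<theta>: "test_function ?\<theta>" by (rule test_function_ee_mult[OF \<eta>])
    obtain B where B: "\<And>x. cmod (\<eta> x) \<le> B" using test_function_bounded[OF \<eta>] by blast
    have \<eta>m: "\<eta> \<in> borel_measurable borel" by (rule borel_measurable_continuous_onI[OF test_function_continuous[OF \<eta>]])
    have i1: "integrable lborel (\<lambda>x. ?g x * vderiv \<eta> x)" by (rule test_function_vderiv_integrable[OF \<eta> gc])
    have i2: "integrable lborel (\<lambda>x. ?g x * \<eta> x)" by (rule test_function_integrable[OF \<eta> gc])
    have i3: "integrable lborel (\<lambda>x. u x * ?w x * ?\<theta> x)"
      using integrable_bounded_mult[OF uw, of ?\<theta> B] B \<eta>m by (simp add: norm_mult mult_ac)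
    have i4: "integrable lborel (\<lambda>x. u x * ?\<theta> x)"
      using integrable_bounded_mult[OF u_integrable, of ?\<theta> B] B \<eta>m by (simp add: norm_mult mult_ac)
    have l: "(LINT x|lborel. \<i> * h x * vderiv ?\<theta> x) = \<i> * (LINT x|lborel. ?g x * vderiv \<eta> x) + \<kappa> * (LINT x|lborel. ?g x * \<eta> x)"
    proof -
      have "\<i> * h x * vderiv ?\<theta> x = \<i> * (?g x * vderiv \<eta> x) + \<kappa> * (?g x * \<eta> x)" for x
        unfolding vderiv_ee_mult[OF test_function_smooth[OF \<eta>]] by (simp add: algebra_simps)
      then show ?thesis using i1 i2 by simp
    qed
    have r: "(LINT x|lborel. (complex_of_real \<kappa> * h x + c * u x) * ?\<theta> x) = \<kappa> * (LINT x|lborel. ?g x * \<eta> x) + c * (LINT x|lborel. u x * ?\<theta> x)"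
    proof -
      have "(complex_of_real \<kappa> * h x + c * u x) * ?\<theta> x = \<kappa> * (?g x * \<eta> x) + c * (u x * ?\<theta> x)" for x
        by (simp add: algebra_simps)
      then show ?thesis using i2 i4 by simp
    qed
    have "?F x * \<eta> x = \<i> * (u x * ?w x * ?\<theta> x) + \<i> * c * (u x * ?\<theta> x)" for x
      unfolding gauge_V[symmetric] src_def by (simp add: algebra_simps)
    then have F: "(LINT x|lborel. ?F x * \<eta> x) = \<i> * (LINT x|lborel. u x * ?w x * ?\<theta> x) + \<i> * c * (LINT x|lborel. u x * ?\<theta> x)"
      using i3 i4 by simp
    have "\<i> * (LINT x|lborel. ?g x * vderiv \<eta> x) = (LINT x|lborel. u x * ?w x * ?\<theta> x) + c * (LINT x|lborel. u x * ?\<theta> x)"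
    proof -
      have gen: "p + q - r = q + t \<Longrightarrow> p = r + t" for p q r t :: complex by (simp add: algebra_simps)
      have "(LINT x|lborel. \<i> * h x * vderiv ?\<theta> x) - (LINT x|lborel. u x * ?w x * ?\<theta> x)
          = (LINT x|lborel. (complex_of_real \<kappa> * h x + c * u x) * ?\<theta> x)"
        using lax \<theta> unfolding lax_eq_def by blast
      then show ?thesis unfolding l r by (rule gen)
    qed
    then have "\<i> * (\<i> * (LINT x|lborel. ?g x * vderiv \<eta> x)) = (LINT x|lborel. ?F x * \<eta> x)"
      unfolding F by (simp add: distrib_left)
    then have "- (LINT x|lborel. ?g x * vderiv \<eta> x) = (LINT x|lborel. ?F x * \<eta> x)"
      by (simp flip: mult.assoc)
    then show "(LINT x|lborel. ?g x * vderiv \<eta> x) = - (LINT x|lborel. ?F x * \<eta> x)"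
      by (metis minus_minus)
  qed
  then show ?thesis using gL by (simp add: sol_def)
qed

text \<open>The constant in \<open>sol\<close> is the limit at -infinity, and adding the total
  integral gives the limit at +infinity. A prescribed limit at either end therefore turns the
  equation into an integral equation.\<close>

lemma sol_facts:
  assumes "sol \<kappa> c g"
  shows sol_L2: "L2 (\<lambda>x. cnj (u x) * g x)"
    and sol_integrable: "integrable lborel (\<lambda>y. V \<kappa> g y + c * src \<kappa> y)"
    and sol_continuous: "continuous_on UNIV g"
    and sol_bounded: "\<exists>B. \<forall>x. cmod (g x) \<le> B"
    and sol_at_bot_imp: "(g \<longlongrightarrow> a) at_bot \<Longrightarrow> g x = a + prim (\<lambda>y. V \<kappa> g y + c * src \<kappa> y) x"
    and sol_at_top_imp: "(g \<longlongrightarrow> a) at_top \<Longrightarrow> g x = a - (LINT y:{x<..}|lborel. V \<kappa> g y + c * src \<kappa> y)"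
    and sol_at_top: "(g \<longlongrightarrow> a) at_bot \<Longrightarrow> (g \<longlongrightarrow> a + (LINT y|lborel. V \<kappa> g y + c * src \<kappa> y)) at_top"
proof -
  show L: "L2 (\<lambda>x. cnj (u x) * g x)" using assms by (simp add: sol_def)
  show F: "integrable lborel (\<lambda>y. V \<kappa> g y + c * src \<kappa> y)"
    by (intro Bochner_Integration.integrable_add integrable_mult_right V_integrable src_integrable L)
  obtain c0 where c0: "\<And>x. g x = c0 + prim (\<lambda>y. V \<kappa> g y + c * src \<kappa> y) x" using assms by (auto simp: sol_def)
  have g: "g = (\<lambda>x. c0 + prim (\<lambda>y. V \<kappa> g y + c * src \<kappa> y) x)" using c0 by (rule ext)
  show "continuous_on UNIV g" by (subst g) (intro continuous_intros prim_continuous[OF F])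
  have "cmod (g x) \<le> cmod c0 + (LINT y|lborel. cmod (V \<kappa> g y + c * src \<kappa> y))" for x
    by (subst c0) (intro order_trans[OF norm_triangle_ineq] add_left_mono prim_bound[OF F])
  then show "\<exists>B. \<forall>x. cmod (g x) \<le> B" by blast
  have bot: "(g \<longlongrightarrow> c0 + 0) at_bot" by (subst g) (intro tendsto_intros prim_at_bot[OF F])
  have top: "(g \<longlongrightarrow> c0 + (LINT y|lborel. V \<kappa> g y + c * src \<kappa> y)) at_top"
    by (subst g) (intro tendsto_intros prim_at_top[OF F])
  show "g x = a + prim (\<lambda>y. V \<kappa> g y + c * src \<kappa> y) x" if "(g \<longlongrightarrow> a) at_bot"
    using tendsto_unique[OF trivial_limit_at_bot_linorder that bot] c0 by simp
  show "(g \<longlongrightarrow> a + (LINT y|lborel. V \<kappa> g y + c * src \<kappa> y)) at_top" if "(g \<longlongrightarrow> a) at_bot"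
    using tendsto_unique[OF trivial_limit_at_bot_linorder that bot] top by simp
  show "g x = a - (LINT y:{x<..}|lborel. V \<kappa> g y + c * src \<kappa> y)" if "(g \<longlongrightarrow> a) at_top"
    using tendsto_unique[OF trivial_limit_at_top_linorder that top] c0[of x] prim_tail[OF F, of x]
    by (simp add: algebra_simps)
qed

lemma sol_add:
  assumes g: "sol \<kappa> a g" and h: "sol \<kappa> b h" shows "sol \<kappa> (a + c * b) (\<lambda>x. g x + c * h x)"
proof -
  note gL = sol_L2[OF g] and hL = sol_L2[OF h]
  have L: "L2 (\<lambda>x. cnj (u x) * (g x + c * h x))"
    using L2_add[OF gL L2_cmult[OF hL, of c]] by (simp add: algebra_simps)
  obtain c1 c2 where c: "\<And>x. g x = c1 + prim (\<lambda>y. V \<kappa> g y + a * src \<kappa> y) x" "\<And>x. h x = c2 + prim (\<lambda>y. V \<kappa> h y + b * src \<kappa> y) x"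
    using g h by (auto simp: sol_def)
  let ?G = "\<lambda>y. V \<kappa> g y + a * src \<kappa> y" and ?H = "\<lambda>y. V \<kappa> h y + b * src \<kappa> y"
  have "prim (\<lambda>y. ?G y + c * ?H y) = prim (\<lambda>y. V \<kappa> (\<lambda>x. g x + c * h x) y + (a + c * b) * src \<kappa> y)"
  proof (rule prim_cong_AE)
    show "AE y in lborel. ?G y + c * ?H y = V \<kappa> (\<lambda>x. g x + c * h x) y + (a + c * b) * src \<kappa> y"
      using V_lincomb[OF gL hL, of \<kappa> c] by eventually_elim (simp add: algebra_simps)
  qed (intro Bochner_Integration.integrable_add integrable_mult_right V_integrable src_integrable gL hL L)+
  moreover have "g x + c * h x = (c1 + c * c2) + prim (\<lambda>y. ?G y + c * ?H y) x" for x
    unfolding prim_add[OF sol_integrable[OF g] sol_integrable[OF h]] using c(1)[of x] c(2)[of x]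
    by (simp add: distrib_left)
  ultimately show ?thesis using L by (auto simp: sol_def)
qed

section \<open>Uniqueness of solutions vanishing at one end\<close>

text \<open>The factor \<open>u\<close> outside the projector joins \<open>cnj g\<close> to form the
  conjugate of the argument of the projector, and an orthogonal projection pairs with its argument
  to the square of its norm. The value is purely imaginary, so it contributes nothing to
  \<open>prim_energy\<close>.\<close>

lemma V_l2ip: assumes "L2 (\<lambda>x. cnj (u x) * g x)"
  shows "(LINT x|lborel. V \<kappa> g x * cnj (g x)) = \<i> * complex_of_real ((l2n (sz \<kappa> (\<lambda>x. cnj (u x) * g x)))\<^sup>2)"
proof -
  let ?f = "\<lambda>x. cnj (u x) * g x"
  have "(LINT x|lborel. V \<kappa> g x * cnj (g x)) = (LINT x|lborel. \<i> * (sz \<kappa> ?f x * cnj (?f x)))"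
    by (simp add: V_def mult_ac)
  also have "\<dots> = \<i> * l2ip (sz \<kappa> ?f) ?f" by (simp only: integral_mult_right_zero l2ip_def)
  finally show ?thesis using sz_l2ip_self[OF assms] by simp
qed

lemma V_L2: assumes "L2 (\<lambda>x. cnj (u x) * g x)" shows "L2 (V \<kappa> g)"
proof -
  obtain C where "AE x in lborel. cmod (u x) \<le> C" by (rule u_bounded)
  then have "L2 (\<lambda>x. u x * sz \<kappa> (\<lambda>y. cnj (u y) * g y) x)"
    by (intro L2_bounded_mult[OF sz_L2[OF assms], where B = C]) auto
  then show ?thesis unfolding V_def[abs_def] by (rule L2_cmult)
qed

text \<open>Undoing the gauge shifts frequencies by \<kappa> and leaves the product of
  \<open>u\<close> with a projected function, two factors with nonnegative frequencies.\<close>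

lemma V_ft_support:
  assumes g: "L2 (\<lambda>x. cnj (u x) * g x)" and "\<xi> < - \<kappa>"
  shows "ft (V \<kappa> g) \<xi> = 0"
proof -
  let ?f = "\<lambda>x. ee \<kappa> x * (cnj (u x) * g x)"
  have fL: "L2 ?f" by (rule L2_ee[OF g])
  note w = szego_has_fourier[OF fL has_fourier_fourier[OF fL]]
  have "ft (\<lambda>x. u x * szego ?f x) (\<xi> + \<kappa>) = 0"
    by (rule fourier_product_support[OF u_L2 has_fourier_fourier[OF u_L2] _ w])
      (use Hu \<open>\<xi> < - \<kappa>\<close> in \<open>auto simp: Hplus_def\<close>)
  moreover have "V \<kappa> g x * ee (- \<xi>) x = \<i> * ((u x * szego ?f x) * ee (- (\<xi> + \<kappa>)) x)" for x
    using ee_add[of "- \<kappa>" x "- \<xi>"] by (simp add: V_def sz_def mult_ac add.commute)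
  ultimately show ?thesis by (simp add: ft_def)
qed

text \<open>The way back from the gauge for the homogeneous equation, which is the form of an
  eigenvalue equation in \<open>sigma_pp\<close>.\<close>

lemma sol_imp_lax_eq:
  assumes g: "sol \<kappa> 0 g"
  shows "lax_eq u (\<lambda>x. ee \<kappa> x * g x) (\<lambda>x. complex_of_real \<kappa> * (ee \<kappa> x * g x))"
  unfolding lax_eq_def
proof (intro allI impI)
  fix \<eta> assume \<eta>: "test_function \<eta>"
  let ?h = "\<lambda>x. ee \<kappa> x * g x"
  let ?\<theta> = "\<lambda>x. ee \<kappa> x * \<eta> x"
  have \<theta>: "test_function ?\<theta>" by (rule test_function_ee_mult[OF \<eta>])
  have gc: "continuous_on UNIV g" by (rule sol_continuous[OF g])
  have hc: "continuous_on UNIV ?h" by (intro continuous_intros gc)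
  obtain c0 where c0: "\<And>x. g x = c0 + prim (V \<kappa> g) x" using g by (auto simp: sol_def)
  have i1: "integrable lborel (\<lambda>x. ?h x * vderiv \<eta> x)" by (rule test_function_vderiv_integrable[OF \<eta> hc])
  have i2: "integrable lborel (\<lambda>x. ?h x * \<eta> x)" by (rule test_function_integrable[OF \<eta> hc])
  have "(LINT x|lborel. g x * vderiv ?\<theta> x) = - (LINT x|lborel. V \<kappa> g x * ?\<theta> x)"
    using prim_weak_derivative[OF V_integrable[OF sol_L2[OF g], of \<kappa>] \<theta>, of c0] by (simp only: c0[symmetric])
  moreover have "g x * vderiv ?\<theta> x = ?h x * vderiv \<eta> x + \<i> * \<kappa> * (?h x * \<eta> x)" for x
    unfolding vderiv_ee_mult[OF test_function_smooth[OF \<eta>]] by (simp add: algebra_simps)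
  moreover have "V \<kappa> g x * ?\<theta> x = \<i> * (u x * szego (\<lambda>y. cnj (u y) * ?h y) x * \<eta> x)" for x
  proof -
    have "(\<lambda>y. ee \<kappa> y * (cnj (u y) * g y)) = (\<lambda>y. cnj (u y) * ?h y)" by (simp add: fun_eq_iff)
    then show ?thesis by (simp add: V_def sz_def mult_ac)
  qed
  ultimately have "(LINT x|lborel. ?h x * vderiv \<eta> x) + \<i> * \<kappa> * (LINT x|lborel. ?h x * \<eta> x)
      = - (\<i> * (LINT x|lborel. u x * szego (\<lambda>y. cnj (u y) * ?h y) x * \<eta> x))"
    using i1 i2 by simp
  from arg_cong[OF this, of "\<lambda>z. \<i> * z"]
  have e: "\<i> * (LINT x|lborel. ?h x * vderiv \<eta> x) - \<kappa> * (LINT x|lborel. ?h x * \<eta> x)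
      = (LINT x|lborel. u x * szego (\<lambda>y. cnj (u y) * ?h y) x * \<eta> x)"
    by (simp add: distrib_left flip: mult.assoc)
  have gen: "p - q = r \<Longrightarrow> p - r = q" for p q r :: complex by (simp add: algebra_simps)
  have "(LINT x|lborel. \<i> * ?h x * vderiv \<eta> x) = \<i> * (LINT x|lborel. ?h x * vderiv \<eta> x)"
    by (simp only: mult.assoc integral_mult_right_zero)
  moreover have "(LINT x|lborel. complex_of_real \<kappa> * ?h x * \<eta> x) = \<kappa> * (LINT x|lborel. ?h x * \<eta> x)"
    by (simp only: mult.assoc integral_mult_right_zero)
  ultimately show "(LINT x|lborel. \<i> * ?h x * vderiv \<eta> x) - (LINT x|lborel. u x * szego (\<lambda>y. cnj (u y) * ?h y) x * \<eta> x)
      = (LINT x|lborel. complex_of_real \<kappa> * ?h x * \<eta> x)"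
    using gen[OF e] by simp
qed

text \<open>The outer factor \<open>u\<close> carries the whole weight; the projected factor is only
  known to be in L2.\<close>

lemma V_weight_integrable:
  assumes "L2 (\<lambda>x. cnj (u x) * g x)"
  shows "integrable lborel (\<lambda>x. jbr x powr s * cmod (V \<kappa> g x))"
proof -
  have "integrable lborel (\<lambda>x. (complex_of_real (jbr x powr s) * u x) * sz \<kappa> (\<lambda>y. cnj (u y) * g y) x)"
    by (rule L2_mult_integrable[OF L2w_L2[OF Wu] sz_L2[OF assms]])
  from integrable_norm[OF this] show ?thesis by (simp add: norm_mult V_def mult_ac)
qed

lemma jbr_mono: "\<bar>x\<bar> \<le> \<bar>y\<bar> \<Longrightarrow> jbr x \<le> jbr y"
  by (simp add: jbr_def abs_le_square_iff)

text \<open>A solution vanishing at both ends inherits the weight of \<open>u\<close>, hence decays like \<open>\<langle>x\<rangle>\<^sup>-\<^sup>s\<close>.\<close>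

lemma sol_decay_L2:
  assumes g: "sol \<kappa> 0 g" and z: "(g \<longlongrightarrow> 0) at_bot" "(g \<longlongrightarrow> 0) at_top"
  shows "L2 g"
proof -
  let ?V = "V \<kappa> g"
  define M where "M = (LINT y|lborel. jbr y powr s * cmod (?V y))"
  note Vi = V_integrable[OF sol_L2[OF g], of \<kappa>]
  have part: "cmod (LINT y:S|lborel. ?V y) \<le> jbr x powr (- s) * M"
    if S: "S \<in> sets borel" "\<And>y. y \<in> S \<Longrightarrow> \<bar>x\<bar> \<le> \<bar>y\<bar>" for S x
  proof -
    have "cmod (LINT y:S|lborel. ?V y) \<le> (LINT y|lborel. cmod (indicator S y *\<^sub>R ?V y))"
      unfolding set_lebesgue_integral_def by (rule integral_norm_bound)
    also have "\<dots> \<le> (LINT y|lborel. jbr x powr (- s) * (jbr y powr s * cmod (?V y)))"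
    proof (rule integral_mono)
      show "integrable lborel (\<lambda>y. cmod (indicator S y *\<^sub>R ?V y))"
        by (intro integrable_norm integrable_on_set Vi S)
      show "integrable lborel (\<lambda>y. jbr x powr (- s) * (jbr y powr s * cmod (?V y)))"
        by (intro integrable_mult_right V_weight_integrable sol_L2[OF g])
      fix y
      show "cmod (indicator S y *\<^sub>R ?V y) \<le> jbr x powr (- s) * (jbr y powr s * cmod (?V y))"
      proof (cases "y \<in> S")
        case True
        have "1 = jbr x powr (- s) * jbr x powr s" using jbr_ge_1[of x] by (simp flip: powr_add)
        also have "\<dots> \<le> jbr x powr (- s) * jbr y powr s"
          using s jbr_ge_1[of x] jbr_mono[OF S(2)[OF True]] by (intro mult_left_mono powr_mono2) auto
        finally have "1 * cmod (?V y) \<le> (jbr x powr (- s) * jbr y powr s) * cmod (?V y)"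
          by (rule mult_right_mono) simp
        then show ?thesis using True by (simp add: mult.assoc)
      qed simp
    qed
    also have "\<dots> = jbr x powr (- s) * M" by (simp only: integral_mult_right_zero M_def)
    finally show ?thesis .
  qed
  \<comment> \<open>Each half-line is reached from the end that makes |y| \<ge> |x| on the domain of
    integration: from the left for x \<le> 0, from the right otherwise.\<close>
  have le: "cmod (g x) \<le> jbr x powr (- s) * M" for x
  proof (cases "x \<le> 0")
    case True
    then have "cmod (LINT y:{..x}|lborel. ?V y) \<le> jbr x powr (- s) * M" by (intro part) auto
    then show ?thesis using sol_at_bot_imp[OF g z(1), of x] by (simp add: prim_def)
  next
    case False
    then have "cmod (LINT y:{x<..}|lborel. ?V y) \<le> jbr x powr (- s) * M" by (intro part) auto
    then show ?thesis using sol_at_top_imp[OF g z(2), of x] by simp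
  qed
  show "L2 g"
  proof (rule L2_bound)
    show "g \<in> borel_measurable borel" by (rule borel_measurable_continuous_onI[OF sol_continuous[OF g]])
    show "integrable lborel (\<lambda>x. (jbr x powr (- s) * M)\<^sup>2)"
      using integrable_inverse_jbr[OF s] by (simp add: power_mult_distrib jbr_powr_sq)
    show "AE x in lborel. (cmod (g x))\<^sup>2 \<le> (jbr x powr (- s) * M)\<^sup>2"
      using le by (auto intro!: power_mono)
  qed
qed

text \<open>What has to be checked is that the ungauged function belongs to the domain of the
  operator: square integrability comes from the decay, the frequency support and the extra
  derivative from \<open>prim_fourier\<close> applied to g.\<close>

lemma sol_zero:
  assumes \<kappa>: "\<kappa> > 0" "\<kappa> \<notin> sigma_pp u" and g: "sol \<kappa> 0 g"
    and z: "(g \<longlongrightarrow> 0) at_bot \<or> (g \<longlongrightarrow> 0) at_top"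
  shows "g x = 0"
proof -
  let ?V = "V \<kappa> g"
  note gL = sol_L2[OF g]
  note Vi = V_integrable[OF gL, of \<kappa>]
  obtain c0 where c0: "\<And>x. g x = c0 + prim ?V x" using g by (auto simp: sol_def)
  have gp: "g = (\<lambda>x. c0 + prim ?V x)" using c0 by (rule ext)
  define I where "I = (LINT x|lborel. ?V x)"
  have bot: "(g \<longlongrightarrow> c0 + 0) at_bot" by (subst gp) (intro tendsto_intros prim_at_bot[OF Vi])
  have top: "(g \<longlongrightarrow> c0 + I) at_top" unfolding I_def by (subst gp) (intro tendsto_intros prim_at_top[OF Vi])
  have "(cmod (c0 + I))\<^sup>2 = (cmod c0)\<^sup>2"
    using prim_energy[OF Vi c0] unfolding V_l2ip[OF gL] I_def by simp
  moreover from z have "c0 = 0 \<or> c0 + I = 0"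
  proof
    assume "(g \<longlongrightarrow> 0) at_bot"
    from tendsto_unique[OF trivial_limit_at_bot_linorder this bot] show ?thesis by simp
  next
    assume "(g \<longlongrightarrow> 0) at_top"
    from tendsto_unique[OF trivial_limit_at_top_linorder this top] show ?thesis by simp
  qed
  \<comment> \<open>The energy identity equates the moduli of the two limits, so if one vanishes
    both do.\<close>
  ultimately have c00: "c0 = 0" and I0: "I = 0" by auto
  have gpV: "g = prim ?V" using gp c00 by simp
  have z': "(g \<longlongrightarrow> 0) at_bot" "(g \<longlongrightarrow> 0) at_top" using bot top c00 I0 by simp_all
  have gL2: "L2 g" by (rule sol_decay_L2[OF g z'])
  obtain G where G: "has_fourier g G" using has_fourier_exists[OF gL2] by blast
  have GL: "L2 G" using G has_fourier_L2 by blast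
  have AE1: "AE \<xi> in lborel. \<i> * complex_of_real \<xi> * G \<xi> = ft ?V \<xi>"
    using prim_fourier[OF Vi I0[unfolded I_def]] gL2 G unfolding gpV[symmetric] by blast
  have VL: "L2 (ft ?V)" by (rule ft_L2[OF Vi V_L2[OF gL]])
  let ?h = "\<lambda>x. ee \<kappa> x * g x"
  have hL: "L2 ?h" by (rule L2_ee[OF gL2])
  have hF: "has_fourier ?h (\<lambda>\<xi>. G (\<xi> - \<kappa>))" by (rule has_fourier_modulate[OF gL2 G])
  let ?H = "fourier ?h"
  have Heq: "AE \<xi> in lborel. ?H \<xi> = G (\<xi> - \<kappa>)"
    by (rule has_fourier_unique[OF hL has_fourier_fourier[OF hL] hF])
  have AE2: "AE \<xi> in lborel. \<i> * complex_of_real (\<xi> - \<kappa>) * G (\<xi> - \<kappa>) = ft ?V (\<xi> - \<kappa>)"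
  proof -
    have "AE \<xi> in distr lborel borel (\<lambda>\<xi>. - \<kappa> + 1 * \<xi>). \<i> * complex_of_real \<xi> * G \<xi> = ft ?V \<xi>"
    proof -
      have "distr lborel borel (\<lambda>\<xi>. - \<kappa> + 1 * \<xi>) = lborel"
        using lborel_real_affine[of 1 "- \<kappa>"] by (simp add: density_1)
      then show ?thesis using AE1 by (simp only:)
    qed
    moreover have [measurable]: "G \<in> borel_measurable borel" "ft ?V \<in> borel_measurable borel"
      using GL VL by (auto simp: L2_def)
    ultimately show ?thesis by (subst (asm) AE_distr_iff) (auto simp: pred_def)
  qed
  have "Hplus 1 ?h"
    unfolding Hplus_def
  proof (intro conjI hL)
    show "AE \<xi> in lborel. \<xi> < 0 \<longrightarrow> ?H \<xi> = 0"
      using Heq AE2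
    proof eventually_elim
      case (elim \<xi>)
      show ?case
      proof
        assume "\<xi> < 0"
        then have "ft ?V (\<xi> - \<kappa>) = 0" by (intro V_ft_support[OF gL]) simp
        \<comment> \<open>For \<xi> < 0 the factor \<xi> - \<kappa> is nonzero because \<kappa> > 0,
          so the vanishing of the right-hand side passes to the transform.\<close>
        then show "?H \<xi> = 0" using elim \<open>\<xi> < 0\<close> \<kappa>(1) by simp
      qed
    qed
    have HL: "L2 ?H" by (rule fourier_L2[OF hL])
    \<comment> \<open>By the transformed equation this is \<xi> times \<open>?H \<xi>\<close>;
      written in this way it is visibly square integrable.\<close>
    let ?K = "\<lambda>\<xi>. - \<i> * ft ?V (\<xi> - \<kappa>) + \<kappa> * ?H \<xi>"
    have KL: "L2 ?K" by (intro L2_add L2_cmult L2_translate VL HL)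
    have [measurable]: "?H \<in> borel_measurable borel" using HL by (simp add: L2_def)
    show "L2 (\<lambda>\<xi>. complex_of_real ((1 + \<xi>\<^sup>2) powr (1 / 2)) * ?H \<xi>)"
    proof (rule L2_bound)
      show "integrable lborel (\<lambda>\<xi>. (cmod (?H \<xi>))\<^sup>2 + (cmod (?K \<xi>))\<^sup>2)"
        by (intro Bochner_Integration.integrable_add L2_sq HL KL)
      show "AE \<xi> in lborel. (cmod (complex_of_real ((1 + \<xi>\<^sup>2) powr (1 / 2)) * ?H \<xi>))\<^sup>2 \<le> (cmod (?H \<xi>))\<^sup>2 + (cmod (?K \<xi>))\<^sup>2"
        using Heq AE2
      proof eventually_elim
        case (elim \<xi>)
        have "?K \<xi> = complex_of_real \<xi> * ?H \<xi>"
          using elim(1) unfolding elim(2)[symmetric] by (simp add: algebra_simps)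
        then have "(cmod (?K \<xi>))\<^sup>2 = \<xi>\<^sup>2 * (cmod (?H \<xi>))\<^sup>2" by (simp add: norm_mult power_mult_distrib)
        moreover have "(cmod (complex_of_real ((1 + \<xi>\<^sup>2) powr (1 / 2)) * ?H \<xi>))\<^sup>2 = (1 + \<xi>\<^sup>2) * (cmod (?H \<xi>))\<^sup>2"
          by (simp add: norm_mult power_mult_distrib powr_half_sqrt)
        ultimately show ?case by (simp add: distrib_right)
      qed
    qed auto
  qed
  then have "AE x in lborel. ?h x = 0"
    using \<kappa>(2) sol_imp_lax_eq[OF g] unfolding sigma_pp_def by blast
  then have "AE x in lborel. g x = 0"
    by eventually_elim (metis ee_cancel(4) mult_zero_right)
  then show ?thesis by (rule continuous_AE_zero[OF sol_continuous[OF g]])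
qed

subsection \<open>The integral operator\<close>

abbreviation Nu :: real where "Nu \<equiv> LINT y|lborel. cmod (u y)"

text \<open>The sign and the half-line make this the primitive of \<open>V \<kappa> g\<close> that
  vanishes at +infinity; \<open>tsrc\<close> below is its counterpart for the source term.\<close>

definition T :: "real \<Rightarrow> (real \<Rightarrow> complex) \<Rightarrow> real \<Rightarrow> complex" where
  "T \<kappa> g x = - (LINT y:{x<..}|lborel. V \<kappa> g y)"

definition tsrc :: "real \<Rightarrow> real \<Rightarrow> complex" where
  "tsrc \<kappa> x = - (LINT y:{x<..}|lborel. src \<kappa> y)"

text \<open>Bounds the error of linearising \<open>T\<close> in the spectral parameter.\<close>

definition omega :: "real \<Rightarrow> real" where
  "omega \<delta> = (LINT x|lborel. cmod (u x) * (LINT y|lborel. cmod (u y) * min 2 (\<bar>x - y\<bar> * \<delta>)))"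

lemma min2_bound: "0 \<le> \<delta> \<Longrightarrow> \<bar>min 2 (\<bar>x - y\<bar> * \<delta>)\<bar> \<le> (2::real)"
  by (auto simp: min_def)

lemma omega_kernel:
  assumes "0 \<le> \<delta>"
  shows "integrable lborel (\<lambda>y. cmod (u y) * min 2 (\<bar>x - y\<bar> * \<delta>))"
    and "(\<lambda>x. LINT y|lborel. cmod (u y) * min 2 (\<bar>x - y\<bar> * \<delta>)) \<in> borel_measurable borel"
    and "0 \<le> (LINT y|lborel. cmod (u y) * min 2 (\<bar>x - y\<bar> * \<delta>))"
    and "(LINT y|lborel. cmod (u y) * min 2 (\<bar>x - y\<bar> * \<delta>)) \<le> 2 * Nu"
    and "integrable lborel (\<lambda>x. cmod (u x) * (LINT y|lborel. cmod (u y) * min 2 (\<bar>x - y\<bar> * \<delta>)))"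
proof -
  let ?w = "\<lambda>x. LINT y|lborel. cmod (u y) * min 2 (\<bar>x - y\<bar> * \<delta>)"
  have un: "integrable lborel (\<lambda>y. cmod (u y))" by (rule integrable_norm[OF u_integrable])
  show i: "integrable lborel (\<lambda>y. cmod (u y) * min 2 (\<bar>x - y\<bar> * \<delta>))" for x
  proof (rule Bochner_Integration.integrable_bound[where f = "\<lambda>y. 2 * cmod (u y)"])
    show "AE y in lborel. norm (cmod (u y) * min 2 (\<bar>x - y\<bar> * \<delta>)) \<le> norm (2 * cmod (u y))"
      using mult_left_mono[OF min2_bound[OF assms] norm_ge_zero[of "u _"]] by (auto simp: abs_mult mult.commute)
  qed (use un in auto)
  show m: "?w \<in> borel_measurable borel" by measurable
  show w0: "0 \<le> ?w x" for x using assms by (intro integral_nonneg_AE AE_I2) auto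
  show w2: "?w x \<le> 2 * Nu" for x
  proof -
    have "?w x \<le> (LINT y|lborel. cmod (u y) * 2)"
      by (rule integral_mono[OF i]) (use un in \<open>auto intro!: mult_left_mono\<close>)
    then show ?thesis by (simp add: mult.commute)
  qed
  show "integrable lborel (\<lambda>x. cmod (u x) * ?w x)"
  proof (rule Bochner_Integration.integrable_bound[where f = "\<lambda>x. cmod (u x) * (2 * Nu)"])
    show "AE x in lborel. norm (cmod (u x) * ?w x) \<le> norm (cmod (u x) * (2 * Nu))"
      using w0 w2 by (auto simp: abs_mult intro!: mult_left_mono AE_I2)
  qed (use un m in auto)
qed

text \<open>Dominated convergence twice, in the inner and then in the outer variable; the cap by 2
  supplies the majorants from the integrability of \<open>u\<close>. No rate is obtained.\<close>

lemma omega_tendsto: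
  assumes \<delta>: "\<delta> \<longlonglongrightarrow> 0" "\<And>n. 0 \<le> \<delta> n"
  shows "(\<lambda>n. omega (\<delta> n)) \<longlonglongrightarrow> 0"
proof -
  have un: "integrable lborel (\<lambda>y. cmod (u y))" by (rule integrable_norm[OF u_integrable])
  have inner: "(\<lambda>n. LINT y|lborel. cmod (u y) * min 2 (\<bar>x - y\<bar> * \<delta> n)) \<longlonglongrightarrow> (LINT y|lborel. cmod (u y) * min 2 (\<bar>x - y\<bar> * 0))" for x
  proof (rule integral_dominated_convergence[where w = "\<lambda>y. 2 * cmod (u y)"])
    show "AE y in lborel. (\<lambda>n. cmod (u y) * min 2 (\<bar>x - y\<bar> * \<delta> n)) \<longlonglongrightarrow> cmod (u y) * min 2 (\<bar>x - y\<bar> * 0)"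
      by (intro AE_I2 tendsto_intros \<delta>)
    show "AE y in lborel. norm (cmod (u y) * min 2 (\<bar>x - y\<bar> * \<delta> n)) \<le> 2 * cmod (u y)" for n
      using mult_left_mono[OF min2_bound[OF \<delta>(2)] norm_ge_zero[of "u _"]] by (auto simp: abs_mult mult.commute)
  qed (use un in auto)
  have "(\<lambda>n. LINT x|lborel. cmod (u x) * (LINT y|lborel. cmod (u y) * min 2 (\<bar>x - y\<bar> * \<delta> n))) \<longlonglongrightarrow> (LINT x|lborel. cmod (u x) * 0)"
  proof (rule integral_dominated_convergence[where w = "\<lambda>x. cmod (u x) * (2 * Nu)"])
    show "AE x in lborel. (\<lambda>n. cmod (u x) * (LINT y|lborel. cmod (u y) * min 2 (\<bar>x - y\<bar> * \<delta> n))) \<longlonglongrightarrow> cmod (u x) * 0"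
      using inner by (intro AE_I2 tendsto_intros) simp
    show "AE x in lborel. norm (cmod (u x) * (LINT y|lborel. cmod (u y) * min 2 (\<bar>x - y\<bar> * \<delta> n))) \<le> cmod (u x) * (2 * Nu)" for n
      using omega_kernel(3,4)[OF \<delta>(2)] by (auto simp: abs_mult intro!: mult_left_mono AE_I2)
  qed (use un omega_kernel(2)[OF \<delta>(2)] in auto)
  then show ?thesis by (simp add: omega_def)
qed

lemma tail_norm_le:
  fixes F :: "real \<Rightarrow> complex" and k :: "real \<Rightarrow> real"
  assumes "integrable lborel F" "integrable lborel k" "AE y in lborel. cmod (F y) \<le> k y"
  shows "cmod (LINT y:{x<..}|lborel. F y) \<le> (LINT y|lborel. k y)"
  unfolding set_lebesgue_integral_def
proof (rule order_trans[OF integral_norm_bound], rule integral_mono_AE)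
  show "integrable lborel (\<lambda>y. cmod (indicator {x<..} y *\<^sub>R F y))"
    by (intro integrable_norm integrable_on_set assms) auto
  show "AE y in lborel. cmod (indicator {x<..} y *\<^sub>R F y) \<le> k y"
    using assms(3)
  proof eventually_elim
    case (elim y)
    then show ?case using norm_ge_zero[of "F y"] by (auto simp: indicator_def simp del: norm_ge_zero)
  qed
qed fact

text \<open>Holds at every x although \<open>V_lincomb\<close> holds only almost everywhere: the
  integral absorbs the exceptional null set.\<close>

lemma T_lincomb:
  assumes g: "L2 (\<lambda>x. cnj (u x) * g x)" and h: "L2 (\<lambda>x. cnj (u x) * h x)"
  shows "T \<kappa> (\<lambda>x. g x + c * h x) x = T \<kappa> g x + c * T \<kappa> h x"
proof -
  have L: "L2 (\<lambda>x. cnj (u x) * (g x + c * h x))"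
    using L2_add[OF g L2_cmult[OF h, of c]] by (simp add: algebra_simps)
  let ?I = "\<lambda>y. indicator {x<..} y :: real"
  have ig: "integrable lborel (\<lambda>y. ?I y *\<^sub>R V \<kappa> g y)" "integrable lborel (\<lambda>y. ?I y *\<^sub>R V \<kappa> h y)"
    "integrable lborel (\<lambda>y. ?I y *\<^sub>R V \<kappa> (\<lambda>x. g x + c * h x) y)"
    by (intro integrable_on_set V_integrable g h L; simp)+
  have "(LINT y:{x<..}|lborel. V \<kappa> (\<lambda>x. g x + c * h x) y) = (LINT y|lborel. ?I y *\<^sub>R V \<kappa> g y + c * (?I y *\<^sub>R V \<kappa> h y))"
    unfolding set_lebesgue_integral_def
  proof (rule integral_cong_AE)
    show "AE y in lborel. ?I y *\<^sub>R V \<kappa> (\<lambda>x. g x + c * h x) y = ?I y *\<^sub>R V \<kappa> g y + c * (?I y *\<^sub>R V \<kappa> h y)"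
      using V_lincomb[OF g h, of \<kappa> c] by eventually_elim (simp add: scaleR_add_right)
    show "(\<lambda>y. ?I y *\<^sub>R V \<kappa> (\<lambda>x. g x + c * h x) y) \<in> borel_measurable lborel"
      by (rule borel_measurable_integrable[OF ig(3)])
    show "(\<lambda>y. ?I y *\<^sub>R V \<kappa> g y + c * (?I y *\<^sub>R V \<kappa> h y)) \<in> borel_measurable lborel"
      by (intro borel_measurable_integrable Bochner_Integration.integrable_add integrable_mult_right ig)
  qed
  also have "\<dots> = (LINT y|lborel. ?I y *\<^sub>R V \<kappa> g y) + (LINT y|lborel. c * (?I y *\<^sub>R V \<kappa> h y))"
    by (rule Bochner_Integration.integral_add) (intro integrable_mult_right ig)+
  finally show ?thesis unfolding T_def set_lebesgue_integral_def integral_mult_right_zero by simp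
qed

text \<open>A sup norm is controlled by an L2 norm with weight |u|^2. Pointwise convergence of
  uniformly bounded functions thereby becomes uniform convergence of their images.\<close>

lemma T_bound:
  assumes g: "L2 (\<lambda>x. cnj (u x) * g x)"
  shows "cmod (T \<kappa> g x) \<le> l2n u * l2n (\<lambda>x. cnj (u x) * g x)"
proof -
  have "cmod (T \<kappa> g x) \<le> (LINT y|lborel. cmod (V \<kappa> g y))"
    unfolding T_def norm_minus_cancel
    by (rule tail_norm_le) (use V_integrable[OF g] in auto)
  also have "\<dots> = (LINT y|lborel. cmod (u y * sz \<kappa> (\<lambda>x. cnj (u x) * g x) y))" by (simp add: V_def norm_mult)
  also have "\<dots> \<le> l2n u * l2n (sz \<kappa> (\<lambda>x. cnj (u x) * g x))"
    by (rule L2_Cauchy_Schwarz[OF u_L2 sz_L2[OF g]])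
  also have "\<dots> \<le> l2n u * l2n (\<lambda>x. cnj (u x) * g x)"
    by (intro mult_left_mono sz_le g) simp
  finally show ?thesis .
qed

lemma u_mult_bounded:
  assumes "g \<in> borel_measurable borel" "\<And>x. cmod (g x) \<le> B"
  shows "integrable lborel (\<lambda>x. cnj (u x) * g x)" "(LINT y|lborel. cmod (cnj (u y) * g y)) \<le> B * Nu"
    "l2n (\<lambda>x. cnj (u x) * g x) \<le> B * l2n u"
proof -
  have B: "0 \<le> B" using assms(2)[of 0] norm_ge_zero order_trans by blast
  have un: "integrable lborel (\<lambda>y. cmod (u y))" by (rule integrable_norm[OF u_integrable])
  show i: "integrable lborel (\<lambda>x. cnj (u x) * g x)"
    using integrable_bounded_mult[OF integrable_cnj[OF u_integrable] assms] by (simp add: mult.commute)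
  have "(LINT y|lborel. cmod (cnj (u y) * g y)) \<le> (LINT y|lborel. B * cmod (u y))"
    by (rule integral_mono[OF integrable_norm[OF i]])
      (use un assms(2) mult_left_mono[OF assms(2) norm_ge_zero[of "u _"]] in \<open>auto simp: norm_mult mult.commute\<close>)
  then show "(LINT y|lborel. cmod (cnj (u y) * g y)) \<le> B * Nu" by simp
  have "l2n (\<lambda>x. cnj (u x) * g x) \<le> l2n (\<lambda>x. complex_of_real B * u x)"
    unfolding l2n_def
  proof (intro real_sqrt_le_mono integral_mono L2_sq L2_u_bounded[OF assms] L2_cmult u_L2)
    fix x
    show "(cmod (cnj (u x) * g x))\<^sup>2 \<le> (cmod (complex_of_real B * u x))\<^sup>2"
      using mult_left_mono[OF assms(2)[of x] norm_ge_zero[of "u x"]] B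
      by (intro power_mono) (auto simp: norm_mult mult.commute)
  qed
  then show "l2n (\<lambda>x. cnj (u x) * g x) \<le> B * l2n u" using B by (simp add: l2n_cmult)
qed

text \<open>The first estimate keeps the lower bound for I - T stable under small changes of the
  parameter; the second linearises T, with an error of smaller order than the increment.\<close>

lemma T_diff_bound:
  assumes g: "g \<in> borel_measurable borel" "\<And>x. cmod (g x) \<le> B"
  shows "cmod (T \<mu> g x - T \<kappa> g x) \<le> \<bar>\<mu> - \<kappa>\<bar> * Nu\<^sup>2 * B"
    and "cmod (T \<mu> g x - T \<kappa> g x - complex_of_real (\<mu> - \<kappa>) * (complex_of_real (1 / (2 * pi)) * ft (\<lambda>y. cnj (u y) * g y) (- \<kappa>)) * tsrc \<kappa> x)
      \<le> \<bar>\<mu> - \<kappa>\<bar> * B * omega \<bar>\<mu> - \<kappa>\<bar>"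
proof -
  let ?f = "\<lambda>x. cnj (u x) * g x"
  have B: "0 \<le> B" using g(2)[of 0] norm_ge_zero order_trans by blast
  note fL = L2_u_bounded[OF g] and fi = u_mult_bounded(1)[OF g] and fB = u_mult_bounded(2)[OF g]
  have un: "integrable lborel (\<lambda>y. cmod (u y))" by (rule integrable_norm[OF u_integrable])
  note Vi = V_integrable[OF fL]
  have D: "T \<mu> g x - T \<kappa> g x = - (LINT y:{x<..}|lborel. V \<mu> g y - V \<kappa> g y)"
    unfolding T_def set_lebesgue_integral_def scaleR_diff_right
    by (subst Bochner_Integration.integral_diff) (use Vi integrable_on_set in auto)
  have Di: "integrable lborel (\<lambda>y. V \<mu> g y - V \<kappa> g y)" by (intro Bochner_Integration.integrable_diff Vi)
  have "cmod (T \<mu> g x - T \<kappa> g x) \<le> (LINT y|lborel. cmod (u y) * (\<bar>\<mu> - \<kappa>\<bar> * (B * Nu)))"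
    unfolding D norm_minus_cancel
  proof (rule tail_norm_le[OF Di])
    show "integrable lborel (\<lambda>y. cmod (u y) * (\<bar>\<mu> - \<kappa>\<bar> * (B * Nu)))" using un by simp
    show "AE y in lborel. cmod (V \<mu> g y - V \<kappa> g y) \<le> cmod (u y) * (\<bar>\<mu> - \<kappa>\<bar> * (B * Nu))"
      using sz_diff_bound[OF fi fL, of \<mu> \<kappa>]
    proof eventually_elim
      case (elim y)
      have "V \<mu> g y - V \<kappa> g y = \<i> * (u y * (sz \<mu> ?f y - sz \<kappa> ?f y))" by (simp add: V_def right_diff_distrib)
      then have "cmod (V \<mu> g y - V \<kappa> g y) = cmod (u y) * cmod (sz \<mu> ?f y - sz \<kappa> ?f y)" by (simp add: norm_mult)
      also have "\<dots> \<le> cmod (u y) * (\<bar>\<mu> - \<kappa>\<bar> * (B * Nu))"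
        by (intro mult_left_mono order_trans[OF elim] fB) auto
      finally show ?case .
    qed
  qed
  then show "cmod (T \<mu> g x - T \<kappa> g x) \<le> \<bar>\<mu> - \<kappa>\<bar> * Nu\<^sup>2 * B" by (simp add: power2_eq_square mult_ac)
  let ?a = "complex_of_real (1 / (2 * pi)) * ft ?f (- \<kappa>)"
  let ?c = "complex_of_real (\<mu> - \<kappa>) * ?a"
  let ?\<delta> = "\<bar>\<mu> - \<kappa>\<bar>"
  let ?E = "\<lambda>y. V \<mu> g y - V \<kappa> g y - ?c * src \<kappa> y"
  have Ei: "integrable lborel ?E" by (intro Bochner_Integration.integrable_diff Vi integrable_mult_right src_integrable)
  have "(LINT y:{x<..}|lborel. ?E y) = (LINT y:{x<..}|lborel. V \<mu> g y - V \<kappa> g y) - ?c * (LINT y:{x<..}|lborel. src \<kappa> y)"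
    unfolding set_lebesgue_integral_def scaleR_diff_right[of _ "V \<mu> g _ - V \<kappa> g _"] integral_mult_right_zero[symmetric] mult_scaleR_right[symmetric]
    by (rule Bochner_Integration.integral_diff) (auto intro!: integrable_on_set Di src_integrable simp del: mult_scaleR_right simp: mult_scaleR_right)
  then have E: "T \<mu> g x - T \<kappa> g x - ?c * tsrc \<kappa> x = - (LINT y:{x<..}|lborel. ?E y)"
  proof -
    have gen: "L = X - c * S \<Longrightarrow> - X - c * (- S) = - L" for L X c S :: complex by simp
    assume "(LINT y:{x<..}|lborel. ?E y) = (LINT y:{x<..}|lborel. V \<mu> g y - V \<kappa> g y) - ?c * (LINT y:{x<..}|lborel. src \<kappa> y)"
    then show ?thesis unfolding D tsrc_def by (rule gen)
  qed
  have "cmod (T \<mu> g x - T \<kappa> g x - ?c * tsrc \<kappa> x) \<le> (LINT y|lborel. (?\<delta> * B) * (cmod (u y) * (LINT z|lborel. cmod (u z) * min 2 (\<bar>y - z\<bar> * ?\<delta>))))"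
    unfolding E norm_minus_cancel
  proof (rule tail_norm_le[OF Ei])
    show "integrable lborel (\<lambda>y. (?\<delta> * B) * (cmod (u y) * (LINT z|lborel. cmod (u z) * min 2 (\<bar>y - z\<bar> * ?\<delta>))))"
      by (intro integrable_mult_right omega_kernel) simp
    show "AE y in lborel. cmod (?E y) \<le> (?\<delta> * B) * (cmod (u y) * (LINT z|lborel. cmod (u z) * min 2 (\<bar>y - z\<bar> * ?\<delta>)))"
      using sz_deriv_bound[OF fi fL, of \<mu> \<kappa>]
    proof eventually_elim
      case (elim y)
      have "?E y = \<i> * (u y * (sz \<mu> ?f y - sz \<kappa> ?f y - ?c * ee (- \<kappa>) y))" by (simp add: V_def src_def algebra_simps)
      then have "cmod (?E y) = cmod (u y) * cmod (sz \<mu> ?f y - sz \<kappa> ?f y - ?c * ee (- \<kappa>) y)" by (simp add: norm_mult)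
      also have "\<dots> \<le> cmod (u y) * (?\<delta> * (LINT z|lborel. cmod (?f z) * min 2 (\<bar>y - z\<bar> * ?\<delta>)))"
        by (intro mult_left_mono elim) simp
      also have "\<dots> \<le> cmod (u y) * (?\<delta> * (B * (LINT z|lborel. cmod (u z) * min 2 (\<bar>y - z\<bar> * ?\<delta>))))"
      proof (intro mult_left_mono)
        show "(LINT z|lborel. cmod (?f z) * min 2 (\<bar>y - z\<bar> * ?\<delta>)) \<le> B * (LINT z|lborel. cmod (u z) * min 2 (\<bar>y - z\<bar> * ?\<delta>))"
        proof -
          have "(LINT z|lborel. cmod (?f z) * min 2 (\<bar>y - z\<bar> * ?\<delta>)) \<le> (LINT z|lborel. B * (cmod (u z) * min 2 (\<bar>y - z\<bar> * ?\<delta>)))"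
          proof (rule integral_mono')
            show "integrable lborel (\<lambda>z. B * (cmod (u z) * min 2 (\<bar>y - z\<bar> * ?\<delta>)))"
              by (intro integrable_mult_right omega_kernel) simp
            fix z
            have "cmod (?f z) \<le> B * cmod (u z)"
              using mult_left_mono[OF g(2)[of z] norm_ge_zero[of "u z"]] by (simp add: norm_mult mult.commute)
            then have "cmod (?f z) * min 2 (\<bar>y - z\<bar> * ?\<delta>) \<le> (B * cmod (u z)) * min 2 (\<bar>y - z\<bar> * ?\<delta>)"
              by (rule mult_right_mono) simp
            then show "cmod (?f z) * min 2 (\<bar>y - z\<bar> * ?\<delta>) \<le> B * (cmod (u z) * min 2 (\<bar>y - z\<bar> * ?\<delta>))" by (simp only: mult.assoc)
            show "0 \<le> B * (cmod (u z) * min 2 (\<bar>y - z\<bar> * ?\<delta>))" using B by simp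
          qed
          then show ?thesis by (simp only: integral_mult_right_zero)
        qed
      qed auto
      finally show ?case by (simp only: mult_ac)
    qed
  qed
  then show "cmod (T \<mu> g x - T \<kappa> g x - ?c * tsrc \<kappa> x) \<le> ?\<delta> * B * omega ?\<delta>"
    by (simp only: integral_mult_right_zero omega_def)
qed

section \<open>Compactness and the lower bound\<close>

text \<open>\<open>T \<kappa> g\<close> is \<open>prim\<close> minus the total integral, so a
  bounded fixed point is a solution whose constant is chosen to give limit 0 at +infinity.\<close>

lemma T_as_sol:
  assumes g: "g \<in> borel_measurable borel" "\<And>x. cmod (g x) \<le> B" and eq: "\<And>x. g x = T \<kappa> g x"
  shows "sol \<kappa> 0 g" "(g \<longlongrightarrow> 0) at_top"
proof -
  note L = L2_u_bounded[OF g]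
  note Vi = V_integrable[OF L, of \<kappa>]
  have e: "g x = - (LINT y|lborel. V \<kappa> g y) + prim (V \<kappa> g) x" for x
    by (rule trans[OF eq]) (simp add: T_def flip: prim_tail[OF Vi])
  then show "sol \<kappa> 0 g" using L by (auto simp: sol_def)
  have "((\<lambda>x. - (LINT y|lborel. V \<kappa> g y) + prim (V \<kappa> g) x) \<longlongrightarrow> - (LINT y|lborel. V \<kappa> g y) + (LINT y|lborel. V \<kappa> g y)) at_top"
    by (intro tendsto_intros prim_at_top[OF Vi])
  then have lim: "((\<lambda>x. - (LINT y|lborel. V \<kappa> g y) + prim (V \<kappa> g) x) \<longlongrightarrow> 0) at_top" by simp
  have "g = (\<lambda>x. - (LINT y|lborel. V \<kappa> g y) + prim (V \<kappa> g) x)" by (rule ext) (rule e)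
  then show "(g \<longlongrightarrow> 0) at_top" by (rule ssubst) (rule lim)
qed

text \<open>\<open>c * g\<close> is split as g plus \<open>(c - 1) * g\<close>, the form to which
  \<open>T_lincomb\<close> applies.\<close>

lemma T_scale:
  assumes "L2 (\<lambda>x. cnj (u x) * g x)" shows "T \<kappa> (\<lambda>x. c * g x) x = c * T \<kappa> g x"
  using T_lincomb[OF assms assms, of \<kappa> "c - 1" x] by (simp add: algebra_simps)

text \<open>A Hoelder bound of exponent 1/2: Cauchy-Schwarz against the indicator of [x, y], using
  that \<open>u\<close> is bounded and the projector is a contraction.\<close>

lemma T_equicontinuous:
  "\<exists>K. \<forall>g x y. g \<in> borel_measurable borel \<longrightarrow> (\<forall>x. cmod (g x) \<le> 1) \<longrightarrow> x \<le> y \<longrightarrow> cmod (T \<kappa> g x - T \<kappa> g y) \<le> K * sqrt (y - x)"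
proof -
  obtain C where C: "AE x in lborel. cmod (u x) \<le> C" by (rule u_bounded)
  have "cmod (T \<kappa> g x - T \<kappa> g y) \<le> (\<bar>C\<bar> * l2n u) * sqrt (y - x)"
    if g: "g \<in> borel_measurable borel" "\<And>x. cmod (g x) \<le> 1" and xy: "x \<le> y" for g x y
  proof -
    let ?f = "\<lambda>x. cnj (u x) * g x"
    note L = L2_u_bounded[OF g]
    note Vi = V_integrable[OF L, of \<kappa>]
    let ?I = "indicator {x..y} :: real \<Rightarrow> complex"
    have Iw: "integrable lborel (\<lambda>t. ?I t * sz \<kappa> ?f t)" by (intro L2_mult_integrable indicator_L2 sz_L2 L)
    have "T \<kappa> g x - T \<kappa> g y = - (prim (V \<kappa> g) y - prim (V \<kappa> g) x)"
      unfolding T_def prim_tail[OF Vi, symmetric] by simp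
    then have "cmod (T \<kappa> g x - T \<kappa> g y) = cmod (LINT t:{x<..y}|lborel. V \<kappa> g t)"
      unfolding prim_diff[OF Vi xy] by simp
    also have "\<dots> \<le> (LINT t|lborel. cmod (indicator {x<..y} t *\<^sub>R V \<kappa> g t))"
      unfolding set_lebesgue_integral_def by (rule integral_norm_bound)
    also have "\<dots> \<le> (LINT t|lborel. \<bar>C\<bar> * cmod (?I t * sz \<kappa> ?f t))"
    proof (rule integral_mono_AE)
      show "integrable lborel (\<lambda>t. cmod (indicator {x<..y} t *\<^sub>R V \<kappa> g t))"
        by (intro integrable_norm integrable_on_set Vi) auto
      show "integrable lborel (\<lambda>t. \<bar>C\<bar> * cmod (?I t * sz \<kappa> ?f t))"
        by (intro integrable_mult_right integrable_norm Iw)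
      show "AE t in lborel. cmod (indicator {x<..y} t *\<^sub>R V \<kappa> g t) \<le> \<bar>C\<bar> * cmod (?I t * sz \<kappa> ?f t)"
        using C
      proof eventually_elim
        case (elim t)
        then have "cmod (u t) * cmod (sz \<kappa> ?f t) \<le> \<bar>C\<bar> * cmod (sz \<kappa> ?f t)" by (intro mult_right_mono) auto
        then show ?case by (auto simp: indicator_def V_def norm_mult)
      qed
    qed
    also have "\<dots> \<le> \<bar>C\<bar> * (l2n ?I * l2n (sz \<kappa> ?f))"
      unfolding integral_mult_right_zero by (intro mult_left_mono L2_Cauchy_Schwarz indicator_L2 sz_L2 L) simp
    also have "\<dots> \<le> \<bar>C\<bar> * (l2n ?I * l2n u)"
      using order_trans[OF sz_le[OF L] u_mult_bounded(3)[OF g]] by (intro mult_left_mono) auto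
    also have "l2n ?I = sqrt (y - x)"
    proof -
      have "(LINT t|lborel. (cmod (?I t))\<^sup>2) = (LINT t|lborel. indicator {x..y} t)"
        by (rule Bochner_Integration.integral_cong) (auto simp: indicator_def)
      then show ?thesis using xy by (simp add: l2n_def)
    qed
    finally show ?thesis by (simp add: mult_ac)
  qed
  then show ?thesis by blast
qed

text \<open>A diagonal subsequence converges at the rational points, and equicontinuity extends the
  convergence to every real point.\<close>

lemma T_pointwise_subsequence:
  assumes k: "\<And>n::nat. k n \<in> borel_measurable borel" "\<And>n x. cmod (k n x) \<le> 1"
  shows "\<exists>r :: nat \<Rightarrow> nat. strict_mono r \<and> (\<forall>x. convergent (\<lambda>n. T \<kappa> (k (r n)) x))"
proof -
  obtain K where K: "\<forall>g x y. g \<in> borel_measurable borel \<longrightarrow> (\<forall>x. cmod (g x) \<le> 1) \<longrightarrow> x \<le> y \<longrightarrow> cmod (T \<kappa> g x - T \<kappa> g y) \<le> K * sqrt (y - x)"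
    using T_equicontinuous by blast
  have bd: "cmod (T \<kappa> (k n) x) \<le> l2n u * l2n u" for n x
    using T_bound[OF L2_u_bounded[OF k], of \<kappa> n x] mult_left_mono[OF u_mult_bounded(3)[OF k, of n] l2n_nonneg[of u]] by simp
  have "\<exists>r :: nat \<Rightarrow> nat. strict_mono r \<and> (\<forall>x\<in>\<rat>. \<exists>l. (\<lambda>n. T \<kappa> (k (r n)) x) \<longlonglongrightarrow> l)"
  proof (rule function_convergent_subsequence[OF countable_rat, of "\<lambda>n. T \<kappa> (k n)"])
    show "cmod (T \<kappa> (k n) x) \<le> l2n u * l2n u" for n x by (rule bd)
  qed blast
  then obtain r :: "nat \<Rightarrow> nat" where r: "strict_mono r" "\<And>x. x \<in> \<rat> \<Longrightarrow> \<exists>l. (\<lambda>n. T \<kappa> (k (r n)) x) \<longlonglongrightarrow> l"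
    by blast
  have "convergent (\<lambda>n. T \<kappa> (k (r n)) x)" for x
  proof (rule Cauchy_convergent, rule metric_CauchyI)
    fix e :: real assume e: "e > 0"
    \<comment> \<open>Solves the Hoelder bound for an error below e / 3; the term |K| + 1 keeps the
      denominator positive.\<close>
    define d where "d = (e / (3 * (\<bar>K\<bar> + 1)))\<^sup>2"
    have d: "d > 0" using e by (simp add: d_def)
    obtain q where q: "q \<in> \<rat>" "x < q" "q < x + d" using Rats_dense_in_real[of x "x + d"] d by auto
    have "sqrt (q - x) \<le> sqrt d" using q by (intro real_sqrt_le_mono) simp
    also have "sqrt d = e / (3 * (\<bar>K\<bar> + 1))" using e by (simp add: d_def)
    finally have sq: "sqrt (q - x) \<le> e / (3 * (\<bar>K\<bar> + 1))" .
    have Ke: "K * sqrt (q - x) < e / 3"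
    proof -
      have "K * sqrt (q - x) \<le> \<bar>K\<bar> * sqrt (q - x)" using q by (intro mult_right_mono) auto
      also have "\<dots> \<le> \<bar>K\<bar> * (e / (3 * (\<bar>K\<bar> + 1)))" by (intro mult_left_mono sq) simp
      also have "\<dots> < e / 3" using e by (simp add: field_simps)
      finally show ?thesis .
    qed
    have close: "cmod (T \<kappa> (k n) x - T \<kappa> (k n) q) < e / 3" for n
    proof -
      have "cmod (T \<kappa> (k n) x - T \<kappa> (k n) q) \<le> K * sqrt (q - x)"
        by (rule K[rule_format, OF k(1) k(2) less_imp_le[OF q(2)]])
      with Ke show ?thesis by linarith
    qed
    have "Cauchy (\<lambda>n. T \<kappa> (k (r n)) q)" using r(2)[OF q(1)] by (blast intro: LIMSEQ_imp_Cauchy)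
    then obtain M where M: "\<And>m n. m \<ge> M \<Longrightarrow> n \<ge> M \<Longrightarrow> dist (T \<kappa> (k (r m)) q) (T \<kappa> (k (r n)) q) < e / 3"
      using metric_CauchyD[of _ "e / 3"] e by (metis divide_pos_pos zero_less_numeral)
    have "dist (T \<kappa> (k (r m)) x) (T \<kappa> (k (r n)) x) < e" if "m \<ge> M" "n \<ge> M" for m n
    proof -
      have "dist (T \<kappa> (k (r m)) x) (T \<kappa> (k (r n)) x) \<le> dist (T \<kappa> (k (r m)) x) (T \<kappa> (k (r m)) q)
          + dist (T \<kappa> (k (r m)) q) (T \<kappa> (k (r n)) q) + dist (T \<kappa> (k (r n)) q) (T \<kappa> (k (r n)) x)"
        by (meson add_right_mono dist_triangle order_trans)
      also have "\<dots> < e / 3 + e / 3 + e / 3"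
        using close[of "r m"] close[of "r n"] M[OF that] by (intro add_strict_mono) (auto simp: dist_norm norm_minus_commute)
      finally show ?thesis by simp
    qed
    then show "\<exists>M. \<forall>m\<ge>M. \<forall>n\<ge>M. dist (T \<kappa> (k (r m)) x) (T \<kappa> (k (r n)) x) < e" by blast
  qed
  with r(1) show ?thesis by blast
qed

text \<open>Almost fixed points converge, along a subsequence, to an exact bounded fixed point,
  which is 0 by \<open>sol_zero\<close>. Since \<open>T_bound\<close> makes the convergence of the
  images uniform, the almost fixed points themselves become uniformly small, against
  \<open>big\<close>.\<close>

lemma no_approximate_kernel:
  assumes \<kappa>: "\<kappa> > 0" "\<kappa> \<notin> sigma_pp u"
    and k: "\<And>n::nat. k n \<in> borel_measurable borel" "\<And>n x. cmod (k n x) \<le> 1"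
    and app: "\<And>n x. cmod (k n x - T \<kappa> (k n) x) \<le> 1 / real (Suc n)"
    and big: "\<And>n. \<exists>x. cmod (k n x) > 1 / 2"
  shows False
proof -
  have "\<exists>r :: nat \<Rightarrow> nat. strict_mono r \<and> (\<forall>x. convergent (\<lambda>n. T \<kappa> (k (r n)) x))"
    by (rule T_pointwise_subsequence[of k]) (rule k)+
  then obtain r :: "nat \<Rightarrow> nat" where r: "strict_mono r" "\<And>x. convergent (\<lambda>n. T \<kappa> (k (r n)) x)"
    by blast
  have inv: "(\<lambda>n. 1 / real (Suc (r n))) \<longlonglongrightarrow> 0"
    using LIMSEQ_subseq_LIMSEQ[OF inverse_Suc_tendsto r(1)] by (simp add: comp_def)
  define g where "g x = lim (\<lambda>n. T \<kappa> (k (r n)) x)" for x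
  have Tg: "(\<lambda>n. T \<kappa> (k (r n)) x) \<longlonglongrightarrow> g x" for x
    using r(2)[of x] by (simp add: g_def convergent_LIMSEQ_iff)
  have kg: "(\<lambda>n. k (r n) x) \<longlonglongrightarrow> g x" for x
  proof -
    have "(\<lambda>n. k (r n) x - T \<kappa> (k (r n)) x) \<longlonglongrightarrow> 0"
      by (rule Lim_null_comparison[OF _ inv]) (use app in auto)
    from tendsto_add[OF this Tg[of x]] show ?thesis by simp
  qed
  have gm[measurable]: "g \<in> borel_measurable borel"
    by (rule borel_measurable_LIMSEQ_metric[OF k(1) kg])
  have g1: "cmod (g x) \<le> 1" for x
    by (rule LIMSEQ_le_const2[OF tendsto_norm[OF kg]]) (use k(2) in auto)
  let ?fk = "\<lambda>n x. cnj (u x) * k (r n) x" and ?fg = "\<lambda>x. cnj (u x) * g x"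
  have [measurable]: "k n \<in> borel_measurable borel" for n by (rule k)
  \<comment> \<open>Square integrability of \<open>u\<close> provides the majorant on the whole
    line, where \<open>k\<close> converges merely pointwise.\<close>
  have "(\<lambda>n. LINT x|lborel. (cmod (?fk n x - ?fg x))\<^sup>2) \<longlonglongrightarrow> (LINT x|(lborel :: real measure). (0 :: real))"
  proof (rule integral_dominated_convergence[where w = "\<lambda>x. (2 * cmod (u x))\<^sup>2"])
    show "integrable lborel (\<lambda>x. (2 * cmod (u x))\<^sup>2)" using L2_sq[OF u_L2] by (simp add: power_mult_distrib)
    show "AE x in lborel. (\<lambda>n. (cmod (?fk n x - ?fg x))\<^sup>2) \<longlonglongrightarrow> 0"
    proof (intro AE_I2)
      fix x
      have "(\<lambda>n. (cmod (?fk n x - ?fg x))\<^sup>2) \<longlonglongrightarrow> (cmod (cnj (u x) * g x - ?fg x))\<^sup>2"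
        by (intro tendsto_intros kg)
      then show "(\<lambda>n. (cmod (?fk n x - ?fg x))\<^sup>2) \<longlonglongrightarrow> 0" by simp
    qed
    show "AE x in lborel. norm ((cmod (?fk n x - ?fg x))\<^sup>2) \<le> (2 * cmod (u x))\<^sup>2" for n
    proof (intro AE_I2)
      fix x
      have "cmod (k (r n) x - g x) \<le> 2"
        using norm_triangle_ineq4[of "k (r n) x" "g x"] k(2)[of "r n" x] g1[of x] by linarith
      then have "cmod (u x) * cmod (k (r n) x - g x) \<le> cmod (u x) * 2" by (intro mult_left_mono) auto
      moreover have "cmod (?fk n x - ?fg x) = cmod (u x) * cmod (k (r n) x - g x)"
        by (simp only: right_diff_distrib[symmetric] norm_mult complex_mod_cnj)
      ultimately have "cmod (?fk n x - ?fg x) \<le> 2 * cmod (u x)" by simp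
      from power_mono[OF this norm_ge_zero, of 2]
      show "norm ((cmod (?fk n x - ?fg x))\<^sup>2) \<le> (2 * cmod (u x))\<^sup>2"
        by (simp only: real_norm_def abs_of_nonneg[OF zero_le_power2])
    qed
  qed auto
  from tendsto_real_sqrt[OF this] have l2: "(\<lambda>n. l2n (\<lambda>x. cnj (u x) * (k (r n) x + (-1) * g x))) \<longlonglongrightarrow> 0"
    by (simp add: l2n_def right_diff_distrib)
  have gL: "L2 ?fg" by (rule L2_u_bounded[OF gm g1])
  have kL: "L2 (?fk n)" for n by (rule L2_u_bounded[OF k])
  have kgL: "L2 (\<lambda>x. cnj (u x) * (k (r n) x + (-1) * g x))" for n
    using L2_diff[OF kL[of n] gL] by (simp add: right_diff_distrib)
  have unif: "cmod (T \<kappa> (k (r n)) x - T \<kappa> g x) \<le> l2n u * l2n (\<lambda>x. cnj (u x) * (k (r n) x + (-1) * g x))" for n x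
    using T_bound[OF kgL, of \<kappa> n x] T_lincomb[OF kL gL, of \<kappa> n "-1" x] by simp
  have l2': "(\<lambda>n. l2n u * l2n (\<lambda>x. cnj (u x) * (k (r n) x + (-1) * g x))) \<longlonglongrightarrow> 0"
    using tendsto_mult_left[OF l2, of "l2n u"] by simp
  have "g x = T \<kappa> g x" for x
  proof (rule LIMSEQ_unique[OF Tg])
    show "(\<lambda>n. T \<kappa> (k (r n)) x) \<longlonglongrightarrow> T \<kappa> g x"
      by (rule LIM_zero_cancel, rule Lim_null_comparison[OF _ l2']) (use unif in auto)
  qed
  note sg = T_as_sol[OF gm g1 this]
  have g0: "g x = 0" for x by (rule sol_zero[OF \<kappa> sg(1)]) (use sg(2) in blast)
  then have g0': "g = (\<lambda>x. 0)" by (simp add: fun_eq_iff)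
  have T0: "T \<kappa> g x = 0" for x using \<open>\<And>x. g x = T \<kappa> g x\<close>[of x] g0[of x] by simp
  have "(\<lambda>n. l2n u * l2n (\<lambda>x. cnj (u x) * (k (r n) x + (-1) * g x)) + 1 / real (Suc (r n))) \<longlonglongrightarrow> 0 + 0"
    by (intro tendsto_add l2' inv)
  then have "\<forall>\<^sub>F n in sequentially. l2n u * l2n (\<lambda>x. cnj (u x) * (k (r n) x + (-1) * g x)) + 1 / real (Suc (r n)) < 1 / 2"
    by (intro order_tendstoD(2)) auto
  then obtain n where n: "l2n u * l2n (\<lambda>x. cnj (u x) * (k (r n) x + (-1) * g x)) + 1 / real (Suc (r n)) < 1 / 2"
    by (auto simp: eventually_sequentially)
  obtain x where x: "cmod (k (r n) x) > 1 / 2" using big by blast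
  have "cmod (k (r n) x) \<le> cmod (T \<kappa> (k (r n)) x) + cmod (k (r n) x - T \<kappa> (k (r n)) x)"
    by (metis norm_triangle_sub add.commute)
  also have "\<dots> \<le> l2n u * l2n (\<lambda>x. cnj (u x) * (k (r n) x + (-1) * g x)) + 1 / real (Suc (r n))"
    using unif[of n x] app[of "r n" x] unfolding T0 by (intro add_mono) auto
  finally show False using n x by linarith
qed

text \<open>If every constant n + 1 failed, dividing the counterexamples by their suprema would give
  an approximate kernel. The bound B only expresses that g is bounded; the constant C is independent
  of it.\<close>

lemma T_bounded_below:
  assumes \<kappa>: "\<kappa> > 0" "\<kappa> \<notin> sigma_pp u"
  shows "\<exists>C>0. \<forall>g B M x. g \<in> borel_measurable borel \<longrightarrow> (\<forall>x. cmod (g x) \<le> B) \<longrightarrow> (\<forall>x. cmod (g x - T \<kappa> g x) \<le> M) \<longrightarrow> cmod (g x) \<le> C * M"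
proof -
  let ?P = "\<lambda>C. \<forall>g B M x. g \<in> borel_measurable borel \<longrightarrow> (\<forall>x. cmod (g x) \<le> B) \<longrightarrow> (\<forall>x. cmod (g x - T \<kappa> g x) \<le> M) \<longrightarrow> cmod (g x) \<le> C * M"
  have "\<exists>n. ?P (real (Suc n))"
  proof (rule ccontr)
    assume neg: "\<not> (\<exists>n. ?P (real (Suc n)))"
    have "\<exists>k. k \<in> borel_measurable borel \<and> (\<forall>x. cmod (k x) \<le> 1) \<and> (\<forall>x. cmod (k x - T \<kappa> k x) \<le> 1 / real (Suc n)) \<and> (\<exists>x. cmod (k x) > 1 / 2)" for n
    proof -
      obtain g B M x0 where g: "g \<in> borel_measurable borel" "\<And>x. cmod (g x) \<le> B" "\<And>x. cmod (g x - T \<kappa> g x) \<le> M"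
        and x0: "cmod (g x0) > real (Suc n) * M"
        using neg by (metis not_le)
      have M: "M \<ge> 0" using g(3)[of 0] norm_ge_zero order_trans by blast
      define S where "S = (SUP x. cmod (g x))"
      have bdd: "bdd_above (range (\<lambda>x. cmod (g x)))" using g(2) by (auto intro!: bdd_aboveI)
      have gS: "cmod (g x) \<le> S" for x unfolding S_def by (intro cSUP_upper bdd) auto
      \<comment> \<open>Failure at \<open>x0\<close> makes the supremum exceed (n + 1) M, so it is
        positive and the normalised defect is at most 1 / (n + 1).\<close>
      have S: "S > 0" "real (Suc n) * M < S"
        using gS[of x0] x0 M by (auto intro: order.strict_trans1[of 0 "real (Suc n) * M"] simp: mult_nonneg_nonneg)
      \<comment> \<open>The supremum need not be attained; half of it is exceeded somewhere, which
        is the origin of the threshold 1/2.\<close>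
      obtain x1 where x1: "S / 2 < cmod (g x1)"
        using less_cSUP_iff[OF _ bdd, of "S / 2"] S(1) by (auto simp flip: S_def)
      let ?c = "complex_of_real (1 / S)"
      let ?k = "\<lambda>x. ?c * g x"
      have gL: "L2 (\<lambda>x. cnj (u x) * g x)" by (rule L2_u_bounded[OF g(1,2)])
      have kT: "?k x - T \<kappa> ?k x = ?c * (g x - T \<kappa> g x)" for x
        unfolding T_scale[OF gL] by (simp only: right_diff_distrib)
      have nc: "cmod ?c = 1 / S" using S(1) by (simp add: norm_divide)
      have "cmod (?k x) \<le> 1" for x
        unfolding norm_mult nc using gS[of x] S(1) by simp
      moreover have "cmod (?k x - T \<kappa> ?k x) \<le> 1 / real (Suc n)" for x
      proof -
        have "cmod (?k x - T \<kappa> ?k x) \<le> 1 / S * M"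
          unfolding kT norm_mult nc using g(3)[of x] S(1) by (intro mult_left_mono) auto
        also have "\<dots> \<le> 1 / real (Suc n)" using S by (simp add: field_simps del: of_nat_Suc)
        finally show ?thesis .
      qed
      moreover have "cmod (?k x1) > 1 / 2"
        unfolding norm_mult nc using x1 S(1) by (simp add: field_simps)
      moreover have "?k \<in> borel_measurable borel" using g(1) by simp
      ultimately show ?thesis by (intro exI[of _ ?k] conjI) blast+
    qed
    then obtain k where k: "\<And>n::nat. k n \<in> borel_measurable borel" "\<And>n x. cmod (k n x) \<le> 1"
      "\<And>n x. cmod (k n x - T \<kappa> (k n) x) \<le> 1 / real (Suc n)" "\<And>n. \<exists>x. cmod (k n x) > 1 / 2"
      by metis
    show False by (rule no_approximate_kernel[OF \<kappa> k])
  qed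
  then obtain n where "?P (real (Suc n))" by blast
  then show ?thesis by (intro exI[of _ "real (Suc n)"] conjI) simp
qed

subsection \<open>Jost functions\<close>

text \<open>Replacing T at \<mu> by T at \<kappa> costs a small multiple of the supremum of g, which
  is absorbed on the left at the price of doubling C. One constant serves all nearby \<mu>.\<close>

lemma T_bounded_below_nearby:
  assumes \<kappa>: "\<kappa> > 0" "\<kappa> \<notin> sigma_pp u"
  shows "\<exists>C>0. \<exists>d>0. \<forall>\<mu>. \<bar>\<mu> - \<kappa>\<bar> < d \<longrightarrow> (\<forall>g B M x. g \<in> borel_measurable borel \<longrightarrow> (\<forall>x. cmod (g x) \<le> B) \<longrightarrow>
    (\<forall>x. cmod (g x - T \<mu> g x) \<le> M) \<longrightarrow> cmod (g x) \<le> C * M)"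
proof -
  obtain C where C: "C > 0" "\<forall>g B M x. g \<in> borel_measurable borel \<longrightarrow> (\<forall>x. cmod (g x) \<le> B) \<longrightarrow> (\<forall>x. cmod (g x - T \<kappa> g x) \<le> M) \<longrightarrow> cmod (g x) \<le> C * M"
    using T_bounded_below[OF \<kappa>] by blast
  \<comment> \<open>Makes the absorbed part at most half of the supremum; the added 1 keeps the
    denominator positive.\<close>
  define d where "d = 1 / (2 * C * (Nu\<^sup>2 + 1))"
  have N: "Nu\<^sup>2 + 1 > 0" by (simp add: add_nonneg_pos)
  have d: "d > 0" using C(1) N by (simp add: d_def)
  have "cmod (g x) \<le> (2 * C) * M"
    if \<mu>: "\<bar>\<mu> - \<kappa>\<bar> < d" and g: "g \<in> borel_measurable borel" "\<forall>x. cmod (g x) \<le> B" "\<forall>x. cmod (g x - T \<mu> g x) \<le> M" for \<mu> g B M x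
  proof -
    define S where "S = (SUP x. cmod (g x))"
    have bdd: "bdd_above (range (\<lambda>x. cmod (g x)))" using g(2) by (auto intro!: bdd_aboveI)
    have gS: "cmod (g x) \<le> S" for x unfolding S_def by (intro cSUP_upper bdd) auto
    have S0: "S \<ge> 0" using gS[of 0] norm_ge_zero order_trans by blast
    have "cmod (g x - T \<kappa> g x) \<le> M + \<bar>\<mu> - \<kappa>\<bar> * Nu\<^sup>2 * S" for x
    proof -
      have "cmod (g x - T \<kappa> g x) \<le> cmod (g x - T \<mu> g x) + cmod (T \<mu> g x - T \<kappa> g x)"
        by (rule norm_diff_triangle_le[OF order_refl order_refl])
      then show ?thesis using g(3)[rule_format, of x] T_diff_bound(1)[OF g(1) gS, of \<mu> x \<kappa>] by linarith
    qed
    then have le: "cmod (g x) \<le> C * (M + \<bar>\<mu> - \<kappa>\<bar> * Nu\<^sup>2 * S)" for x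
      using C(2) g(1) gS by blast
    have "C * (\<bar>\<mu> - \<kappa>\<bar> * Nu\<^sup>2) \<le> C * (d * (Nu\<^sup>2 + 1))"
      using \<mu> C(1) d by (intro mult_left_mono mult_mono) auto
    also have "\<dots> = 1 / 2" using C(1) N by (simp add: d_def)
    finally have "C * (\<bar>\<mu> - \<kappa>\<bar> * Nu\<^sup>2) * S \<le> 1 / 2 * S" using S0 by (rule mult_right_mono)
    then have "cmod (g x) \<le> C * M + S / 2" for x
      using le[of x] by (simp add: distrib_left mult.assoc)
    then have "S \<le> C * M + S / 2" unfolding S_def by (intro cSUP_least) auto
    then show ?thesis using gS[of x] by simp
  qed
  then show ?thesis using C(1) d by (intro exI[of _ "2 * C"] conjI exI[of _ d]) auto
qed

text \<open>In the gauge an eigenfunction has a limit at +infinity, which square integrability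
  forces to be 0, so it solves the integral equation without data. With the lower bound for nearby
  parameters this keeps eigenvalues away from \<kappa>.\<close>

lemma eigenvalue_imp_fixed_point:
  assumes "\<mu> \<in> sigma_pp u"
  shows "\<exists>g B. g \<in> borel_measurable borel \<and> (\<forall>x. cmod (g x) \<le> B) \<and> (\<forall>x. g x = T \<mu> g x) \<and> (\<exists>x. g x \<noteq> 0)"
proof -
  obtain h where h: "Hplus 1 h" "\<not> (AE x in lborel. h x = 0)" "lax_eq u h (\<lambda>x. complex_of_real \<mu> * h x)"
    using assms by (auto simp: sigma_pp_def)
  have hL: "L2 h" using h(1) by (simp add: Hplus_def)
  obtain k B where k: "continuous_on UNIV k" "\<And>x. cmod (k x) \<le> B" "AE x in lborel. h x = k x"
    using Hplus_1_continuous_bounded[OF h(1)] by blast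
  have km: "k \<in> borel_measurable borel" by (rule borel_measurable_continuous_onI[OF k(1)])
  have kL: "L2 k" by (rule L2_cong_AE[OF hL km k(3)])
  have hm: "h \<in> borel_measurable borel" using hL by (simp add: L2_def)
  have lax: "lax_eq u k (\<lambda>x. complex_of_real \<mu> * k x)"
    by (rule lax_eq_cong_AE[OF hm km u_measurable k(3) h(3)])
  let ?g = "\<lambda>x. ee (- \<mu>) x * k x"
  have g: "sol \<mu> 0 ?g"
    by (rule lax_eq_imp_sol[OF k(1) L2_u_bounded[OF km k(2)]]) (use lax in simp)
  have gm: "?g \<in> borel_measurable borel" using km by simp
  obtain c0 where c0: "\<And>x. ?g x = c0 + prim (V \<mu> ?g) x" using g by (auto simp: sol_def)
  have ge: "?g = (\<lambda>x. c0 + prim (V \<mu> ?g) x)" by (rule ext) (rule c0)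
  have "((\<lambda>x. c0 + prim (V \<mu> ?g) x) \<longlongrightarrow> c0 + (LINT y|lborel. V \<mu> ?g y)) at_top"
    by (intro tendsto_intros prim_at_top V_integrable sol_L2[OF g])
  then have top: "(?g \<longlongrightarrow> c0 + (LINT y|lborel. V \<mu> ?g y)) at_top" by (rule ge[THEN ssubst])
  have top0: "(?g \<longlongrightarrow> 0) at_top"
    using top unfolding L2_limit_zero[OF L2_ee[OF kL] top] .
  have "?g x = T \<mu> ?g x" for x
    by (rule trans[OF sol_at_top_imp[OF g top0]]) (simp add: T_def)
  moreover have "\<exists>x. ?g x \<noteq> 0"
  proof (rule ccontr)
    assume "\<not> (\<exists>x. ?g x \<noteq> 0)"
    then have "k x = 0" for x by (metis ee_cancel(3) mult_zero_right)
    then have "AE x in lborel. h x = 0" using k(3) by simp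
    then show False using h(2) by simp
  qed
  moreover have "cmod (?g x) \<le> B" for x using k(2) by (simp add: norm_mult)
  ultimately show ?thesis
    by (intro exI[of _ ?g], intro exI[of _ B]) (use gm in blast)
qed

section \<open>Identities between Jost functions\<close>

lemma jost_phi_sol:
  assumes "jost_phi F u s \<kappa> \<phi>"
  shows "sol \<kappa> 1 (\<lambda>x. ee (- \<kappa>) x * \<phi> x)" "((\<lambda>x. ee (- \<kappa>) x * \<phi> x) \<longlongrightarrow> 0) F"
proof -
  have j: "Linfw (- s) \<phi>" "continuous_on UNIV \<phi>" "lax_eq u \<phi> (\<lambda>x. complex_of_real \<kappa> * \<phi> x + u x)" "(\<phi> \<longlongrightarrow> 0) F"
    using assms by (auto simp: jost_phi_def)
  show "sol \<kappa> 1 (\<lambda>x. ee (- \<kappa>) x * \<phi> x)"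
    by (rule lax_eq_imp_sol[OF j(2) L2_u_Linfw[OF j(1)]]) (use j(3) in simp)
  show "((\<lambda>x. ee (- \<kappa>) x * \<phi> x) \<longlongrightarrow> 0) F"
    by (rule Lim_null_comparison[OF _ tendsto_norm_zero[OF j(4)]]) (simp add: norm_mult)
qed

lemma jost_psi_sol:
  assumes "jost_psi F u s \<kappa> \<psi>"
  shows "sol \<kappa> 0 (\<lambda>x. ee (- \<kappa>) x * \<psi> x)" "((\<lambda>x. ee (- \<kappa>) x * \<psi> x) \<longlongrightarrow> 1) F"
proof -
  have j: "Linfw (- s) \<psi>" "continuous_on UNIV \<psi>" "lax_eq u \<psi> (\<lambda>x. complex_of_real \<kappa> * \<psi> x)" "((\<lambda>x. \<psi> x - ee \<kappa> x) \<longlongrightarrow> 0) F"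
    using assms by (auto simp: jost_psi_def)
  show "sol \<kappa> 0 (\<lambda>x. ee (- \<kappa>) x * \<psi> x)"
    by (rule lax_eq_imp_sol[OF j(2) L2_u_Linfw[OF j(1)]]) (use j(3) in simp)
  show "((\<lambda>x. ee (- \<kappa>) x * \<psi> x) \<longlongrightarrow> 1) F"
  proof (rule LIM_zero_cancel, rule Lim_null_comparison[OF _ tendsto_norm_zero[OF j(4)]])
    have "cmod (ee (- \<kappa>) x * \<psi> x - 1) = cmod (\<psi> x - ee \<kappa> x)" for x
    proof -
      have "ee (- \<kappa>) x * \<psi> x - 1 = ee (- \<kappa>) x * (\<psi> x - ee \<kappa> x)" by (simp add: right_diff_distrib)
      then show ?thesis by (simp add: norm_mult)
    qed
    then show "\<forall>\<^sub>F x in F. norm (ee (- \<kappa>) x * \<psi> x - 1) \<le> cmod (\<psi> x - ee \<kappa> x)" by simp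
  qed
qed

lemma ee_mult_cancel: "ee (- \<kappa>) x * a = ee (- \<kappa>) x * b \<longleftrightarrow> a = b"
  by (metis ee_cancel(3))

text \<open>\<open>jost_Gamma\<close> is the limit at +infinity of the gauged \<psi>+: its limit 1
  at -infinity plus the integral of its derivative. Subtracting that multiple of the gauged \<psi>-
  leaves a solution vanishing at +infinity.\<close>

lemma jost_psi_identity:
  assumes \<kappa>: "\<kappa> > 0" "\<kappa> \<notin> sigma_pp u"
    and p: "jost_psi at_bot u s \<kappa> (\<psi>p \<kappa>)" and m: "jost_psi at_top u s \<kappa> (\<psi>m \<kappa>)"
  shows "\<psi>p \<kappa> x = jost_Gamma u \<psi>p \<kappa> * \<psi>m \<kappa> x"
proof -
  let ?g = "\<lambda>x. ee (- \<kappa>) x * \<psi>p \<kappa> x" and ?k = "\<lambda>x. ee (- \<kappa>) x * \<psi>m \<kappa> x"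
  let ?c = "jost_Gamma u \<psi>p \<kappa>"
  note g = jost_psi_sol[OF p] and k = jost_psi_sol[OF m]
  have "(LINT y|lborel. V \<kappa> ?g y + 0 * src \<kappa> y) = \<i> * (LINT y|lborel. u y * szego (\<lambda>x. cnj (u x) * \<psi>p \<kappa> x) y * ee (- \<kappa>) y)"
    unfolding gauge_V[symmetric] integral_mult_right_zero[symmetric] by (simp add: mult_ac)
  then have "?c = 1 + (LINT y|lborel. V \<kappa> ?g y + 0 * src \<kappa> y)" by (simp only: jost_Gamma_def)
  with sol_at_top[OF g] have top: "(?g \<longlongrightarrow> ?c) at_top" by (simp only:)
  have "((\<lambda>x. ?g x + (- ?c) * ?k x) \<longlongrightarrow> ?c + (- ?c) * 1) at_top"
    by (intro tendsto_intros top k(2))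
  moreover have "sol \<kappa> 0 (\<lambda>x. ?g x + (- ?c) * ?k x)" using sol_add[OF g(1) k(1), of "- ?c"] by simp
  ultimately have "?g x + (- ?c) * ?k x = 0" by (intro sol_zero[OF \<kappa>]) auto
  then have "ee (- \<kappa>) x * \<psi>p \<kappa> x = ee (- \<kappa>) x * (?c * \<psi>m \<kappa> x)" by (simp add: mult.left_commute)
  then show ?thesis by (simp only: ee_mult_cancel)
qed

text \<open>\<open>jost_beta\<close> is the integral of the derivative of the gauged \<phi>+, hence
  its limit at +infinity. In the difference of \<phi>+ and \<phi>- the source terms cancel, so
  uniqueness for the homogeneous equation applies.\<close>

lemma jost_phi_identity:
  assumes \<kappa>: "\<kappa> > 0" "\<kappa> \<notin> sigma_pp u"
    and p: "jost_phi at_bot u s \<kappa> (\<phi>p \<kappa>)" and m: "jost_phi at_top u s \<kappa> (\<phi>m \<kappa>)" and n: "jost_psi at_top u s \<kappa> (\<psi>m \<kappa>)"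
  shows "\<phi>p \<kappa> x - \<phi>m \<kappa> x = jost_beta u \<phi>p \<kappa> * \<psi>m \<kappa> x"
proof -
  let ?g = "\<lambda>x. ee (- \<kappa>) x * \<phi>p \<kappa> x" and ?l = "\<lambda>x. ee (- \<kappa>) x * \<phi>m \<kappa> x" and ?k = "\<lambda>x. ee (- \<kappa>) x * \<psi>m \<kappa> x"
  let ?c = "jost_beta u \<phi>p \<kappa>"
  note g = jost_phi_sol[OF p] and l = jost_phi_sol[OF m] and k = jost_psi_sol[OF n]
  have "(LINT y|lborel. V \<kappa> ?g y + 1 * src \<kappa> y) = ?c"
    unfolding gauge_V[symmetric] jost_beta_def integral_mult_right_zero[symmetric] src_def
    by (simp add: algebra_simps)
  with sol_at_top[OF g] have top: "(?g \<longlongrightarrow> 0 + ?c) at_top" by (simp only:)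
  have "((\<lambda>x. (?g x + (- 1) * ?l x) + (- ?c) * ?k x) \<longlongrightarrow> (0 + ?c) + (- 1) * 0 + (- ?c) * 1) at_top"
    by (intro tendsto_add tendsto_mult_left top k(2) l(2))
  moreover have "sol \<kappa> 0 (\<lambda>x. (?g x + (- 1) * ?l x) + (- ?c) * ?k x)"
    using sol_add[OF sol_add[OF g(1) l(1), of "- 1"] k(1), of "- ?c"] by simp
  ultimately have "(?g x + (- 1) * ?l x) + (- ?c) * ?k x = 0" by (intro sol_zero[OF \<kappa>]) auto
  then have "ee (- \<kappa>) x * (\<phi>p \<kappa> x - \<phi>m \<kappa> x) = ee (- \<kappa>) x * (?c * \<psi>m \<kappa> x)" by (simp add: algebra_simps)
  then show ?thesis by (simp only: ee_mult_cancel)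
qed

section \<open>Derivative in the spectral parameter\<close>

lemma sol_eq_T:
  assumes g: "sol \<kappa> c g" and a: "(g \<longlongrightarrow> a) at_top"
  shows "g x = a + T \<kappa> g x + c * tsrc \<kappa> x"
proof -
  have "(LINT y:{x<..}|lborel. V \<kappa> g y + c * src \<kappa> y) = (LINT y|lborel. indicator {x<..} y *\<^sub>R V \<kappa> g y + c * (indicator {x<..} y *\<^sub>R src \<kappa> y))"
    unfolding set_lebesgue_integral_def by (simp add: scaleR_add_right)
  also have "\<dots> = (LINT y|lborel. indicator {x<..} y *\<^sub>R V \<kappa> g y) + (LINT y|lborel. c * (indicator {x<..} y *\<^sub>R src \<kappa> y))"
    by (rule Bochner_Integration.integral_add) (intro integrable_mult_right integrable_on_set V_integrable sol_L2[OF g] src_integrable; simp)+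
  finally have "(LINT y:{x<..}|lborel. V \<kappa> g y + c * src \<kappa> y) = - T \<kappa> g x - c * tsrc \<kappa> x"
    unfolding T_def tsrc_def set_lebesgue_integral_def integral_mult_right_zero by simp
  then show ?thesis using sol_at_top_imp[OF g a, of x] by simp
qed

lemma tsrc_bound: "cmod (tsrc \<kappa> x) \<le> Nu"
  unfolding tsrc_def norm_minus_cancel
  by (rule tail_norm_le[OF src_integrable]) (use integrable_norm[OF u_integrable] in \<open>auto simp: src_def norm_mult\<close>)

text \<open>The difference quotient \<open>D\<close> of \<open>G\<^sub>\<mu> = e\<^sub>-\<^sub>\<mu> \<psi>\<^sub>\<mu>\<^sup>-\<close> and the claimed derivative \<open>E\<close> satisfy
  \<open>(I - T\<^sub>\<kappa>)(D - E) = (T\<^sub>\<mu> - T\<^sub>\<kappa>) G\<^sub>\<mu> / (\<mu> - \<kappa>) - a tsrc\<close>, which tends to \<open>0\<close> uniformly, and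
  \<open>I - T\<^sub>\<kappa>\<close> is bounded below.\<close>

lemma jost_psi_derivative:
  assumes \<kappa>: "\<kappa> > 0" "\<kappa> \<notin> sigma_pp u"
    and \<psi>: "\<And>\<mu>. \<mu> > 0 \<Longrightarrow> \<mu> \<notin> sigma_pp u \<Longrightarrow> jost_psi at_top u s \<mu> (\<psi>m \<mu>)"
    and \<phi>: "jost_phi at_top u s \<kappa> (\<phi>m \<kappa>)"
  shows "((\<lambda>l. ee (- l) x * \<psi>m l x) has_vector_derivative
     (1 / (2 * complex_of_real pi) * (LINT y|lborel. cnj (u y) * \<psi>m \<kappa> y)) * (ee (- \<kappa>) x * \<phi>m \<kappa> x)) (at \<kappa>)"
proof -
  let ?G = "\<lambda>\<mu> x. ee (- \<mu>) x * \<psi>m \<mu> x"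
  let ?p = "complex_of_real (1 / (2 * pi))"
  \<comment> \<open>The transform is taken at the fixed frequency -\<kappa> for every \<mu>, since T
    is linearised at \<kappa> and applied to the moving function \<open>?G \<mu>\<close>. At \<mu> =
    \<kappa> the characters cancel and \<open>a \<kappa>\<close> is the constant of the
    claim.\<close>
  define a where "a \<mu> = ?p * ft (\<lambda>y. cnj (u y) * ?G \<mu> y) (- \<kappa>)" for \<mu>
  let ?\<Phi> = "\<lambda>x. ee (- \<kappa>) x * \<phi>m \<kappa> x"
  obtain C d where C: "C > 0" and d: "d > 0" and bel: "\<And>\<mu>. \<bar>\<mu> - \<kappa>\<bar> < d \<Longrightarrow> (\<forall>g B M x. g \<in> borel_measurable borel \<longrightarrow> (\<forall>x. cmod (g x) \<le> B) \<longrightarrow>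
    (\<forall>x. cmod (g x - T \<mu> g x) \<le> M) \<longrightarrow> cmod (g x) \<le> C * M)"
    using T_bounded_below_nearby[OF \<kappa>] by blast
  \<comment> \<open>The hypothesis on \<open>\<psi>m\<close> speaks only of parameters off the point
    spectrum; this makes it available throughout a neighbourhood of \<kappa>.\<close>
  have nsig: "\<mu> \<notin> sigma_pp u" if "\<bar>\<mu> - \<kappa>\<bar> < d" for \<mu>
  proof
    assume "\<mu> \<in> sigma_pp u"
    then obtain g B x where g: "g \<in> borel_measurable borel" "\<forall>x. cmod (g x) \<le> B" "\<forall>x. g x = T \<mu> g x" "g x \<noteq> 0"
      using eigenvalue_imp_fixed_point by blast
    have "\<forall>x. cmod (g x - T \<mu> g x) \<le> 0" using g(3) by simp
    then have "cmod (g x) \<le> C * 0" using bel[OF that] g(1,2) by blast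
    then show False using g(4) by simp
  qed
  have G: "sol \<mu> 0 (?G \<mu>)" "(?G \<mu> \<longlongrightarrow> 1) at_top" if "\<bar>\<mu> - \<kappa>\<bar> < d" "\<mu> > 0" for \<mu>
    using jost_psi_sol[OF \<psi>[OF that(2) nsig[OF that(1)]]] by blast+
  have GT: "?G \<mu> x = 1 + T \<mu> (?G \<mu>) x" if "\<bar>\<mu> - \<kappa>\<bar> < d" "\<mu> > 0" for \<mu> x
    using sol_eq_T[OF G[OF that], of x] by simp
  have Gm: "?G \<mu> \<in> borel_measurable borel" if "\<bar>\<mu> - \<kappa>\<bar> < d" "\<mu> > 0" for \<mu>
    by (rule borel_measurable_continuous_onI[OF sol_continuous[OF G(1)[OF that]]])
  \<comment> \<open>The lower bound applied to (I - T) G = 1 bounds \<open>?G \<mu>\<close> by the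
    same C for all nearby \<mu>.\<close>
  have GC: "cmod (?G \<mu> x) \<le> C" if \<mu>: "\<bar>\<mu> - \<kappa>\<bar> < d" "\<mu> > 0" for \<mu> x
  proof -
    obtain B where B: "\<forall>x. cmod (?G \<mu> x) \<le> B" using sol_bounded[OF G(1)[OF \<mu>]] by blast
    have "?G \<mu> x - T \<mu> (?G \<mu>) x = 1" for x using GT[OF \<mu>, of x] by simp
    then have "\<forall>x. cmod (?G \<mu> x - T \<mu> (?G \<mu>) x) \<le> 1" by simp
    then have "cmod (?G \<mu> x) \<le> C * 1" using bel[OF \<mu>(1)] Gm[OF \<mu>] B by blast
    then show ?thesis by simp
  qed
  have k0: "\<bar>\<kappa> - \<kappa>\<bar> < d" using d by simp
  note GLk = L2_u_bounded[OF Gm[OF k0 \<kappa>(1)] GC[OF k0 \<kappa>(1)]]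
  note \<Phi> = jost_phi_sol[OF \<phi>]
  have \<Phi>m: "?\<Phi> \<in> borel_measurable borel"
    by (rule borel_measurable_continuous_onI[OF sol_continuous[OF \<Phi>(1)]])
  obtain B\<Phi> where B\<Phi>: "\<And>x. cmod (?\<Phi> x) \<le> B\<Phi>" using sol_bounded[OF \<Phi>(1)] by blast
  note \<Phi>L = L2_u_bounded[OF \<Phi>m B\<Phi>]
  have \<Phi>T: "?\<Phi> x = T \<kappa> ?\<Phi> x + tsrc \<kappa> x" for x
    using sol_eq_T[OF \<Phi>, of x] by simp
  \<comment> \<open>The outer C comes from inverting I - T. Inside are the error of linearising T on
    a function bounded by C, and the change of the coefficient a between \<mu> and \<kappa> times
    the bound \<open>Nu\<close> for \<open>tsrc\<close>.\<close>
  define R where "R \<mu> = C * (C * omega \<bar>\<mu> - \<kappa>\<bar> + (C * (\<bar>\<mu> - \<kappa>\<bar> * Nu\<^sup>2 * C)) * Nu * Nu)" for \<mu>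
  have main: "cmod ((?G \<mu> x - ?G \<kappa> x) / complex_of_real (\<mu> - \<kappa>) - a \<kappa> * ?\<Phi> x) \<le> R \<mu>"
    if \<mu>: "\<bar>\<mu> - \<kappa>\<bar> < d" "\<mu> > 0" and ne: "\<mu> \<noteq> \<kappa>" for \<mu> x
  proof -
    note m = Gm[OF \<mu>] and b = GC[OF \<mu>]
    note L = L2_u_bounded[OF m b]
    let ?e = "complex_of_real (\<mu> - \<kappa>)"
    have e0: "?e \<noteq> 0" using ne by simp
    \<comment> \<open>Lipschitz dependence, from (I - T) at \<kappa> applied to the difference of
      the two functions, which equals the difference of the two operators on
      \<open>?G \<mu>\<close>.\<close>
    have dG: "cmod (?G \<mu> x - ?G \<kappa> x) \<le> C * (\<bar>\<mu> - \<kappa>\<bar> * Nu\<^sup>2 * C)" for x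
    proof -
      let ?g = "\<lambda>x. ?G \<mu> x + (- 1) * ?G \<kappa> x"
      have "?g x - T \<kappa> ?g x = T \<mu> (?G \<mu>) x - T \<kappa> (?G \<mu>) x" for x
        using GT[OF \<mu>, of x] GT[OF k0 \<kappa>(1), of x] unfolding T_lincomb[OF L GLk] by simp
      then have le: "\<forall>x. cmod (?g x - T \<kappa> ?g x) \<le> \<bar>\<mu> - \<kappa>\<bar> * Nu\<^sup>2 * C"
        using T_diff_bound(1)[OF m b] by simp
      have "cmod (?g x) \<le> C + C" for x
        using norm_triangle_ineq4[of "?G \<mu> x" "?G \<kappa> x"] b[of x] GC[OF k0 \<kappa>(1), of x] by simp
      moreover have "?g \<in> borel_measurable borel" using m Gm[OF k0 \<kappa>(1)] by simp
      ultimately have "cmod (?g x) \<le> C * (\<bar>\<mu> - \<kappa>\<bar> * Nu\<^sup>2 * C)" using bel[OF k0] le by blast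
      then show ?thesis by simp
    qed
    have da: "cmod (a \<mu> - a \<kappa>) \<le> (C * (\<bar>\<mu> - \<kappa>\<bar> * Nu\<^sup>2 * C)) * Nu"
    proof -
      let ?g = "\<lambda>x. ?G \<mu> x - ?G \<kappa> x"
      have gm: "?g \<in> borel_measurable borel" using m Gm[OF k0 \<kappa>(1)] by simp
      note fi = u_mult_bounded(1)[OF gm dG] and fB = u_mult_bounded(2)[OF gm dG]
      have "ft (\<lambda>y. cnj (u y) * ?G \<mu> y) (- \<kappa>) - ft (\<lambda>y. cnj (u y) * ?G \<kappa> y) (- \<kappa>) = ft (\<lambda>y. cnj (u y) * ?g y) (- \<kappa>)"
        unfolding right_diff_distrib
        by (rule ft_diff[symmetric, OF u_mult_bounded(1)[OF m b] u_mult_bounded(1)[OF Gm[OF k0 \<kappa>(1)] GC[OF k0 \<kappa>(1)]]])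
      then have "cmod (a \<mu> - a \<kappa>) = 1 / (2 * pi) * cmod (ft (\<lambda>y. cnj (u y) * ?g y) (- \<kappa>))"
        unfolding a_def right_diff_distrib[symmetric] by (simp add: norm_mult norm_divide)
      also have "\<dots> \<le> 1 * cmod (ft (\<lambda>y. cnj (u y) * ?g y) (- \<kappa>))"
        using pi_gt3 by (intro mult_right_mono) auto
      also have "\<dots> \<le> (C * (\<bar>\<mu> - \<kappa>\<bar> * Nu\<^sup>2 * C)) * Nu"
        using order_trans[OF ft_bound[OF fi] fB] by simp
      finally show ?thesis .
    qed
    let ?D = "\<lambda>x. (?G \<mu> x + (- 1) * ?G \<kappa> x)"
    \<comment> \<open>This is \<mu> - \<kappa> times the gap between the difference quotient and the
      claimed derivative; division by the increment is postponed until the estimate is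
      complete.\<close>
    let ?E = "\<lambda>x. ?D x + (- (?e * a \<kappa>)) * ?\<Phi> x"
    have DL: "L2 (\<lambda>x. cnj (u x) * ?D x)"
      using L2_diff[OF L GLk] by (simp add: right_diff_distrib)
    have "?E x - T \<kappa> ?E x = (T \<mu> (?G \<mu>) x - T \<kappa> (?G \<mu>) x - ?e * a \<mu> * tsrc \<kappa> x) + ?e * (a \<mu> - a \<kappa>) * tsrc \<kappa> x" for x
      using GT[OF \<mu>, of x] GT[OF k0 \<kappa>(1), of x] \<Phi>T[of x]
      unfolding T_lincomb[OF DL \<Phi>L] T_lincomb[OF L GLk] by (simp add: algebra_simps)
    moreover have "cmod ((T \<mu> (?G \<mu>) x - T \<kappa> (?G \<mu>) x - ?e * a \<mu> * tsrc \<kappa> x) + ?e * (a \<mu> - a \<kappa>) * tsrc \<kappa> x)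
      \<le> \<bar>\<mu> - \<kappa>\<bar> * (C * omega \<bar>\<mu> - \<kappa>\<bar> + (C * (\<bar>\<mu> - \<kappa>\<bar> * Nu\<^sup>2 * C)) * Nu * Nu)" for x
    proof -
      have "cmod (?e * (a \<mu> - a \<kappa>) * tsrc \<kappa> x) \<le> \<bar>\<mu> - \<kappa>\<bar> * ((C * (\<bar>\<mu> - \<kappa>\<bar> * Nu\<^sup>2 * C)) * Nu) * Nu"
        unfolding norm_mult norm_of_real using C
        by (intro mult_mono da tsrc_bound mult_nonneg_nonneg) auto
      with T_diff_bound(2)[OF m b, of \<mu> x \<kappa>]
      have "cmod (T \<mu> (?G \<mu>) x - T \<kappa> (?G \<mu>) x - ?e * a \<mu> * tsrc \<kappa> x) + cmod (?e * (a \<mu> - a \<kappa>) * tsrc \<kappa> x)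
        \<le> \<bar>\<mu> - \<kappa>\<bar> * C * omega \<bar>\<mu> - \<kappa>\<bar> + \<bar>\<mu> - \<kappa>\<bar> * ((C * (\<bar>\<mu> - \<kappa>\<bar> * Nu\<^sup>2 * C)) * Nu) * Nu"
        unfolding a_def by (rule add_mono)
      then show ?thesis
        by (intro order_trans[OF norm_triangle_ineq]) (simp only: distrib_left mult.assoc)
    qed
    ultimately have le: "\<forall>x. cmod (?E x - T \<kappa> ?E x) \<le> \<bar>\<mu> - \<kappa>\<bar> * (C * omega \<bar>\<mu> - \<kappa>\<bar> + (C * (\<bar>\<mu> - \<kappa>\<bar> * Nu\<^sup>2 * C)) * Nu * Nu)"
      by (simp only:) simp
    have "cmod (?E x) \<le> (C + C) + cmod (?e * a \<kappa>) * B\<Phi>" for x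
    proof -
      have 1: "cmod (?D x) \<le> C + C"
        using norm_triangle_ineq4[of "?G \<mu> x" "?G \<kappa> x"] b[of x] GC[OF k0 \<kappa>(1), of x] by simp
      have 2: "cmod ((- (?e * a \<kappa>)) * ?\<Phi> x) \<le> cmod (?e * a \<kappa>) * B\<Phi>"
        unfolding norm_mult[of "- (?e * a \<kappa>)"] norm_minus_cancel by (intro mult_left_mono B\<Phi>) simp
      show ?thesis by (rule norm_triangle_le[OF add_mono[OF 1 2]])
    qed
    moreover have "?E \<in> borel_measurable borel" using m Gm[OF k0 \<kappa>(1)] \<Phi>m by simp
    ultimately have "cmod (?E x) \<le> C * (\<bar>\<mu> - \<kappa>\<bar> * (C * omega \<bar>\<mu> - \<kappa>\<bar> + (C * (\<bar>\<mu> - \<kappa>\<bar> * Nu\<^sup>2 * C)) * Nu * Nu))"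
      using bel[OF k0] le by blast
    then have "cmod (?E x) \<le> \<bar>\<mu> - \<kappa>\<bar> * R \<mu>" unfolding R_def by (simp only: mult.left_commute)
    moreover have "?E x = ?e * ((?G \<mu> x - ?G \<kappa> x) / ?e - a \<kappa> * ?\<Phi> x)"
    proof -
      have gen: "(A + (- 1) * B) + (- (e * w)) * P = e * ((A - B) / e - w * P)" if "e \<noteq> 0" for A B e w P :: complex
        using that by (simp add: field_simps)
      show ?thesis by (rule gen[OF e0])
    qed
    ultimately have "\<bar>\<mu> - \<kappa>\<bar> * cmod ((?G \<mu> x - ?G \<kappa> x) / ?e - a \<kappa> * ?\<Phi> x) \<le> \<bar>\<mu> - \<kappa>\<bar> * R \<mu>"
      by (simp only: norm_mult norm_of_real)
    then show ?thesis using ne by (simp add: mult_le_cancel_left_pos)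
  qed
  have R0: "(R \<longlongrightarrow> 0) (at \<kappa>)"
    unfolding tendsto_at_iff_sequentially comp_def
  proof (intro allI impI)
    fix \<mu> :: "nat \<Rightarrow> real" assume "\<mu> \<longlonglongrightarrow> \<kappa>"
    then have l: "(\<lambda>n. \<bar>\<mu> n - \<kappa>\<bar>) \<longlonglongrightarrow> 0" by (simp add: tendsto_rabs_zero LIM_zero)
    have "(\<lambda>n. C * (C * omega \<bar>\<mu> n - \<kappa>\<bar> + (C * (\<bar>\<mu> n - \<kappa>\<bar> * Nu\<^sup>2 * C)) * Nu * Nu)) \<longlonglongrightarrow> C * (C * 0 + (C * (0 * Nu\<^sup>2 * C)) * Nu * Nu)"
      by (intro tendsto_intros l omega_tendsto) simp
    then show "(\<lambda>n. R (\<mu> n)) \<longlonglongrightarrow> 0" by (simp add: R_def)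
  qed
  have "((\<lambda>\<mu>. (?G \<mu> x - ?G \<kappa> x) / complex_of_real (\<mu> - \<kappa>) - a \<kappa> * ?\<Phi> x) \<longlongrightarrow> 0) (at \<kappa>)"
  proof (rule Lim_null_comparison[OF _ R0])
    \<comment> \<open>The radius is capped by \<kappa> so that \<mu> stays positive.\<close>
    have "\<forall>\<^sub>F \<mu> in at \<kappa>. dist \<mu> \<kappa> < min d \<kappa>"
      unfolding eventually_at using d \<kappa>(1) by (intro exI[of _ "min d \<kappa>"]) auto
    moreover have "\<forall>\<^sub>F \<mu> in at \<kappa>. \<mu> \<noteq> \<kappa>" by (simp add: eventually_at_filter)
    ultimately show "\<forall>\<^sub>F \<mu> in at \<kappa>. norm ((?G \<mu> x - ?G \<kappa> x) / complex_of_real (\<mu> - \<kappa>) - a \<kappa> * ?\<Phi> x) \<le> R \<mu>"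
    proof eventually_elim
      case (elim \<mu>)
      then have "\<bar>\<mu> - \<kappa>\<bar> < d" "\<mu> > 0" by (auto simp: dist_real_def)
      then show ?case by (intro main elim) auto
    qed
  qed
  note quot = tendsto_norm_zero[OF this]
  have "((\<lambda>\<mu>. ?G \<mu> x) has_vector_derivative a \<kappa> * ?\<Phi> x) (at \<kappa>)"
    unfolding has_vector_derivative_def has_derivative_iff_norm
  proof (intro conjI bounded_linear_scaleR_left)
    show "((\<lambda>\<mu>. norm (?G \<mu> x - ?G \<kappa> x - (\<mu> - \<kappa>) *\<^sub>R (a \<kappa> * ?\<Phi> x)) / norm (\<mu> - \<kappa>)) \<longlongrightarrow> 0) (at \<kappa>)"
    proof (rule Lim_transform_eventually[OF quot], unfold eventually_at_filter, intro always_eventually allI impI)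
      fix \<mu> :: real assume "\<mu> \<noteq> \<kappa>"
      then have e0: "complex_of_real (\<mu> - \<kappa>) \<noteq> 0" by simp
      have gen: "D / e - w = (D - e * w) / e" if "e \<noteq> 0" for D e w :: complex
        using that by (simp add: diff_divide_distrib)
      show "norm ((?G \<mu> x - ?G \<kappa> x) / complex_of_real (\<mu> - \<kappa>) - a \<kappa> * ?\<Phi> x)
        = norm (?G \<mu> x - ?G \<kappa> x - (\<mu> - \<kappa>) *\<^sub>R (a \<kappa> * ?\<Phi> x)) / norm (\<mu> - \<kappa>)"
        unfolding gen[OF e0] scaleR_conv_of_real norm_divide norm_of_real real_norm_def ..
    qed
  qed
  moreover have "a \<kappa> = 1 / (2 * complex_of_real pi) * (LINT y|lborel. cnj (u y) * \<psi>m \<kappa> y)"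
  proof -
    have "cnj (u y) * (ee (- \<kappa>) y * \<psi>m \<kappa> y) * ee (- (- \<kappa>)) y = cnj (u y) * \<psi>m \<kappa> y" for y
      using ee_cancel(1)[of \<kappa> y] by (simp add: mult_ac)
    then show ?thesis unfolding a_def ft_def by (simp only:) simp
  qed
  ultimately show ?thesis by simp
qed

end

theorem theorem1p4:
  fixes u :: "real \<Rightarrow> complex" and s :: real
    and \<phi>p \<phi>m \<psi>p \<psi>m :: "real \<Rightarrow> real \<Rightarrow> complex"
  assumes "s > 1 / 2"
    and "Hplus 1 u" and "L2w s u"
    and "\<And>\<kappa>. \<kappa> \<in> {0<..} - sigma_pp u \<Longrightarrow> jost_phi at_bot u s \<kappa> (\<phi>p \<kappa>)"
    and "\<And>\<kappa>. \<kappa> \<in> {0<..} - sigma_pp u \<Longrightarrow> jost_phi at_top u s \<kappa> (\<phi>m \<kappa>)"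
    and "\<And>\<kappa>. \<kappa> \<in> {0<..} - sigma_pp u \<Longrightarrow> jost_psi at_bot u s \<kappa> (\<psi>p \<kappa>)"
    and "\<And>\<kappa>. \<kappa> \<in> {0<..} - sigma_pp u \<Longrightarrow> jost_psi at_top u s \<kappa> (\<psi>m \<kappa>)"
  shows "\<forall>\<kappa> \<in> {0<..} - sigma_pp u.
      (\<forall>x. \<psi>p \<kappa> x = jost_Gamma u \<psi>p \<kappa> * \<psi>m \<kappa> x) \<and>
      (\<forall>x. \<phi>p \<kappa> x - \<phi>m \<kappa> x = jost_beta u \<phi>p \<kappa> * \<psi>m \<kappa> x) \<and>
      (\<forall>x. (\<lambda>l. ee (- l) x * \<psi>m l x) differentiable (at \<kappa>) \<and>
           ee \<kappa> x * vector_derivative (\<lambda>l. ee (- l) x * \<psi>m l x) (at \<kappa>)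
             = (1 / (2 * complex_of_real pi) * (LINT y|lborel. cnj (u y) * \<psi>m \<kappa> y)) * \<phi>m \<kappa> x)"
proof (intro ballI conjI allI)
  interpret lax_potential u s by unfold_locales (fact assms(1-3))+
  fix \<kappa> x assume \<kappa>: "\<kappa> \<in> {0<..} - sigma_pp u"
  then have k: "\<kappa> > 0" "\<kappa> \<notin> sigma_pp u" by auto
  show "\<psi>p \<kappa> x = jost_Gamma u \<psi>p \<kappa> * \<psi>m \<kappa> x"
    by (rule jost_psi_identity[where \<psi>p = \<psi>p and \<psi>m = \<psi>m, OF k assms(6,7)[OF \<kappa>]])
  show "\<phi>p \<kappa> x - \<phi>m \<kappa> x = jost_beta u \<phi>p \<kappa> * \<psi>m \<kappa> x"
    by (rule jost_phi_identity[where \<phi>p = \<phi>p and \<phi>m = \<phi>m and \<psi>m = \<psi>m, OF k assms(4,5,7)[OF \<kappa>]])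
  have "jost_psi at_top u s \<mu> (\<psi>m \<mu>)" if "\<mu> > 0" "\<mu> \<notin> sigma_pp u" for \<mu>
    using assms(7)[of \<mu>] that by simp
  note d = jost_psi_derivative[where \<psi>m = \<psi>m and \<phi>m = \<phi>m, OF k this assms(5)[OF \<kappa>], of x]
  show "(\<lambda>l. ee (- l) x * \<psi>m l x) differentiable (at \<kappa>)" using d by (rule differentiableI_vector)
  show "ee \<kappa> x * vector_derivative (\<lambda>l. ee (- l) x * \<psi>m l x) (at \<kappa>)
             = (1 / (2 * complex_of_real pi) * (LINT y|lborel. cnj (u y) * \<psi>m \<kappa> y)) * \<phi>m \<kappa> x"
  proof -
    have vd: "vector_derivative (\<lambda>l. ee (- l) x * \<psi>m l x) (at \<kappa>)
      = (1 / (2 * complex_of_real pi) * (LINT y|lborel. cnj (u y) * \<psi>m \<kappa> y)) * (ee (- \<kappa>) x * \<phi>m \<kappa> x)"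
      by (rule vector_derivative_at[OF d])
    have gen: "ee \<kappa> x * (w * (ee (- \<kappa>) x * z)) = w * z" for w z
      using ee_cancel(3)[of \<kappa> x "w * z"] by (simp add: mult.left_commute)
    show ?thesis unfolding vd by (rule gen)
  qed
qed

end
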